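(* Let $b \in H^\infty(\mathbb{D})$ with $\|b\|_\infty = 1$. Then $b$ is one-component if and only if there exists a constant $0<C_1<1$ such that $\sigma_b(Q(z)) = 0$ for every $z \in \mathbb{D}\setminus\{0\}$ with $|b(z)| \geq C_1$.
   Context: $\mathbb{D}$ is the open unit disc, $H^\infty(\mathbb{D})$ the bounded analytic functions on $\mathbb{D}$, $\|b\|_\infty=\sup_{z\in\mathbb{D}}|b(z)|$, and $m$ is normalized Lebesgue measure on $\partial\mathbb{D}$. For $b\in H^\infty(\mathbb{D})$ with $\|b\|_\infty=1$, the spectrum of $b$ is $\mathrm{spec}(b)=\{\xi\in\partial\mathbb{D}: \liminf_{z\to\xi, z\in\mathbb{D}}|b(z)|<1\}$. Such a $b$ is called one-component if there is a constant $0<C<1$ such that (a) $\mathrm{spec}(b)\subseteq\overline{\{z\in\mathbb{D}:|b(z)|\le C\}}$ and (b) the set $\{z\in\mathbb{D}:|b(z)|<C\}$ is connected. If $b=B_{\{z_n\}}S_\mu O_b$ is the canonical factorization of $b$ into a Blaschke product with zeros $\{z_n\}$ (with multiplicity), a singular inner function with singular measure $\mu$ on $\partial\mathbb{D}$ and an outer function, define the positive measure on $\overline{\mathbb{D}}$ $$d\sigma_b=\sum_n(1-|z_n|)\delta_{z_n}+d\mu+\log|b|^{-1}\,dm,$$ where the last two terms live on $\partial\mathbb{D}$. For $z\in\mathbb{D}\setminus\{0\}$, the Carleson square is $Q(z)=\{w\in\overline{\mathbb{D}}\setminus\{0\}: |z|<|w|\le 1,\ |w/|w|-z/|z||<(1-|z|)/2\}$;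 i.e. it is understood to include its boundary arc on $\partial\mathbb{D}$, so that $\sigma_b(Q(z))$ counts zeros of $b$ in the square as well as the mass of $\mu$ and of $\log|b|^{-1}dm$ on the arc $\{\xi\in\partial\mathbb{D}:|\xi-z/|z||<(1-|z|)/2\}$. *)

theory Defs
  imports "HOL-Complex_Analysis.Complex_Analysis"
begin

definition Hinf :: "(complex \<Rightarrow> complex) \<Rightarrow> bool" where
  "Hinf b \<longleftrightarrow> b holomorphic_on ball 0 1 \<and> bounded (b ` ball 0 1)"

definition sup_norm :: "(complex \<Rightarrow> complex) \<Rightarrow> real" where
  "sup_norm b = (SUP z\<in>ball 0 1. cmod (b z))"

definition spec :: "(complex \<Rightarrow> complex) \<Rightarrow> complex set" where
  "spec b = {\<xi> \<in> sphere 0 1. Liminf (at \<xi> within ball 0 1) (\<lambda>z. ereal (cmod (b z))) < 1}"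

definition one_component :: "(complex \<Rightarrow> complex) \<Rightarrow> bool" where
  "one_component b \<longleftrightarrow> (\<exists>C::real. 0 < C \<and> C < 1 \<and>
      spec b \<subseteq> closure {z \<in> ball 0 1. cmod (b z) \<le> C} \<and>
      connected {z \<in> ball 0 1. cmod (b z) < C})"

definition carleson_square :: "complex \<Rightarrow> complex set" where
  "carleson_square z = {w. w \<noteq> 0 \<and> cmod z < cmod w \<and> cmod w \<le> 1 \<and>
      cmod (w / of_real (cmod w) - z / of_real (cmod z)) < (1 - cmod z) / 2}"

definition zeros_in :: "(complex \<Rightarrow> complex) \<Rightarrow> complex set" where
  "zeros_in b = {a \<in> ball 0 1. b a = 0}"

definition log_blaschke :: "(complex \<Rightarrow> complex) \<Rightarrow> complex \<Rightarrow> real" where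
  "log_blaschke b z = infsum (\<lambda>a. real (nat (zorder b a)) *
       ln (cmod ((z - a) / (1 - cnj a * z)))) (zeros_in b)"

definition poisson_kernel :: "complex \<Rightarrow> complex \<Rightarrow> real" where
  "poisson_kernel z \<xi> = (1 - (cmod z)^2) / (cmod (\<xi> - z))^2"

text \<open>nu = mu + log|b|^{-1} dm is the (unique) finite positive Borel measure on the circle with
  -log |S_mu O_b(z)| = -log|b(z)/B(z)| = Poisson integral of nu at z.\<close>
definition boundary_rep :: "(complex \<Rightarrow> complex) \<Rightarrow> complex measure \<Rightarrow> bool" where
  "boundary_rep b \<nu> \<longleftrightarrow> sets \<nu> = sets borel \<and> finite_measure \<nu> \<and>
     emeasure \<nu> (- sphere 0 1) = 0 \<and>
     (\<forall>z\<in>ball 0 1. b z \<noteq> 0 \<longrightarrow>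
        integrable \<nu> (poisson_kernel z) \<and>
        - ln (cmod (b z)) + log_blaschke b z = integral\<^sup>L \<nu> (poisson_kernel z))"

definition boundary_measure :: "(complex \<Rightarrow> complex) \<Rightarrow> complex measure" where
  "boundary_measure b = (THE \<nu>. boundary_rep b \<nu>)"

definition sigma_b :: "(complex \<Rightarrow> complex) \<Rightarrow> complex set \<Rightarrow> ennreal" where
  "sigma_b b A = infsum (\<lambda>a. ennreal ((1 - cmod a) * real (nat (zorder b a)))) (zeros_in b \<inter> A)
      + emeasure (boundary_measure b) (A \<inter> sphere 0 1)"

end

theory Submission
  imports Defs "HOL-Probability.Probability"
begin

text \<open>
  Write $u = -\log |b|$. Dividing $b$ by its Blaschke products and applying Herglotz' theorem represents $u$ by the zeros of
  $b$ and a unique measure on the circle. Consequently $|b| \to 1$ at every boundary point near which the zeros and the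
  measure are absent, and conversely the measure vanishes on arcs where $|b| \to 1$.

  If $b$ is one-component and the square of $z$ is charged, a curve in the connected set $|b| < C$ starts in the square and
  runs far away. Either it comes close to $z$, and Harnack's inequality bounds $|b(z)|$ away from $1$, or it
  stays close to the circle and crosses a box next to the square; then the maximum principle above the curve gives the bound.

  Conversely, charged squares increase along radii towards the origin, so a component $V$ of $|b| < C$ missing the origin
  has no zeros, avoids the radii ending at the points where its closure meets the circle, and hence lies in a sector that it
  touches at the two end points only. Comparison with Poisson integrals shows
  $u = O(1/|z - \xi|)$ in $V$ at these points $\xi$. As the corners are right angles, growth of order less
  than $2$ is excluded by the Phragmen-Lindelof principle, so $u$ cannot exceed $\log (1/C)$ in $V$.
\<close>

section \<open>A maximum principle with boundary limits\<close>

text \<open>How much mass a charged square carries does not matter, only whether it is charged. What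
  must be uniform is the constant, and scaling provides this: with y = - ln |z|, the map \<zeta>
  \<mapsto> (z / |z|) * exp (i * y * \<zeta>) sends i to z and pulls the part of the square in the
  open disc back into the fixed box |Re \<zeta>| < 1, 0 < Im \<zeta> < 1. Both alternatives for the
  curve are then estimates in fixed boxes, with the constants 16 and sinh (pi/2) / sinh pi. In the
  converse the obstacle is that u may be unbounded in V, so the plain maximum principle says
  nothing. The right angles come from the lift z = exp (i * \<zeta>), under which radii become
  vertical half lines. The level C is taken strictly between C1 and 1, because |b| < C1 along a
  charged radius yields only |b(0)| \<le> C1 in the limit, and the origin has to lie in the sublevel
  set as well.\<close>

lemma max_mod_limsup:
  fixes f :: "complex \<Rightarrow> complex"
  assumes V: "open V" "bounded V" and f: "f holomorphic_on V"
    and bd: "\<And>\<xi> \<epsilon>. \<xi> \<in> frontier V \<Longrightarrow> 0 < \<epsilon> \<Longrightarrow> \<forall>\<^sub>F z in at \<xi> within V. cmod (f z) \<le> 1 + \<epsilon>"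
    and z: "z \<in> V"
  shows "cmod (f z) \<le> 1"
proof (rule ccontr)
  assume "\<not> cmod (f z) \<le> 1"
  then obtain \<epsilon> where \<epsilon>: "0 < \<epsilon>" "1 + \<epsilon> < cmod (f z)"
    by (metis add.commute dense less_diff_eq diff_gt_0_iff_gt not_less)
  have "\<forall>\<xi>\<in>frontier V. \<exists>U. open U \<and> \<xi> \<in> U \<and> (\<forall>z\<in>U. z \<noteq> \<xi> \<longrightarrow> z \<in> V \<longrightarrow> cmod (f z) \<le> 1 + \<epsilon>)"
    using bd[OF _ \<epsilon>(1)] unfolding eventually_at_topological by blast
  then obtain U where U: "\<And>\<xi>. \<xi> \<in> frontier V \<Longrightarrow> open (U \<xi>) \<and> \<xi> \<in> U \<xi> \<and>
      (\<forall>z\<in>U \<xi>. z \<noteq> \<xi> \<longrightarrow> z \<in> V \<longrightarrow> cmod (f z) \<le> 1 + \<epsilon>)"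
    by metis
  define K where "K = closure V - (\<Union>\<xi>\<in>frontier V. U \<xi>)"
  have fV: "frontier V \<inter> V = {}"
    using V(1) by (auto simp: frontier_def interior_open)
  have K: "compact K"
    unfolding K_def using V U by (intro compact_diff) (auto simp: compact_closure intro!: open_UN)
  have KV: "K \<subseteq> V"
    using U V(1) unfolding K_def frontier_def by (auto simp: interior_open)
  have out: "cmod (f w) \<le> 1 + \<epsilon>" if w: "w \<in> V" "w \<notin> K" for w
  proof -
    have "w \<in> closure V" using w closure_subset by blast
    then obtain \<xi> where \<xi>: "\<xi> \<in> frontier V" "w \<in> U \<xi>"
      using w unfolding K_def by auto
    moreover have "w \<noteq> \<xi>" using fV w \<xi> by auto
    ultimately show ?thesis using U[OF \<xi>(1)] w by simp
  qed
  have zK: "z \<in> K" using out[OF z] \<epsilon> by linarith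
  have contf: "continuous_on V f" using f by (rule holomorphic_on_imp_continuous_on)
  obtain k where k: "k \<in> K" "\<And>w. w \<in> K \<Longrightarrow> cmod (f w) \<le> cmod (f k)"
    using continuous_attains_sup[OF K, of "\<lambda>w. cmod (f w)"] zK continuous_on_subset[OF contf KV]
    by (auto intro: continuous_on_norm)
  have kmax: "cmod (f w) \<le> cmod (f k)" if "w \<in> V" for w
    using k(2)[of w] k(2)[OF zK] out[OF that] \<epsilon> by linarith
  \<comment> \<open>\<open>V\<close> need not be connected, so \<open>f\<close> is constant only on
    the component of the maximum point. The large value keeps that component inside the compact
    \<open>K\<close>; it is then closed as well as open, and a nonempty open set cannot be
    compact.\<close>
  define W where "W = connected_component_set V k"
  have W: "open W" "connected W" "W \<subseteq> V" "k \<in> W"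
    unfolding W_def using V k(1) KV open_connected_component[of V k] connected_component_subset[of V k]
    by (simp_all add: subset_eq connected_component_refl_eq)
  have "f constant_on W"
    by (rule maximum_modulus_principle[OF holomorphic_on_subset[OF f W(3)] W(1,2,1) subset_refl W(4)]) (use kmax W in auto)
  then have const: "f w = f k" if "w \<in> W" for w
    using W that unfolding constant_on_def by metis
  have "W \<subseteq> K"
    proof
    fix w assume "w \<in> W"
    then show "w \<in> K" using const[of w] out[of w] W(3) \<epsilon> k(2)[OF zK] by fastforce
  qed
  then have "closure W \<subseteq> V"
    using K KV closure_minimal compact_imp_closed by blast
  moreover have "connected (closure W)" using W connected_imp_connected_closure by blast
  ultimately have "closure W \<subseteq> W"
    using connected_component_maximal[of k "closure W" V, folded W_def] W(4) closure_subset[of W] by blast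
  then have "closed W" using closure_subset[of W] closure_closed[of W] closure_eq by blast
  moreover have "bounded W" using W(3) V(2) bounded_subset by blast
  ultimately have "compact W" by (simp add: compact_eq_bounded_closed)
  then show False using W(1,4) compact_open[of W] by blast
qed

section \<open>The Poisson integral\<close>

text \<open>The normalised angle. It lives on the line rather than on the circle so that compactness
  of tight sequences of real distributions is available for Herglotz' theorem.\<close>

definition circ :: "real measure" where
  "circ = uniform_measure lborel {0..2*pi}"

lemma prob_circ: "prob_space circ"
  unfolding circ_def by (rule prob_space_uniform_measure) auto

lemma sets_circ[simp, measurable_cong]: "sets circ = sets borel" and space_circ[simp]: "space circ = UNIV"
  by (auto simp: circ_def)

lemma integral_circ:
  fixes f :: "real \<Rightarrow> 'a::euclidean_space"
  assumes "continuous_on UNIV f"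
  shows "integrable circ f" "integral\<^sup>L circ f = (1 / (2*pi)) *\<^sub>R integral {0..2*pi} f"
proof -
  have c: "continuous_on {0..2*pi} f" using assms continuous_on_subset by blast
  have i: "set_integrable lborel {0..2*pi} f"
    by (rule borel_integrable_atLeastAtMost') (rule c)
  have m: "f \<in> borel_measurable lborel" using assms by (simp add: borel_measurable_continuous_onI)
  have d: "circ = density lborel (\<lambda>x. ennreal (indicator {0..2*pi} x / (2*pi)))"
    unfolding circ_def uniform_measure_def
    by (intro arg_cong2[where f=density] refl ext) (auto simp: divide_ennreal split: split_indicator simp: ennreal_1[symmetric] simp del: ennreal_1)
  have eq: "(\<lambda>x. (indicator {0..2*pi} x / (2*pi)) *\<^sub>R f x) = (\<lambda>x. (1/(2*pi)) *\<^sub>R (indicator {0..2*pi} x *\<^sub>R f x))"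
    by auto
  show "integrable circ f"
    unfolding d using m i
    by (subst integrable_density) (auto simp: eq set_integrable_def simp del: scaleR_scaleR)
  show "integral\<^sup>L circ f = (1 / (2*pi)) *\<^sub>R integral {0..2*pi} f"
    unfolding d using m i
    by (subst integral_density) (auto simp: eq set_borel_integral_eq_integral(2)[OF i, symmetric] set_lebesgue_integral_def simp del: scaleR_scaleR)
qed

text \<open>Cauchy's formula for \<open>F\<close> times (1 - |z|^2) / (1 - cnj z * w). The extra
  factor is 1 at w = z, and on the circle, where 1 - cnj z * w = w * cnj (w - z), it turns the
  Cauchy kernel into the Poisson kernel.\<close>

lemma poisson_integral_holomorphic:
  assumes F: "F holomorphic_on cball 0 1" and z: "cmod z < 1"
  shows "F z = integral\<^sup>L circ (\<lambda>t. of_real (poisson_kernel z (cis t)) * F (cis t))"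
proof -
  define K where "K = (\<lambda>w. F w * (1 - (cmod z)^2) / (1 - cnj z * w))"
  have nz: "1 - cnj z * w \<noteq> 0" if "cmod w \<le> 1" for w
  proof
    assume "1 - cnj z * w = 0"
    then have "cmod (cnj z * w) = 1" by simp
    moreover have "cmod z * cmod w < 1" using that z 
      by (metis mult_left_le norm_ge_zero order_le_less_trans)
    ultimately show False by (simp add: norm_mult)
  qed
  have K: "K holomorphic_on cball 0 1"
    unfolding K_def using F nz by (intro holomorphic_intros) auto
  have zz: "(1 - complex_of_real ((cmod z)^2)) = 1 - cnj z * z"
    by (metis complex_norm_square mult.commute)
  have Kz: "K z = F z"
    unfolding K_def using nz[of z] z zz by simp
  have *: "((\<lambda>u. K u/(u-z)) has_contour_integral (2 * of_real pi * \<i> * K z)) (circlepath 0 1)"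
    using Cauchy_integral_circlepath_simple[OF K] z by simp
  have eq: "K (cis t) / (cis t - z) * \<i> * cis t = \<i> * (of_real (poisson_kernel z (cis t)) * F (cis t))" for t
  proof -
    have 1: "1 - cnj z * cis t = cis t * cnj (cis t - z)"
      by (simp add: algebra_simps cis_mult cis_cnj)
    have 2: "cis t - z \<noteq> 0" using z by auto
    have 3: "complex_of_real ((cmod (cis t - z))^2) = (cis t - z) * cnj (cis t - z)"
      using complex_norm_square by blast
    have gen: "F' * n / (c * B) / A * \<i> * c = \<i> * (n / (A * B) * F')"
      if "A \<noteq> 0" "B \<noteq> 0" "c \<noteq> 0" for A B c F' n :: complex
      using that by (simp add: field_simps)
    show ?thesis
      unfolding K_def poisson_kernel_def of_real_divide 1 3
      by (subst gen) (use 2 in \<open>auto simp del: complex_cnj_diff\<close>)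
  qed
  have "((\<lambda>t. K (cis t) / (cis t - z) * \<i> * cis t) has_integral (2 * of_real pi * \<i> * F z)) {0..2*pi}"
    using * unfolding circlepath_def
    by (subst (asm) has_contour_integral_part_circlepath_iff) (auto simp: Kz)
  then have "((\<lambda>t. \<i> * (of_real (poisson_kernel z (cis t)) * F (cis t))) has_integral (\<i> * (2 * of_real pi * F z))) {0..2*pi}"
    unfolding eq by (simp add: mult_ac)
  then have "((\<lambda>t. -\<i> * (\<i> * (of_real (poisson_kernel z (cis t)) * F (cis t)))) has_integral (-\<i> * (\<i> * (2 * of_real pi * F z)))) {0..2*pi}"
    by (rule has_integral_mult_right)
  then have i: "integral {0..2*pi} (\<lambda>t. of_real (poisson_kernel z (cis t)) * F (cis t)) = 2 * of_real pi * F z"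
    by (intro integral_unique) (simp add: mult.assoc[symmetric])
  have "continuous_on UNIV (\<lambda>t. F (cis t))"
    by (rule continuous_on_compose2[OF holomorphic_on_imp_continuous_on[OF F]]) (auto intro!: continuous_intros)
  then have "continuous_on UNIV (\<lambda>t. of_real (poisson_kernel z (cis t)) * F (cis t))"
    unfolding poisson_kernel_def using z by (intro continuous_intros) auto
  from integral_circ(2)[OF this] i show ?thesis by (simp add: scaleR_conv_of_real)
qed


section \<open>Estimates for the Poisson kernel\<close>

lemma poisson_kernel_pos:
  assumes "cmod z < 1" "cmod \<xi> = 1" shows "0 < poisson_kernel z \<xi>"
proof -
  have "\<xi> \<noteq> z" using assms by auto
  moreover have "(cmod z)\<^sup>2 < 1" using assms by (simp add: power_less_one_iff)
  ultimately show ?thesis unfolding poisson_kernel_def by simp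
qed

text \<open>One factor |\<xi> - z| of the denominator absorbs 1 - |z|. The remaining first power is
  the source of the growth order 1 used in the Phragmen-Lindelof argument.\<close>

lemma poisson_kernel_le:
  assumes "cmod z < 1" "cmod \<xi> = 1" shows "poisson_kernel z \<xi> \<le> 2 / cmod (\<xi> - z)"
proof -
  have d: "0 < cmod (\<xi> - z)" "1 - cmod z \<le> cmod (\<xi> - z)"
    using assms norm_triangle_ineq2[of \<xi> z] by auto
  have "1 - (cmod z)\<^sup>2 = (1 - cmod z) * (1 + cmod z)" by (simp add: power2_eq_square algebra_simps)
  also have "\<dots> \<le> cmod (\<xi> - z) * 2" using d assms by (intro mult_mono) auto
  finally have "poisson_kernel z \<xi> \<le> cmod (\<xi> - z) * 2 / (cmod (\<xi> - z))^2"
    unfolding poisson_kernel_def by (intro divide_right_mono) auto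
  then show ?thesis using d by (simp add: power2_eq_square)
qed

lemma poisson_kernel_ge:
  assumes "cmod z < 1" "cmod \<xi> = 1" shows "poisson_kernel z \<xi> \<ge> (1 - cmod z) / (1 + cmod z)"
proof -
  have d: "0 < cmod (\<xi> - z)" "cmod (\<xi> - z) \<le> 1 + cmod z"
    using assms norm_triangle_ineq4[of \<xi> z] by auto
  have 1: "1 - (cmod z)\<^sup>2 = (1 - cmod z) * (1 + cmod z)" by (simp add: power2_eq_square algebra_simps)
  have "(1 - cmod z) / (1 + cmod z) = (1 - (cmod z)\<^sup>2) / (1 + cmod z)^2"
    unfolding 1 using assms norm_ge_zero[of z] by (simp add: power2_eq_square del: norm_ge_zero)
  also have "\<dots> \<le> poisson_kernel z \<xi>"
    unfolding poisson_kernel_def using d assms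
    by (intro divide_left_mono power_mono mult_pos_pos zero_less_power) (auto simp: power_le_one intro: add_pos_nonneg)
  finally show ?thesis .
qed

lemma poisson_kernel_continuous:
  assumes "cmod z < 1" shows "continuous_on UNIV (\<lambda>t. poisson_kernel z (cis t))"
  unfolding poisson_kernel_def using assms by (intro continuous_intros) auto

lemma poisson_kernel_eq_Re:
  assumes "cmod z < 1" "cmod \<xi> = 1" shows "poisson_kernel z \<xi> = Re (2 * \<xi> / (\<xi> - z) - 1)"
proof -
  have nz: "\<xi> - z \<noteq> 0" using assms by auto
  then have "2 * \<xi> / (\<xi> - z) - 1 = (\<xi> + z) / (\<xi> - z)" by (simp add: field_simps)
  also have "\<dots> = (\<xi> + z) * cnj (\<xi> - z) / of_real ((cmod (\<xi> - z))\<^sup>2)"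
    by (subst complex_div_cnj) simp
  also have "Re \<dots> = Re ((\<xi> + z) * cnj (\<xi> - z)) / (cmod (\<xi> - z))\<^sup>2"
    by (rule Re_divide_of_real)
  also have "Re ((\<xi> + z) * cnj (\<xi> - z)) = (cmod \<xi>)\<^sup>2 - (cmod z)\<^sup>2"
    by (simp add: cmod_power2) (simp add: algebra_simps power2_eq_square)
  finally show ?thesis using assms by (simp add: poisson_kernel_def)
qed

lemma integral_poisson_kernel:
  assumes "cmod z < 1" shows "integral\<^sup>L circ (\<lambda>t. poisson_kernel z (cis t)) = 1"
proof -
  have "1 = integral\<^sup>L circ (\<lambda>t. complex_of_real (poisson_kernel z (cis t)))"
    using poisson_integral_holomorphic[of "\<lambda>_. 1" z] assms by simp
  also have "\<dots> = of_real (integral\<^sup>L circ (\<lambda>t. poisson_kernel z (cis t)))" by (intro integral_of_real integral_circ poisson_kernel_continuous assms)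
  finally show ?thesis by (metis of_real_eq_1_iff)
qed

section \<open>The Dirichlet problem for continuous data\<close>

lemma continuous_on_sphere_cis:
  assumes "continuous_on (sphere 0 1) \<phi>" shows "continuous_on UNIV (\<lambda>t. \<phi> (cis t))"
  by (rule continuous_on_compose2[OF assms]) (auto intro!: continuous_intros)

text \<open>Integrating against the kernel 2 * \<xi> / (\<xi> - z) - 1, whose real part is the
  Poisson kernel, produces a holomorphic function and not just a harmonic one. Its exponential can
  then be used as a factor in the maximum modulus principle.\<close>

lemma dirichlet_holomorphic:
  fixes \<phi> :: "complex \<Rightarrow> real"
  assumes \<phi>: "continuous_on (sphere 0 1) \<phi>"
  obtains H where "H holomorphic_on ball 0 1"
    "\<And>z. cmod z < 1 \<Longrightarrow> Re (H z) = integral\<^sup>L circ (\<lambda>t. poisson_kernel z (cis t) * \<phi> (cis t))"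
proof -
  define f where "f = (\<lambda>u. complex_of_real (\<phi> u))"
  have f: "continuous_on (sphere 0 1) f" unfolding f_def using \<phi> by (intro continuous_intros)
  define g where "g w = contour_integral (circlepath 0 1) (\<lambda>u. f u / (u - w))" for w
  have int: "(\<lambda>u. f u / (u - w)) contour_integrable_on (circlepath 0 1)" if "cmod w < 1" for w
    by (rule contour_integrable_continuous_circlepath) (use f that in \<open>auto intro!: continuous_intros\<close>)
  have g: "g holomorphic_on ball 0 1"
  proof (subst holomorphic_on_open, simp, intro ballI)
    fix w assume w: "w \<in> ball (0::complex) 1"
    show "\<exists>f'. (g has_field_derivative f') (at w)"
      using Cauchy_next_derivative_circlepath(2)[of 0 1 f 1 g w] f w int
      by (auto simp: g_def has_contour_integral_integral)
  qed
  define H where "H z = g z / (pi * \<i>) - of_real (integral\<^sup>L circ (\<lambda>t. \<phi> (cis t)))" for z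
  have \<phi>c: "continuous_on UNIV (\<lambda>t. \<phi> (cis t))" by (rule continuous_on_sphere_cis[OF \<phi>])
  have "Re (H z) = integral\<^sup>L circ (\<lambda>t. poisson_kernel z (cis t) * \<phi> (cis t))" if z: "cmod z < 1" for z
  proof -
    have nz: "cis t - z \<noteq> 0" for t using z by auto
    define k where "k = (\<lambda>t. of_real (\<phi> (cis t)) * (2 * cis t / (cis t - z)))"
    have kc: "continuous_on UNIV k" unfolding k_def using nz \<phi>c by (intro continuous_intros) auto
    have "g z = integral {0..2*pi} (\<lambda>t. f (cis t) / (cis t - z) * \<i> * cis t)"
      unfolding g_def circlepath_def by (subst contour_integral_part_circlepath_eq) auto
    also have "\<dots> = integral {0..2*pi} (\<lambda>t. (\<i>/2) * k t)"
      by (rule arg_cong[where f="integral _"]) (auto simp: f_def k_def)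
    also have "\<dots> = (\<i>/2) * integral {0..2*pi} k" by simp
    also have "integral {0..2*pi} k = 2 * pi * integral\<^sup>L circ k"
      using integral_circ(2)[OF kc] by (simp add: scaleR_conv_of_real)
    finally have "H z = integral\<^sup>L circ k - of_real (integral\<^sup>L circ (\<lambda>t. \<phi> (cis t)))"
      unfolding H_def by simp
    then have "Re (H z) = integral\<^sup>L circ (\<lambda>t. Re (k t)) - integral\<^sup>L circ (\<lambda>t. \<phi> (cis t))"
      using integral_circ(1)[OF kc] by simp
    also have "\<dots> = integral\<^sup>L circ (\<lambda>t. Re (k t) - \<phi> (cis t))"
      using integral_circ(1)[OF kc] integral_circ(1)[OF \<phi>c] by simp
    also have "(\<lambda>t. Re (k t) - \<phi> (cis t)) = (\<lambda>t. poisson_kernel z (cis t) * \<phi> (cis t))"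
    proof
      fix t
      have "Re (k t) = \<phi> (cis t) * Re (2 * cis t / (cis t - z))" unfolding k_def by (simp only: times_complex.sel Re_complex_of_real Im_complex_of_real mult_zero_left diff_zero)
      then show "Re (k t) - \<phi> (cis t) = poisson_kernel z (cis t) * \<phi> (cis t)"
        using poisson_kernel_eq_Re[OF z, of "cis t"] by (simp del: times_divide_eq_right add: right_diff_distrib mult.commute)
    qed
    finally show ?thesis .
  qed
  moreover have "H holomorphic_on ball 0 1" unfolding H_def using g by (intro holomorphic_intros) auto
  ultimately show ?thesis using that by blast
qed

lemma poisson_integral_tendsto:
  fixes \<phi> :: "complex \<Rightarrow> real"
  assumes \<phi>: "continuous_on (sphere 0 1) \<phi>" and \<xi>: "cmod \<xi> = 1"
  shows "((\<lambda>z. integral\<^sup>L circ (\<lambda>t. poisson_kernel z (cis t) * \<phi> (cis t))) \<longlongrightarrow> \<phi> \<xi>) (at \<xi> within ball 0 1)"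
proof (rule tendstoI)
  fix e :: real assume e: "0 < e"
  have \<phi>c: "continuous_on UNIV (\<lambda>t. \<phi> (cis t))" by (rule continuous_on_sphere_cis[OF \<phi>])
  obtain d where d: "0 < d" "\<And>\<eta>. cmod \<eta> = 1 \<Longrightarrow> dist \<eta> \<xi> < d \<Longrightarrow> dist (\<phi> \<eta>) (\<phi> \<xi>) < e / 2"
    using \<phi> \<xi> e half_gt_zero[OF e] unfolding continuous_on_iff by (metis mem_sphere_0)
  have "bounded (\<phi> ` sphere 0 1)" using \<phi> by (intro compact_imp_bounded compact_continuous_image) auto
  then obtain M where M: "0 < M" "\<And>\<eta>. cmod \<eta> = 1 \<Longrightarrow> \<bar>\<phi> \<eta>\<bar> \<le> M"
    unfolding bounded_pos by auto
  \<comment> \<open>For data at distance at least d from \<xi> and z within d/2 of \<xi>, the kernel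
    is at most (1 - |z|^2) / (d/2)^2, and the data differ by at most 2 * M.\<close>
  define A where "A = 2 * M * (4 / d\<^sup>2)"
  have A: "0 < A" unfolding A_def using M d by simp
  have lim: "((\<lambda>z. e/2 + A * (1 - (cmod z)\<^sup>2)) \<longlongrightarrow> e/2 + A * (1 - (cmod \<xi>)\<^sup>2)) (at \<xi> within ball 0 1)"
    by (intro tendsto_intros)
  have ev1: "\<forall>\<^sub>F z in at \<xi> within ball 0 1. e/2 + A * (1 - (cmod z)\<^sup>2) < e"
    using order_tendstoD(2)[OF lim, of e] \<xi> e by simp
  have ev2: "\<forall>\<^sub>F z in at \<xi> within ball 0 1. dist z \<xi> < d/2"
    using d by (auto simp: eventually_at intro!: exI[of _ "d/2"])
  have ev3: "\<forall>\<^sub>F z in at \<xi> within ball 0 1. z \<in> ball 0 1" by (auto simp: eventually_at_filter)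
  show "\<forall>\<^sub>F z in at \<xi> within ball 0 1. dist (integral\<^sup>L circ (\<lambda>t. poisson_kernel z (cis t) * \<phi> (cis t))) (\<phi> \<xi>) < e"
    using ev1 ev2 ev3
  proof eventually_elim
    case (elim z)
    then have z: "cmod z < 1" by simp
    let ?P = "\<lambda>t. poisson_kernel z (cis t)"
    have Pc: "continuous_on UNIV ?P" using z by (rule poisson_kernel_continuous)
    have i1: "integrable circ (\<lambda>t. ?P t * \<phi> (cis t))" by (intro integral_circ continuous_intros Pc \<phi>c)
    have i2: "integrable circ (\<lambda>t. ?P t * \<phi> \<xi>)" by (intro integral_circ continuous_intros Pc)
    have i3: "integrable circ (\<lambda>t. ?P t * (e/2) + A * (1 - (cmod z)\<^sup>2))" by (intro integral_circ continuous_intros Pc)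
    have "integral\<^sup>L circ (\<lambda>t. ?P t * \<phi> (cis t)) - \<phi> \<xi> = integral\<^sup>L circ (\<lambda>t. ?P t * \<phi> (cis t)) - integral\<^sup>L circ (\<lambda>t. ?P t * \<phi> \<xi>)"
      using integral_poisson_kernel[OF z] by simp
    also have "\<dots> = integral\<^sup>L circ (\<lambda>t. ?P t * \<phi> (cis t) - ?P t * \<phi> \<xi>)"
      by (rule Bochner_Integration.integral_diff[symmetric, OF i1 i2])
    also have "\<bar>\<dots>\<bar> \<le> integral\<^sup>L circ (\<lambda>t. ?P t * (e/2) + A * (1 - (cmod z)\<^sup>2))"
    proof (rule order_trans[OF integral_abs_bound integral_mono])
      fix t
      have P: "0 < ?P t" using poisson_kernel_pos[OF z, of "cis t"] by simp
      have n1: "(cmod z)\<^sup>2 \<le> 1" using z by (simp add: power_le_one)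
      have "\<bar>?P t * \<phi> (cis t) - ?P t * \<phi> \<xi>\<bar> = ?P t * \<bar>\<phi> (cis t) - \<phi> \<xi>\<bar>"
        using P by (simp add: right_diff_distrib[symmetric] abs_mult)
      also have "\<dots> \<le> ?P t * (e/2) + A * (1 - (cmod z)\<^sup>2)"
      proof (cases "dist (cis t) \<xi> < d")
        case True
        then have "?P t * \<bar>\<phi> (cis t) - \<phi> \<xi>\<bar> \<le> ?P t * (e/2)"
          using d(2)[of "cis t"] P by (intro mult_left_mono) (auto simp: dist_real_def)
        moreover have "0 \<le> A * (1 - (cmod z)\<^sup>2)" using A n1 by simp
        ultimately show ?thesis by linarith
      next
        case False
        then have "d/2 \<le> cmod (cis t - z)" using elim(2) dist_triangle[of "cis t" \<xi> z]
          by (simp add: dist_norm)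
        then have "?P t \<le> (1 - (cmod z)\<^sup>2) / (d/2)\<^sup>2"
          unfolding poisson_kernel_def using d n1 by (intro divide_left_mono power_mono mult_pos_pos zero_less_power) auto
        then have "?P t * \<bar>\<phi> (cis t) - \<phi> \<xi>\<bar> \<le> ((1 - (cmod z)\<^sup>2) / (d/2)\<^sup>2) * (2 * M)"
          using M(2)[of "cis t"] M(2)[OF \<xi>] P n1 by (intro mult_mono) auto
        also have "\<dots> = A * (1 - (cmod z)\<^sup>2)" unfolding A_def by (simp add: power2_eq_square)
        finally show ?thesis using P e by (smt (verit) mult_nonneg_nonneg divide_nonneg_nonneg)
      qed
      finally show "\<bar>?P t * \<phi> (cis t) - ?P t * \<phi> \<xi>\<bar> \<le> ?P t * (e/2) + A * (1 - (cmod z)\<^sup>2)" .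
    qed (use i1 i2 i3 in auto)
    also have "\<dots> = e/2 + A * (1 - (cmod z)\<^sup>2)"
    proof -
      interpret prob_space circ by (rule prob_circ)
      show ?thesis using integral_poisson_kernel[OF z] integral_circ(1)[OF Pc] 
        by (subst Bochner_Integration.integral_add) (auto simp: prob_space[simplified])
    qed
    also have "\<dots> < e" by (rule elim)
    finally show ?case by (simp add: dist_real_def)
  qed
qed

section \<open>Finite measures on the circle and their uniqueness\<close>

definition circle_measure :: "complex measure \<Rightarrow> bool" where
  "circle_measure \<nu> \<longleftrightarrow> sets \<nu> = sets borel \<and> finite_measure \<nu> \<and> emeasure \<nu> (- sphere 0 1) = 0"

lemma circle_measure_AE:
  assumes "circle_measure \<nu>" shows "AE \<xi> in \<nu>. cmod \<xi> = 1"
  by (rule AE_I[where N="- sphere 0 1"]) (use assms in \<open>auto simp: circle_measure_def\<close>)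

lemma poisson_kernel_measurable[measurable]: "poisson_kernel z \<in> borel_measurable borel"
  unfolding poisson_kernel_def[abs_def] by measurable

lemma poisson_kernel_bound:
  assumes "cmod z \<le> r" "r < 1" "cmod \<xi> = 1" shows "\<bar>poisson_kernel z \<xi>\<bar> \<le> 2 / (1 - r)"
proof -
  have z: "cmod z < 1" using assms by simp
  have d: "1 - r \<le> cmod (\<xi> - z)" using assms norm_triangle_ineq2[of \<xi> z] by auto
  have "poisson_kernel z \<xi> \<le> 2 / cmod (\<xi> - z)" using z assms by (intro poisson_kernel_le)
  also have "\<dots> \<le> 2 / (1 - r)" using d assms by (intro divide_left_mono mult_pos_pos) auto
  finally show ?thesis using poisson_kernel_pos[OF z assms(3)] by simp
qed

lemma poisson_kernel_integrable:
  assumes \<nu>: "circle_measure \<nu>" and z: "cmod z < 1"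
  shows "integrable \<nu> (poisson_kernel z)"
proof -
  interpret finite_measure \<nu> using \<nu> by (simp add: circle_measure_def)
  have [measurable_cong]: "sets \<nu> = sets borel" using \<nu> by (simp add: circle_measure_def)
  show ?thesis
    by (rule integrable_const_bound[where B="2 / (1 - cmod z)"])
      (use circle_measure_AE[OF \<nu>] poisson_kernel_bound[of z "cmod z"] z in auto)
qed

lemma poisson_integral_measure_tendsto:
  assumes \<nu>: "circle_measure \<nu>" and z: "cmod z < 1" and zn: "zn \<longlonglongrightarrow> z"
  shows "(\<lambda>n. integral\<^sup>L \<nu> (poisson_kernel (zn n))) \<longlonglongrightarrow> integral\<^sup>L \<nu> (poisson_kernel z)"
proof -
  interpret finite_measure \<nu> using \<nu> by (simp add: circle_measure_def)
  have [measurable_cong]: "sets \<nu> = sets borel" using \<nu> by (simp add: circle_measure_def)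
  define r where "r = (1 + cmod z) / 2"
  have r: "cmod z < r" "r < 1" using z by (auto simp: r_def)
  have "\<forall>\<^sub>F n in sequentially. cmod (zn n) < r"
    using order_tendstoD(2)[OF tendsto_norm[OF zn] r(1)] .
  then obtain N where N: "\<And>n. n \<ge> N \<Longrightarrow> cmod (zn n) \<le> r"
    unfolding eventually_sequentially by (meson less_imp_le)
  have "(\<lambda>n. integral\<^sup>L \<nu> (poisson_kernel (zn (n + N)))) \<longlonglongrightarrow> integral\<^sup>L \<nu> (poisson_kernel z)"
  proof (rule integral_dominated_convergence[where w="\<lambda>_. 2 / (1 - r)"])
    show "AE x in \<nu>. (\<lambda>n. poisson_kernel (zn (n + N)) x) \<longlonglongrightarrow> poisson_kernel z x"
      using circle_measure_AE[OF \<nu>]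
    proof eventually_elim
      case (elim x)
      have "(\<lambda>n. zn (n + N)) \<longlonglongrightarrow> z" using zn by (rule LIMSEQ_ignore_initial_segment)
      then show ?case unfolding poisson_kernel_def using elim z
        by (intro tendsto_intros) auto
    qed
    show "AE x in \<nu>. norm (poisson_kernel (zn (n + N)) x) \<le> 2 / (1 - r)" for n
      using circle_measure_AE[OF \<nu>] by eventually_elim (use N r poisson_kernel_bound in auto)
  qed auto
  then show ?thesis by (rule LIMSEQ_offset)
qed

lemma poisson_kernel_sym:
  assumes "cmod \<xi> = 1" "cmod \<eta> = 1"
  shows "poisson_kernel (of_real r * \<xi>) \<eta> = poisson_kernel (of_real r * \<eta>) \<xi>"
proof -
  have "(cmod (\<eta> - of_real r * \<xi>))\<^sup>2 = (cmod (\<xi> - of_real r * \<eta>))\<^sup>2"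
  proof -
    have "(Re \<xi>)\<^sup>2 + (Im \<xi>)\<^sup>2 = (Re \<eta>)\<^sup>2 + (Im \<eta>)\<^sup>2" using assms by (metis cmod_power2)
    then show ?thesis unfolding cmod_power2 by (simp add: power2_eq_square) algebra
  qed
  then show ?thesis using assms by (simp add: poisson_kernel_def norm_mult)
qed

text \<open>Fubini and the symmetry of the kernel move the Poisson integral from the measure to
  \<phi>, where the Dirichlet problem gives convergence to \<phi>. Thus the Poisson integral of a
  measure determines its integrals of continuous functions.\<close>

lemma circle_measure_integral_continuous:
  fixes \<phi> :: "complex \<Rightarrow> real"
  assumes \<nu>: "circle_measure \<nu>" and \<phi>: "continuous_on UNIV \<phi>"
  shows "(\<lambda>n. integral\<^sup>L circ (\<lambda>t. \<phi> (cis t) * integral\<^sup>L \<nu> (poisson_kernel (of_real (1 - 1 / (real n + 2)) * cis t))))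
     \<longlonglongrightarrow> integral\<^sup>L \<nu> \<phi>"
proof -
  interpret \<nu>: finite_measure \<nu> using \<nu> by (simp add: circle_measure_def)
  interpret circ: prob_space circ by (rule prob_circ)
  interpret P: pair_sigma_finite \<nu> circ ..
  interpret PF: finite_measure "\<nu> \<Otimes>\<^sub>M circ" using finite_measure_pair_measure[of circ \<nu>] \<nu>.finite_measure_axioms circ.finite_measure_axioms by blast
  have s\<nu>[measurable_cong]: "sets \<nu> = sets borel" using \<nu> by (simp add: circle_measure_def)
  have sp: "sets (\<nu> \<Otimes>\<^sub>M circ) = sets borel"
    using sets_pair_measure_cong[OF s\<nu> sets_circ] unfolding borel_prod .
  have \<phi>s: "continuous_on (sphere 0 1) \<phi>" using \<phi> continuous_on_subset by blast
  have "bounded (\<phi> ` sphere 0 1)" using \<phi>s by (intro compact_imp_bounded compact_continuous_image) auto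
  then obtain M where M: "0 < M" "\<And>\<eta>. cmod \<eta> = 1 \<Longrightarrow> \<bar>\<phi> \<eta>\<bar> \<le> M"
    unfolding bounded_pos by auto
  have [measurable]: "\<phi> \<in> borel_measurable borel" using \<phi> by (rule borel_measurable_continuous_onI)
  define r where "r n = 1 - 1 / (real n + 2)" for n
  have r: "0 < r n" "r n < 1" for n by (auto simp: r_def)
  \<comment> \<open>The measure is one on the whole plane, where the Poisson kernel has a pole. The
    maximum removes the pole and changes nothing for |\<xi>| = 1, so \<open>k\<close> is bounded and
    continuous everywhere, as the product measure needs.\<close>
  define k where "k n \<xi> t = (1 - (r n)\<^sup>2) / max ((1 - r n)\<^sup>2) ((cmod (\<xi> - of_real (r n) * cis t))\<^sup>2)" for n \<xi> t
  have k_eq: "k n \<xi> t = poisson_kernel (of_real (r n) * cis t) \<xi>" if "cmod \<xi> = 1" for n \<xi> t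
  proof -
    have "1 - r n \<le> cmod (\<xi> - of_real (r n) * cis t)"
      using norm_triangle_ineq2[of \<xi> "of_real (r n) * cis t"] that r[of n] by (simp add: norm_mult)
    then have "(1 - r n)\<^sup>2 \<le> (cmod (\<xi> - of_real (r n) * cis t))\<^sup>2" using r[of n] by (intro power_mono) auto
    then show ?thesis using r[of n] by (simp add: k_def poisson_kernel_def norm_mult max_def)
  qed
  have k_bd: "\<bar>k n \<xi> t\<bar> \<le> (1 - (r n)\<^sup>2) / (1 - r n)\<^sup>2" for n \<xi> t
  proof -
    have "0 \<le> 1 - (r n)\<^sup>2" using r[of n] by (simp add: power_le_one)
    moreover have "0 < (1 - r n)\<^sup>2" using r[of n] by simp
    ultimately show ?thesis unfolding k_def
      by (subst abs_of_nonneg) (auto intro!: divide_left_mono divide_nonneg_nonneg mult_pos_pos simp: max_def not_le)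
  qed
  have k_cont: "continuous_on UNIV (\<lambda>p. k n (fst p) (snd p))" for n
  proof -
    have "0 < (1 - r n)\<^sup>2" using r[of n] by simp
    then have nz: "max ((1 - r n)\<^sup>2) x \<noteq> 0" for x by (metis max.cobounded1 not_le)
    show ?thesis unfolding k_def by (intro continuous_intros ballI nz)
  qed
  have int: "integrable (\<nu> \<Otimes>\<^sub>M circ) (\<lambda>(\<xi>, t). k n \<xi> t * \<phi> (cis t))" for n
  proof (rule PF.integrable_const_bound[where B="(1 - (r n)\<^sup>2) / (1 - r n)\<^sup>2 * M"])
    show "AE x in \<nu> \<Otimes>\<^sub>M circ. norm (case x of (\<xi>, t) \<Rightarrow> k n \<xi> t * \<phi> (cis t)) \<le> (1 - (r n)\<^sup>2) / (1 - r n)\<^sup>2 * M"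
    proof (rule AE_I2)
      fix x :: "complex \<times> real"
      obtain \<xi> t where x: "x = (\<xi>, t)" by (cases x)
      have "\<bar>k n \<xi> t\<bar> * \<bar>\<phi> (cis t)\<bar> \<le> (1 - (r n)\<^sup>2) / (1 - r n)\<^sup>2 * M"
        using k_bd[of n \<xi> t] M(2)[of "cis t"] by (intro mult_mono) auto
      then show "norm (case x of (\<xi>, t) \<Rightarrow> k n \<xi> t * \<phi> (cis t)) \<le> (1 - (r n)\<^sup>2) / (1 - r n)\<^sup>2 * M"
        by (simp add: x abs_mult)
    qed
    have "continuous_on UNIV (\<lambda>p. k n (fst p) (snd p) * \<phi> (cis (snd p)))"
      by (intro continuous_intros k_cont continuous_on_compose2[OF \<phi>]) auto
    then have "(\<lambda>p. k n (fst p) (snd p) * \<phi> (cis (snd p))) \<in> borel_measurable borel"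
      by (rule borel_measurable_continuous_onI)
    then show "(\<lambda>(\<xi>, t). k n \<xi> t * \<phi> (cis t)) \<in> borel_measurable (\<nu> \<Otimes>\<^sub>M circ)"
      by (simp add: measurable_cong_sets[OF sp refl] case_prod_beta')
  qed
  have fub: "integral\<^sup>L circ (\<lambda>t. \<phi> (cis t) * integral\<^sup>L \<nu> (poisson_kernel (of_real (r n) * cis t)))
     = integral\<^sup>L \<nu> (\<lambda>\<xi>. integral\<^sup>L circ (\<lambda>t. k n \<xi> t * \<phi> (cis t)))" for n
  proof -
    have "integral\<^sup>L \<nu> (poisson_kernel (of_real (r n) * cis t)) = integral\<^sup>L \<nu> (\<lambda>\<xi>. k n \<xi> t)" for t
    proof (rule integral_cong_AE)
      show "AE x in \<nu>. poisson_kernel (of_real (r n) * cis t) x = k n x t"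
        using circle_measure_AE[OF \<nu>] by eventually_elim (simp add: k_eq)
      show "(\<lambda>\<xi>. k n \<xi> t) \<in> borel_measurable \<nu>" unfolding k_def by measurable
    qed simp
    then have "\<phi> (cis t) * integral\<^sup>L \<nu> (poisson_kernel (of_real (r n) * cis t)) = integral\<^sup>L \<nu> (\<lambda>\<xi>. k n \<xi> t * \<phi> (cis t))" for t
      by (simp add: mult.commute)
    then show ?thesis using P.Fubini_integral[OF int[of n]] by presburger
  qed
  have "(\<lambda>n. integral\<^sup>L \<nu> (\<lambda>\<xi>. integral\<^sup>L circ (\<lambda>t. k n \<xi> t * \<phi> (cis t)))) \<longlonglongrightarrow> integral\<^sup>L \<nu> \<phi>"
  proof (rule integral_dominated_convergence[where w="\<lambda>_. M"])
    have eq: "integral\<^sup>L circ (\<lambda>t. k n \<xi> t * \<phi> (cis t)) = integral\<^sup>L circ (\<lambda>t. poisson_kernel (of_real (r n) * \<xi>) (cis t) * \<phi> (cis t))"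
      if "cmod \<xi> = 1" for n \<xi>
      using that by (simp add: k_eq poisson_kernel_sym[of "cis _"])
    show "AE \<xi> in \<nu>. (\<lambda>n. integral\<^sup>L circ (\<lambda>t. k n \<xi> t * \<phi> (cis t))) \<longlonglongrightarrow> \<phi> \<xi>"
      using circle_measure_AE[OF \<nu>]
    proof eventually_elim
      case (elim \<xi>)
      have "r \<longlonglongrightarrow> 1" unfolding r_def by real_asymp
      then have "(\<lambda>n. of_real (r n) * \<xi>) \<longlonglongrightarrow> of_real 1 * \<xi>" by (intro tendsto_intros)
      then have "filterlim (\<lambda>n. of_real (r n) * \<xi>) (at \<xi> within ball 0 1) sequentially"
        unfolding filterlim_at using r elim less_imp_neq[OF r(2)]
        by (auto simp: norm_mult abs_of_pos intro!: always_eventually)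
      from filterlim_compose[OF poisson_integral_tendsto[OF \<phi>s elim] this]
      show ?case using elim by (simp add: eq)
    qed
    show "AE \<xi> in \<nu>. norm (integral\<^sup>L circ (\<lambda>t. k n \<xi> t * \<phi> (cis t))) \<le> M" for n
      using circle_measure_AE[OF \<nu>]
    proof eventually_elim
      case (elim \<xi>)
      let ?z = "of_real (r n) * \<xi>"
      have z: "cmod ?z < 1" using elim r[of n] by (simp add: norm_mult)
      note Pc = poisson_kernel_continuous[OF z]
      have "\<bar>integral\<^sup>L circ (\<lambda>t. poisson_kernel ?z (cis t) * \<phi> (cis t))\<bar> \<le> integral\<^sup>L circ (\<lambda>t. poisson_kernel ?z (cis t) * M)"
        by (rule order_trans[OF integral_abs_bound integral_mono])
          (use Pc continuous_on_sphere_cis[OF \<phi>s] M(2) poisson_kernel_pos[OF z] in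
            \<open>auto intro!: integral_circ integrable_abs continuous_intros mult_mono simp: abs_mult less_imp_le\<close>)
      also have "\<dots> = M" using integral_poisson_kernel[OF z] by simp
      finally show ?case using elim by (simp add: eq)
    qed
    show "(\<lambda>\<xi>. integral\<^sup>L circ (\<lambda>t. k n \<xi> t * \<phi> (cis t))) \<in> borel_measurable \<nu>" for n
      using P.integrable_fst'[OF int[of n]] by (simp add: borel_measurable_integrable)
  qed auto
  then show ?thesis unfolding fub[unfolded r_def] by (simp add: r_def)
qed

text \<open>Equal integrals of continuous functions pass to indicators of closed sets through the
  cut-offs max 0 (1 - n * infdist x C). Closed sets are stable under intersection and generate the
  Borel sets.\<close>

lemma circle_measure_unique:
  assumes \<nu>: "circle_measure \<nu>" "circle_measure \<nu>'"
    and eq: "\<And>z. cmod z < 1 \<Longrightarrow> integral\<^sup>L \<nu> (poisson_kernel z) = integral\<^sup>L \<nu>' (poisson_kernel z)"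
  shows "\<nu> = \<nu>'"
proof -
  interpret \<nu>: finite_measure \<nu> using \<nu> by (simp add: circle_measure_def)
  interpret \<nu>': finite_measure \<nu>' using \<nu> by (simp add: circle_measure_def)
  have s[measurable_cong]: "sets \<nu> = sets borel" "sets \<nu>' = sets borel" using \<nu> by (auto simp: circle_measure_def)
  have ieq: "integral\<^sup>L \<nu> \<phi> = integral\<^sup>L \<nu>' \<phi>" if \<phi>: "continuous_on UNIV \<phi>" for \<phi> :: "complex \<Rightarrow> real"
  proof -
    have "cmod (of_real (1 - 1 / (real n + 2)) * cis t) < 1" for n t by (simp add: norm_mult del: of_real_diff)
    from eq[OF this] circle_measure_integral_continuous[OF \<nu>(1) \<phi>] circle_measure_integral_continuous[OF \<nu>(2) \<phi>]
    show ?thesis using LIMSEQ_unique by fastforce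
  qed
  have closed: "emeasure \<nu> C = emeasure \<nu>' C" if C: "closed C" for C
  proof (cases "C = {}")
    case False
    define \<phi> where "\<phi> n x = max 0 (1 - real n * infdist x C)" for n x
    have c: "continuous_on UNIV (\<phi> n)" for n unfolding \<phi>_def by (intro continuous_intros)
    have [measurable]: "\<phi> n \<in> borel_measurable borel" for n using c by (rule borel_measurable_continuous_onI)
    have [measurable]: "C \<in> sets borel" using C by simp
    have lim: "(\<lambda>n. \<phi> n x) \<longlonglongrightarrow> indicator C x" for x
    proof (cases "x \<in> C")
      case True then show ?thesis by (simp add: \<phi>_def infdist_zero)
    next
      case nx: False
      have "infdist x C > 0" using C False nx by (simp add: infdist_pos_not_in_closed)
      then have "\<forall>\<^sub>F n in sequentially. \<phi> n x = 0"
        unfolding \<phi>_def eventually_sequentially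
      proof (intro exI[of _ "nat \<lceil>1 / infdist x C\<rceil>"] allI impI)
        fix n assume "nat \<lceil>1 / infdist x C\<rceil> \<le> n"
        then have "1 / infdist x C \<le> real n" by linarith
        then show "max 0 (1 - real n * infdist x C) = 0"
          using \<open>infdist x C > 0\<close> by (simp add: field_simps)
      qed
      then show ?thesis using nx by (simp add: tendsto_eventually)
    qed
    have lim1: "(\<lambda>n. integral\<^sup>L \<nu> (\<phi> n)) \<longlonglongrightarrow> integral\<^sup>L \<nu> (indicator C :: complex \<Rightarrow> real)"
      by (rule integral_dominated_convergence[where w="\<lambda>_. 1"]) (use lim in \<open>auto simp: \<phi>_def infdist_nonneg\<close>)
    have lim2: "(\<lambda>n. integral\<^sup>L \<nu>' (\<phi> n)) \<longlonglongrightarrow> integral\<^sup>L \<nu>' (indicator C :: complex \<Rightarrow> real)"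
      by (rule integral_dominated_convergence[where w="\<lambda>_. 1"]) (use lim in \<open>auto simp: \<phi>_def infdist_nonneg\<close>)
    have "integral\<^sup>L \<nu> (indicator C :: complex \<Rightarrow> real) = integral\<^sup>L \<nu>' (indicator C)"
      using lim1 lim2 ieq[OF c] LIMSEQ_unique by auto
    then have "measure \<nu> C = measure \<nu>' C" using s by (simp add: sets_eq_imp_space_eq[OF s(1)] sets_eq_imp_space_eq[OF s(2)])
    then show ?thesis by (simp add: \<nu>.emeasure_eq_measure \<nu>'.emeasure_eq_measure)
  qed simp
  show ?thesis
  proof (rule measure_eqI_generator_eq[where E="Collect closed" and \<Omega>=UNIV and A="\<lambda>_. UNIV"])
    show "Int_stable (Collect closed :: complex set set)" by (auto simp: Int_stable_def)
    show "sets \<nu> = sigma_sets UNIV (Collect closed)" using s by (simp add: borel_eq_closed)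
    show "sets \<nu>' = sigma_sets UNIV (Collect closed)" using s by (simp add: borel_eq_closed)
  qed (use closed in auto)
qed

section \<open>Division by the zeros\<close>

definition mob :: "complex \<Rightarrow> complex \<Rightarrow> complex" where
  "mob a z = (z - a) / (1 - cnj a * z)"

lemma mob_denom_nonzero:
  assumes "cmod a < 1" "cmod z \<le> 1" shows "1 - cnj a * z \<noteq> 0"
proof
  assume "1 - cnj a * z = 0"
  then have "cmod (cnj a * z) = 1" by simp
  moreover have "cmod a * cmod z < 1" using assms
    by (metis mult_left_le norm_ge_zero order_le_less_trans)
  ultimately show False by (simp add: norm_mult)
qed

lemma mob_holomorphic: "cmod a < 1 \<Longrightarrow> mob a holomorphic_on cball 0 1"
  unfolding mob_def[abs_def] using mob_denom_nonzero by (intro holomorphic_intros) auto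

lemma mob_eq_0_iff: "cmod a < 1 \<Longrightarrow> cmod z \<le> 1 \<Longrightarrow> mob a z = 0 \<longleftrightarrow> z = a"
  using mob_denom_nonzero by (auto simp: mob_def)

lemma mob_denom_ge: "cmod a < 1 \<Longrightarrow> cmod z \<le> 1 \<Longrightarrow> (cmod (1 - cnj a * z))\<^sup>2 - (cmod (z - a))\<^sup>2 = (1 - (cmod a)\<^sup>2) * (1 - (cmod z)\<^sup>2)"
  unfolding cmod_power2 by (simp add: power2_eq_square algebra_simps)

text \<open>The factor 1 - |a|^2 depends on the zero alone. It lets the contributions of one zero at
  two different points be compared.\<close>

lemma one_minus_mob:
  assumes "cmod a < 1" "cmod z \<le> 1"
  shows "1 - (cmod (mob a z))\<^sup>2 = (1 - (cmod a)\<^sup>2) * (1 - (cmod z)\<^sup>2) / (cmod (1 - cnj a * z))\<^sup>2"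
  unfolding mob_denom_ge[OF assms, symmetric] mob_def norm_divide
  using mob_denom_nonzero[OF assms] by (simp add: diff_divide_distrib power_divide)

lemma mob_le_1:
  assumes "cmod a < 1" "cmod z \<le> 1" shows "cmod (mob a z) \<le> 1"
proof -
  have "0 \<le> 1 - (cmod (mob a z))\<^sup>2" unfolding one_minus_mob[OF assms]
    using assms by (intro divide_nonneg_nonneg mult_nonneg_nonneg) (auto simp: power_le_one)
  then show ?thesis by (simp add: abs_square_le_1)
qed

lemma mob_eq_1:
  assumes "cmod a < 1" "cmod z = 1" shows "cmod (mob a z) = 1"
proof -
  have "1 - (cmod (mob a z))\<^sup>2 = 0" using one_minus_mob[of a z] assms by simp
  then show ?thesis by (simp add: power2_eq_1_iff)
    (use norm_ge_zero[of "mob a z"] in linarith)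
qed

lemma mob_factor:
  assumes b: "b holomorphic_on ball 0 1" and nz: "\<exists>w\<in>ball 0 1. b w \<noteq> 0" and a: "a \<in> zeros_in b"
  shows "zorder b a > 0" "\<exists>h. h holomorphic_on ball 0 1 \<and> h a \<noteq> 0 \<and> (\<forall>z\<in>ball 0 1. b z = mob a z ^ nat (zorder b a) * h z)"
proof -
  have a1: "a \<in> ball 0 1" "b a = 0" using a by (auto simp: zeros_in_def)
  then have ca: "cmod a < 1" by simp
  note * = zorder_exist_zero[OF b open_ball convex_connected[OF convex_ball] a1(1) nz]
  show pos: "zorder b a > 0" using conjunct1[OF *] a1(2) by (simp split: if_splits)
  define m where "m = nat (zorder b a)"
  obtain r where r: "r > 0" "cball a r \<subseteq> ball 0 1" "zor_poly b a holomorphic_on cball a r"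
    "\<And>w. w \<in> cball a r \<Longrightarrow> b w = zor_poly b a w * (w - a) ^ m \<and> zor_poly b a w \<noteq> 0"
    using conjunct2[OF *] unfolding m_def by blast
  define g where "g = (\<lambda>z. zor_poly b a z * (1 - cnj a * z) ^ m)"
  \<comment> \<open>The quotient has a removable singularity at \<open>a\<close>: nearby it agrees
    with \<open>g\<close>, in which the power of z - a is already cancelled.\<close>
  define h where "h z = (if z = a then g a else b z / mob a z ^ m)" for z
  have nz0: "1 - cnj a * z \<noteq> 0" if "z \<in> ball 0 1" for z using mob_denom_nonzero[OF ca, of z] that by simp
  have hg: "h z = g z" if "z \<in> ball a r" for z
  proof (cases "z = a")
    case False
    have "z \<in> cball a r" using that by auto
    then have "z \<in> cball a r" "z \<in> ball 0 1" using r(2) by blast+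
    then show ?thesis using False nz0[of z] r(4)[of z] unfolding h_def g_def mob_def
      by (simp add: power_divide field_simps)
  qed (simp add: h_def)
  have "g holomorphic_on ball a r" unfolding g_def
    by (intro holomorphic_intros holomorphic_on_subset[OF r(3)]) auto
  then have h1: "h holomorphic_on ball a r" using hg by (metis holomorphic_transform)
  have "(\<lambda>z. b z / mob a z ^ m) holomorphic_on (ball 0 1 - {a})"
    using mob_eq_0_iff[OF ca] 
    by (intro holomorphic_intros holomorphic_on_subset[OF b] holomorphic_on_subset[OF mob_holomorphic[OF ca]]) auto
  then have h2: "h holomorphic_on (ball 0 1 - {a})"
    by (rule holomorphic_transform) (auto simp: h_def)
  have "h holomorphic_on (ball a r \<union> (ball 0 1 - {a}))"
    using h1 h2 by (intro holomorphic_on_Un) (auto simp: open_delete)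
  moreover have "ball a r \<union> (ball 0 1 - {a}) = ball 0 1" using r ball_subset_cball[of a r] by auto
  moreover have "h a \<noteq> 0" using r nz0[OF a1(1)] by (simp add: h_def g_def)
  moreover have "b z = mob a z ^ m * h z" if "z \<in> ball 0 1" for z
  proof (cases "z = a")
    case True
    have "mob a a = 0" by (simp add: mob_def)
    moreover have "m > 0" using pos by (simp add: m_def)
    ultimately show ?thesis using a1 True by simp
  next
    case False
    then show ?thesis using mob_eq_0_iff[OF ca, of z] that by (simp add: h_def)
  qed
  ultimately show "\<exists>h. h holomorphic_on ball 0 1 \<and> h a \<noteq> 0 \<and> (\<forall>z\<in>ball 0 1. b z = mob a z ^ nat (zorder b a) * h z)"
    unfolding m_def by metis
qed

definition blaschke_part :: "(complex \<Rightarrow> complex) \<Rightarrow> complex set \<Rightarrow> complex \<Rightarrow> complex" where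
  "blaschke_part b F z = (\<Prod>a\<in>F. mob a z ^ nat (zorder b a))"

lemma blaschke_part_holomorphic:
  assumes "F \<subseteq> ball 0 1" shows "blaschke_part b F holomorphic_on cball 0 1"
  unfolding blaschke_part_def[abs_def]
  by (intro holomorphic_on_prod holomorphic_on_power mob_holomorphic) (use assms in auto)

lemma blaschke_part_nonzero:
  assumes "finite F" "F \<subseteq> ball 0 1" "cmod z \<le> 1" "z \<notin> F" shows "blaschke_part b F z \<noteq> 0"
  unfolding blaschke_part_def using assms mob_eq_0_iff[of _ z] by (auto simp: subset_eq)

lemma blaschke_part_sphere:
  assumes "F \<subseteq> ball 0 1" "cmod z = 1" shows "cmod (blaschke_part b F z) = 1"
  unfolding blaschke_part_def prod_norm[symmetric] norm_power
  using assms mob_eq_1[of _ z] by (intro prod.neutral) auto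

lemma blaschke_part_le_1:
  assumes "F \<subseteq> ball 0 1" "cmod z \<le> 1" shows "cmod (blaschke_part b F z) \<le> 1"
  unfolding blaschke_part_def prod_norm[symmetric] norm_power
  using assms mob_le_1[of _ z] by (intro prod_le_1) (auto intro!: power_le_one)

lemma blaschke_part_Un:
  assumes "finite F" "finite G" "F \<inter> G = {}"
  shows "blaschke_part b (F \<union> G) z = blaschke_part b F z * blaschke_part b G z"
  unfolding blaschke_part_def by (rule prod.union_disjoint[OF assms])

text \<open>A finite Blaschke product has modulus 1 on the circle, so the maximum principle
  preserves the bound 1 under division. Further factors have modulus at most 1, so dividing them out
  raises the modulus; this monotonicity later keeps the limit from vanishing.\<close>

lemma zeros_division:
  assumes b: "b holomorphic_on ball 0 1" and nz: "\<exists>w\<in>ball 0 1. b w \<noteq> 0"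
    and le: "\<forall>z\<in>ball 0 1. cmod (b z) \<le> 1"
  shows "\<exists>q. (\<forall>F. finite F \<longrightarrow> F \<subseteq> zeros_in b \<longrightarrow> q F holomorphic_on ball 0 1) \<and>
    (\<forall>F z. finite F \<longrightarrow> F \<subseteq> zeros_in b \<longrightarrow> cmod z < 1 \<longrightarrow> cmod (q F z) \<le> 1) \<and>
    (\<forall>F z. z \<notin> F \<longrightarrow> q F z = b z / blaschke_part b F z) \<and>
    (\<forall>F z. finite F \<longrightarrow> F \<subseteq> zeros_in b \<longrightarrow> z \<in> F \<longrightarrow> q F z \<noteq> 0) \<and>
    (\<forall>F F' z. finite F' \<longrightarrow> F \<subseteq> F' \<longrightarrow> F' \<subseteq> zeros_in b \<longrightarrow> cmod z < 1 \<longrightarrow> z \<notin> F' - F \<longrightarrow>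
        cmod (q F z) \<le> cmod (q F' z))"
proof -
  have "\<forall>a\<in>zeros_in b. \<exists>h. h holomorphic_on ball 0 1 \<and> h a \<noteq> 0 \<and> (\<forall>z\<in>ball 0 1. b z = mob a z ^ nat (zorder b a) * h z)"
    using mob_factor(2)[OF b nz] by blast
  then obtain h where h: "\<And>a. a \<in> zeros_in b \<Longrightarrow> h a holomorphic_on ball 0 1"
    "\<And>a. a \<in> zeros_in b \<Longrightarrow> h a a \<noteq> 0"
    "\<And>a z. a \<in> zeros_in b \<Longrightarrow> cmod z < 1 \<Longrightarrow> b z = mob a z ^ nat (zorder b a) * h a z"
    by (metis mem_ball_0)
  \<comment> \<open>At a point of \<open>F\<close> the plain quotient would be 0 by the convention
    for division by zero. The cofactor \<open>h z\<close> supplies the correct value there.\<close>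
  define q where "q F z = (if z \<in> F then h z z / blaschke_part b (F - {z}) z else b z / blaschke_part b F z)" for F z
  have sub: "F \<subseteq> ball 0 1" if "F \<subseteq> zeros_in b" for F using that by (auto simp: zeros_in_def)
  have hol: "q F holomorphic_on ball 0 1" if F: "finite F" "F \<subseteq> zeros_in b" for F
  proof -
    have "(\<lambda>z. b z / blaschke_part b F z) holomorphic_on (ball 0 1 - F)"
      using blaschke_part_nonzero[OF F(1) sub[OF F(2)]]
      by (intro holomorphic_intros holomorphic_on_subset[OF b] holomorphic_on_subset[OF blaschke_part_holomorphic[OF sub[OF F(2)]]]) auto
    then have 1: "q F holomorphic_on (ball 0 1 - F)"
      by (rule holomorphic_transform) (auto simp: q_def)
    have 2: "q F holomorphic_on (ball 0 1 - (F - {a}))" if a: "a \<in> F" for a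
    proof -
      have Fa: "finite (F - {a})" "F - {a} \<subseteq> ball 0 1" using F sub by auto
      have za: "a \<in> zeros_in b" using a F by auto
      have "(\<lambda>z. h a z / blaschke_part b (F - {a}) z) holomorphic_on (ball 0 1 - (F - {a}))"
        using blaschke_part_nonzero[OF Fa]
        by (intro holomorphic_intros holomorphic_on_subset[OF h(1)[OF za]] holomorphic_on_subset[OF blaschke_part_holomorphic[OF Fa(2)]]) auto
      then show ?thesis
      proof (rule holomorphic_transform)
        fix z assume z: "z \<in> ball 0 1 - (F - {a})"
        show "h a z / blaschke_part b (F - {a}) z = q F z"
        proof (cases "z = a")
          case False
          have "blaschke_part b F z = mob a z ^ nat (zorder b a) * blaschke_part b (F - {a}) z"
            unfolding blaschke_part_def by (rule prod.remove[OF F(1) a])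
          moreover have "mob a z \<noteq> 0" using mob_eq_0_iff[of a z] sub[OF F(2)] a False z by auto
          ultimately show ?thesis using False z h(3)[OF za, of z] by (auto simp: q_def)
        qed (use a in \<open>simp add: q_def\<close>)
      qed
    qed
    have op: "open (ball 0 1 - (F - {a}))" for a :: complex using F by (intro open_Diff) (auto intro: finite_imp_closed)
    have op': "open (ball 0 1 - F)" using F by (intro open_Diff) (auto intro: finite_imp_closed)
    have "q F holomorphic_on (\<Union>a\<in>F. ball 0 1 - (F - {a}))"
      by (rule holomorphic_on_UN_open) (use 2 op in auto)
    then have "q F holomorphic_on ((ball 0 1 - F) \<union> (\<Union>a\<in>F. ball 0 1 - (F - {a})))"
      using 1 op op' by (intro holomorphic_on_Un) auto
    moreover have "(ball 0 1 - F) \<union> (\<Union>a\<in>F. ball 0 1 - (F - {a})) = ball 0 1"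
      by auto
    ultimately show ?thesis by simp
  qed
  have bd: "cmod (q F z) \<le> 1" if F: "finite F" "F \<subseteq> zeros_in b" and z: "cmod z < 1" for F z
  proof (rule max_mod_limsup[of "ball 0 1" "q F"])
    fix \<xi> :: complex and \<epsilon> :: real assume "\<xi> \<in> frontier (ball 0 1)" and \<epsilon>: "0 < \<epsilon>"
    then have \<xi>: "cmod \<xi> = 1" by simp
    have cont: "continuous_on (cball 0 1) (blaschke_part b F)"
      by (intro holomorphic_on_imp_continuous_on blaschke_part_holomorphic sub F)
    have "(blaschke_part b F \<longlongrightarrow> blaschke_part b F \<xi>) (at \<xi> within cball 0 1)"
      using cont \<xi> by (auto simp: continuous_on_def)
    then have "(blaschke_part b F \<longlongrightarrow> blaschke_part b F \<xi>) (at \<xi> within ball 0 1)"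
      by (rule tendsto_within_subset) auto
    then have "((\<lambda>z. (1 + \<epsilon>) * cmod (blaschke_part b F z)) \<longlongrightarrow> (1 + \<epsilon>) * 1) (at \<xi> within ball 0 1)"
      using blaschke_part_sphere[OF sub[OF F(2)] \<xi>] by (metis tendsto_norm tendsto_mult_left)
    then have "\<forall>\<^sub>F z in at \<xi> within ball 0 1. (1 + \<epsilon>) * cmod (blaschke_part b F z) > 1"
      by (rule order_tendstoD) (use \<epsilon> in auto)
    moreover have "\<forall>\<^sub>F z in at \<xi> within ball 0 1. z \<in> - F"
    proof (rule eventually_at_topological[THEN iffD2], intro exI conjI)
      show "open (- F)" using F by (auto intro: finite_imp_closed)
      show "\<xi> \<in> - F" using F(2) \<xi> by (auto simp: zeros_in_def)
    qed auto
    moreover have "\<forall>\<^sub>F z in at \<xi> within ball 0 1. cmod z < 1" by (auto simp: eventually_at_filter)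
    ultimately show "\<forall>\<^sub>F z in at \<xi> within ball 0 1. cmod (q F z) \<le> 1 + \<epsilon>"
    proof eventually_elim
      case (elim z)
      have "blaschke_part b F z \<noteq> 0" using elim(1) by auto
      then have "cmod (q F z) = cmod (b z) / cmod (blaschke_part b F z)"
        using elim by (simp add: q_def norm_divide)
      also have "\<dots> \<le> 1 / cmod (blaschke_part b F z)" using le elim by (intro divide_right_mono) auto
      also have "\<dots> \<le> 1 + \<epsilon>" using elim(1) \<open>blaschke_part b F z \<noteq> 0\<close> by (simp add: field_simps)
      finally show ?case .
    qed
  qed (use hol[OF F] z in auto)
  have q3: "q F z = b z / blaschke_part b F z" if "z \<notin> F" for F z using that by (simp add: q_def)
  have q4: "q F z \<noteq> 0" if F: "finite F" "F \<subseteq> zeros_in b" and z: "z \<in> F" for F z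
  proof -
    have "cmod z < 1" "z \<in> zeros_in b" using sub[OF F(2)] F z by auto
    then show ?thesis unfolding q_def using z blaschke_part_nonzero[of "F - {z}" z] F sub h(2) by auto
  qed
  have q5: "cmod (q F z) \<le> cmod (q F' z)" if F: "finite F'" "F \<subseteq> F'" "F' \<subseteq> zeros_in b" and z: "cmod z < 1" "z \<notin> F' - F" for F F' z
  proof -
    have fin: "finite F" using F finite_subset by blast
    have s: "F \<subseteq> ball 0 1" "F' - F \<subseteq> ball 0 1" using F sub by blast+
    have nz': "blaschke_part b (F' - F) z \<noteq> 0" using blaschke_part_nonzero[of "F' - F" z] F z s by auto
    have "q F z = q F' z * blaschke_part b (F' - F) z"
    proof (cases "z \<in> F")
      case True
      have "F' - {z} = (F - {z}) \<union> (F' - F)" using True F by auto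
      then have "blaschke_part b (F' - {z}) z = blaschke_part b (F - {z}) z * blaschke_part b (F' - F) z"
        using blaschke_part_Un[of "F - {z}" "F' - F"] fin F by auto
      then show ?thesis using True F nz' by (auto simp: q_def)
    next
      case False
      have "F' = F \<union> (F' - F)" using F by auto
      then have "blaschke_part b F' z = blaschke_part b F z * blaschke_part b (F' - F) z"
        using blaschke_part_Un[of "F" "F' - F"] fin F by auto
      then show ?thesis using False z nz' by (auto simp: q_def)
    qed
    then have "cmod (q F z) = cmod (q F' z) * cmod (blaschke_part b (F' - F) z)" by (simp add: norm_mult)
    also have "\<dots> \<le> cmod (q F' z) * 1"
      by (intro mult_left_mono blaschke_part_le_1 s) (use z in auto)
    finally show ?thesis by simp
  qed
  show ?thesis
  proof (intro exI[of _ q] conjI allI impI)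
  qed (fact hol bd q3 q4 q5)+
qed

text \<open>For nonnegative terms, convergence along a single exhausting sequence of finite sets
  already forces unordered summability.\<close>

lemma has_sum_exhaustion:
  fixes f :: "'a \<Rightarrow> real"
  assumes f: "\<And>a. a \<in> A \<Longrightarrow> 0 \<le> f a" and F: "\<And>n::nat. finite (F n)" "\<And>n. F n \<subseteq> A"
    and ex: "\<And>G. finite G \<Longrightarrow> G \<subseteq> A \<Longrightarrow> \<forall>\<^sub>F n in sequentially. G \<subseteq> F n"
    and L: "(\<lambda>n. sum f (F n)) \<longlonglongrightarrow> L"
  shows "(f has_sum L) A"
  unfolding has_sum_def
proof (rule tendstoI)
  fix e :: real assume e: "0 < e"
  have up: "sum f G \<le> L" if G: "finite G" "G \<subseteq> A" for G
  proof (rule tendsto_lowerbound[OF L])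
    show "\<forall>\<^sub>F n in sequentially. sum f G \<le> sum f (F n)"
      using ex[OF G] 
    proof eventually_elim
      case (elim n)
      then show ?case by (intro sum_mono2 F f) (use F(2)[of n] in auto)
    qed
  qed simp
  have "\<forall>\<^sub>F n in sequentially. sum f (F n) > L - e"
    by (rule order_tendstoD[OF L]) (use e in auto)
  then obtain n where n: "sum f (F n) > L - e" by (auto simp: eventually_sequentially)
  show "\<forall>\<^sub>F x in finite_subsets_at_top A. dist (sum f x) L < e"
    unfolding eventually_finite_subsets_at_top
  proof (intro exI[of _ "F n"] conjI allI impI)
    fix Y assume Y: "finite Y \<and> F n \<subseteq> Y \<and> Y \<subseteq> A"
    then have "sum f (F n) \<le> sum f Y" by (intro sum_mono2) (use f in auto)
    then show "dist (sum f Y) L < e" using up[of Y] Y n by (auto simp: dist_real_def)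
  qed (use F in auto)
qed


lemma finite_zeros_cball:
  assumes b: "b holomorphic_on ball 0 1" and nz: "\<exists>w\<in>ball 0 1. b w \<noteq> 0" and r: "r < 1"
  shows "finite (zeros_in b \<inter> cball 0 r)"
proof (cases "b constant_on ball 0 1")
  case True
  then have "zeros_in b = {}" using nz by (fastforce simp: constant_on_def zeros_in_def)
  then show ?thesis by simp
next
  case False
  have "cball 0 r \<subseteq> ball (0::complex) 1" using r by auto
  from holomorphic_compact_finite_zeros[OF b open_ball convex_connected[OF convex_ball] compact_cball this False]
  show ?thesis by (rule finite_subset[rotated]) (auto simp: zeros_in_def)
qed

text \<open>The quotients by finite Blaschke products have a limit by Montel's theorem; it does not vanish because their
  moduli increase.\<close>
lemma blaschke_division:
  assumes b: "b holomorphic_on ball 0 1" and nz: "\<exists>w\<in>ball 0 1. b w \<noteq> 0"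
    and le: "\<forall>z\<in>ball 0 1. cmod (b z) \<le> 1"
  obtains g where "g holomorphic_on ball 0 1" "\<And>z. cmod z < 1 \<Longrightarrow> g z \<noteq> 0 \<and> cmod (g z) \<le> 1"
    "\<And>z. cmod z < 1 \<Longrightarrow> b z \<noteq> 0 \<Longrightarrow>
      ((\<lambda>a. real (nat (zorder b a)) * ln (cmod (mob a z))) has_sum (ln (cmod (b z)) - ln (cmod (g z)))) (zeros_in b)"
proof -
  obtain q where Q: "\<forall>F. finite F \<longrightarrow> F \<subseteq> zeros_in b \<longrightarrow> q F holomorphic_on ball 0 1"
    "\<forall>F z. finite F \<longrightarrow> F \<subseteq> zeros_in b \<longrightarrow> cmod z < 1 \<longrightarrow> cmod (q F z) \<le> 1"
    "\<forall>F z. z \<notin> F \<longrightarrow> q F z = b z / blaschke_part b F z"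
    "\<forall>F z. finite F \<longrightarrow> F \<subseteq> zeros_in b \<longrightarrow> z \<in> F \<longrightarrow> q F z \<noteq> 0"
    "\<forall>F F' z. finite F' \<longrightarrow> F \<subseteq> F' \<longrightarrow> F' \<subseteq> zeros_in b \<longrightarrow> cmod z < 1 \<longrightarrow> z \<notin> F' - F \<longrightarrow>
        cmod (q F z) \<le> cmod (q F' z)"
    using zeros_division[OF b nz le] by (elim exE conjE) (rule that; assumption)
  note q1 = Q(1)[rule_format] and q2 = Q(2)[rule_format] and q3 = Q(3)[rule_format]
    and q4 = Q(4)[rule_format] and q5 = Q(5)[rule_format]
  define R where "R n = 1 - 1 / (real n + 2)" for n
  have R1: "R n < 1" for n by (simp add: R_def)
  have Rmono: "R m \<le> R n" if "m \<le> n" for m n using that unfolding R_def by (intro diff_left_mono divide_left_mono) auto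
  have "R \<longlonglongrightarrow> 1" unfolding R_def by real_asymp
  then have Rev: "\<forall>\<^sub>F n in sequentially. x < R n" if "x < 1" for x using that by (rule order_tendstoD(1))
  define F where "F n = zeros_in b \<inter> cball 0 (R n)" for n
  have F: "finite (F n)" "F n \<subseteq> zeros_in b" for n using finite_zeros_cball[OF b nz R1] by (auto simp: F_def)
  have Fmono: "F m \<subseteq> F n" if "m \<le> n" for m n using Rmono[OF that] by (auto simp: F_def)
  define \<H> where "\<H> = {h. h holomorphic_on ball 0 1 \<and> (\<forall>z\<in>ball 0 1. cmod (h z) \<le> 1)}"
  obtain g r where g: "g holomorphic_on ball 0 1" and r: "strict_mono (r :: nat \<Rightarrow> nat)"
    and lim: "\<And>x. x \<in> ball 0 1 \<Longrightarrow> (\<lambda>n. q (F (r n)) x) \<longlonglongrightarrow> g x"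
  proof (rule Montel[of "ball 0 1" \<H> "\<lambda>n. q (F n)"])
    show "\<exists>B. \<forall>h\<in>\<H>. \<forall>z\<in>K. cmod (h z) \<le> B" if "compact K" "K \<subseteq> ball 0 1" for K
      using that by (intro exI[of _ 1]) (auto simp: \<H>_def)
    show "range (\<lambda>n. q (F n)) \<subseteq> \<H>" using q1 q2 F by (auto simp: \<H>_def)
  qed (auto simp: \<H>_def)
  have g1: "cmod (g z) \<le> 1" if z: "cmod z < 1" for z
    using tendsto_upperbound[OF tendsto_norm[OF lim[of z]], of 1] q2[OF F] z by auto
  have g0: "g z \<noteq> 0" if z: "cmod z < 1" for z
  proof -
    \<comment> \<open>From stage \<open>N\<close> on, all zeros that are newly divided out have
      modulus above |z|. A possible zero at z itself is gone by then, and the modulus at z can only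
      grow.\<close>
    obtain N where N: "cmod z < R N" using Rev[OF z] by (auto simp: eventually_sequentially)
    have "q (F N) z \<noteq> 0"
    proof (cases "z \<in> F N")
      case True then show ?thesis using q4 F by blast
    next
      case False
      then have "b z \<noteq> 0" using z N by (auto simp: F_def zeros_in_def)
      moreover have "blaschke_part b (F N) z \<noteq> 0"
        using F(2)[of N] z by (intro blaschke_part_nonzero F False) (auto simp: zeros_in_def)
      ultimately show ?thesis using q3[OF False] by simp
    qed
    moreover have "cmod (q (F N) z) \<le> cmod (g z)"
    proof (rule tendsto_lowerbound[OF tendsto_norm[OF lim]])
      show "\<forall>\<^sub>F n in sequentially. cmod (q (F N) z) \<le> cmod (q (F (r n)) z)"
        unfolding eventually_sequentially
      proof (intro exI[of _ N] allI impI q5 F Fmono z)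
        fix n assume "N \<le> n"
        then show "N \<le> r n" using seq_suble[OF r, of n] by simp
        show "z \<notin> F (r n) - F N" using N by (auto simp: F_def)
      qed
    qed (use z in auto)
    ultimately show ?thesis by auto
  qed
  have sum: "((\<lambda>a. real (nat (zorder b a)) * ln (cmod (mob a z))) has_sum (ln (cmod (b z)) - ln (cmod (g z)))) (zeros_in b)"
    if z: "cmod z < 1" and bz: "b z \<noteq> 0" for z
  proof -
    \<comment> \<open>The sign makes the terms nonnegative, as the exhaustion argument
      requires.\<close>
    define f where "f a = - (real (nat (zorder b a)) * ln (cmod (mob a z)))" for a
    have mob0: "0 < cmod (mob a z)" "cmod (mob a z) \<le> 1" if "a \<in> zeros_in b" for a
      using mob_eq_0_iff[of a z] mob_le_1[of a z] that z bz by (auto simp: zeros_in_def)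
    have "(f has_sum (ln (cmod (g z)) - ln (cmod (b z)))) (zeros_in b)"
    proof (rule has_sum_exhaustion[where F="\<lambda>n. F (r n)"])
      show "0 \<le> f a" if "a \<in> zeros_in b" for a
        using mob0[OF that] by (simp add: f_def mult_nonneg_nonpos)
      show "\<forall>\<^sub>F n in sequentially. G \<subseteq> F (r n)" if G: "finite G" "G \<subseteq> zeros_in b" for G
      proof -
        have "\<forall>\<^sub>F n in sequentially. \<forall>a\<in>G. cmod a < R n"
          using G by (intro eventually_ball_finite ballI Rev) (auto simp: zeros_in_def)
        then have "\<forall>\<^sub>F n in sequentially. \<forall>a\<in>G. cmod a < R (r n)"
          by (rule eventually_subseq[OF r])
        then show ?thesis by eventually_elim (use G in \<open>force simp: F_def\<close>)
      qed
      have s: "sum f (F (r n)) = ln (cmod (q (F (r n)) z)) - ln (cmod (b z))" for n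
      proof -
        have zF: "z \<notin> F (r n)" using bz by (auto simp: F_def zeros_in_def)
        have mobF: "0 < cmod (mob a z)" if "a \<in> F (r n)" for a using mob0 F(2) that by blast
        have "ln (cmod (blaschke_part b (F (r n)) z)) = (\<Sum>a\<in>F (r n). ln (cmod (mob a z) ^ nat (zorder b a)))"
          unfolding blaschke_part_def prod_norm[symmetric] norm_power
          using mobF F by (intro ln_prod) auto
        also have "\<dots> = - sum f (F (r n))"
          unfolding sum_negf[symmetric] f_def using mobF by (intro sum.cong refl) (auto simp: ln_realpow)
        finally have "ln (cmod (blaschke_part b (F (r n)) z)) = - sum f (F (r n))" .
        moreover have "blaschke_part b (F (r n)) z \<noteq> 0"
          using F(2)[of "r n"] z by (intro blaschke_part_nonzero F zF) (auto simp: zeros_in_def)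
        ultimately show ?thesis using q3[OF zF] bz by (simp add: norm_divide ln_div)
      qed
      show "(\<lambda>n. sum f (F (r n))) \<longlonglongrightarrow> ln (cmod (g z)) - ln (cmod (b z))"
        unfolding s using g0[OF z] z by (intro tendsto_intros lim) auto
    qed (use F in auto)
    then have "((\<lambda>a. - f a) has_sum (ln (cmod (b z)) - ln (cmod (g z)))) (zeros_in b)"
      by (subst has_sum_uminus) simp
    then show ?thesis by (simp add: f_def)
  qed
  show ?thesis using that[OF g _ sum] g0 g1 by blast
qed

section \<open>The Herglotz representation\<close>

lemma poisson_Re_dilation:
  assumes G: "G holomorphic_on ball 0 1" and r: "0 < r" "r < 1" and z: "cmod z < 1"
  shows "Re (G (of_real r * z)) = integral\<^sup>L circ (\<lambda>t. poisson_kernel z (cis t) * Re (G (of_real r * cis t)))"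
    "continuous_on UNIV (\<lambda>t. Re (G (of_real r * cis t)))"
proof -
  have sub: "(\<lambda>w. of_real r * w) ` cball 0 1 \<subseteq> ball (0::complex) 1"
  proof clarsimp
    fix w :: complex assume "cmod w \<le> 1"
    then show "cmod (of_real r * w) < 1" using r by (simp add: norm_mult) (smt (verit) mult_left_le)
  qed
  have "G \<circ> (\<lambda>w. of_real r * w) holomorphic_on cball 0 1"
    by (rule holomorphic_on_compose_gen[OF _ G sub]) (intro holomorphic_intros)
  then have F: "(\<lambda>w. G (of_real r * w)) holomorphic_on cball 0 1" by (simp add: o_def)
  have c: "continuous_on UNIV (\<lambda>t. G (of_real r * cis t))"
    by (rule continuous_on_compose2[OF holomorphic_on_imp_continuous_on[OF F], of _ cis]) (auto intro!: continuous_intros)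
  then show "continuous_on UNIV (\<lambda>t. Re (G (of_real r * cis t)))" by (intro continuous_intros)
  have i: "integrable circ (\<lambda>t. of_real (poisson_kernel z (cis t)) * G (of_real r * cis t))"
    by (intro integral_circ continuous_intros c poisson_kernel_continuous z)
  show "Re (G (of_real r * z)) = integral\<^sup>L circ (\<lambda>t. poisson_kernel z (cis t) * Re (G (of_real r * cis t)))"
    unfolding poisson_integral_holomorphic[OF F z]
    by (subst integral_Re[OF i, symmetric]) simp
qed

text \<open>The kernel is at most 2 / (1 - |z|), and the mean over the circle is the value at 0.
  Dilations are used because \<open>G\<close> has no boundary values.\<close>

lemma harnack:
  assumes G: "G holomorphic_on ball 0 1" and pos: "\<And>z. cmod z < 1 \<Longrightarrow> 0 \<le> Re (G z)" and z: "cmod z < 1"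
  shows "Re (G z) \<le> 2 / (1 - cmod z) * Re (G 0)"
proof -
  have bd: "Re (G (of_real r * z)) \<le> 2 / (1 - cmod z) * Re (G 0)" if r: "0 < r" "r < 1" for r :: real
  proof -
    note D = poisson_Re_dilation[OF G r]
    have P: "poisson_kernel z (cis t) \<le> 2 / (1 - cmod z)" for t
      using poisson_kernel_bound[of z "cmod z" "cis t"] z by simp
    have "Re (G (of_real r * z)) = integral\<^sup>L circ (\<lambda>t. poisson_kernel z (cis t) * Re (G (of_real r * cis t)))"
      by (rule D(1)[OF z])
    also have "\<dots> \<le> integral\<^sup>L circ (\<lambda>t. 2 / (1 - cmod z) * Re (G (of_real r * cis t)))"
    proof (rule integral_mono)
      fix t
      show "poisson_kernel z (cis t) * Re (G (of_real r * cis t)) \<le> 2 / (1 - cmod z) * Re (G (of_real r * cis t))"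
        using r by (intro mult_right_mono P pos) (simp add: norm_mult)
    qed (intro integral_circ continuous_intros D(2)[OF z] poisson_kernel_continuous z)+
    also have "\<dots> = 2 / (1 - cmod z) * integral\<^sup>L circ (\<lambda>t. Re (G (of_real r * cis t)))" by simp
    also have "integral\<^sup>L circ (\<lambda>t. Re (G (of_real r * cis t))) = Re (G 0)"
      using D(1)[of 0] by (simp add: poisson_kernel_def)
    finally show ?thesis .
  qed
  have "((\<lambda>n. Re (G (of_real (1 - 1 / (real n + 2)) * z))) \<longlongrightarrow> Re (G (of_real 1 * z))) sequentially"
  proof (intro tendsto_Re isCont_tendsto_compose[of _ G] tendsto_mult tendsto_of_real tendsto_const)
    show "isCont G (of_real 1 * z)"
      using G z holomorphic_on_imp_continuous_on continuous_on_eq_continuous_at[of "ball 0 1" G] by auto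
    show "(\<lambda>n. 1 - 1 / (real n + 2)) \<longlonglongrightarrow> 1" by real_asymp
  qed
  from tendsto_upperbound[OF this _ sequentially_bot, of "2 / (1 - cmod z) * Re (G 0)"] bd show ?thesis
    by (simp add: always_eventually del: of_real_diff)
qed

text \<open>On circles of radius r < 1 the real part, divided by Re (G 0), is a probability density
  in the angle. A weakly convergent subsequence exists, and the Poisson kernel is a bounded
  continuous test function. If Re (G 0) = 0, Harnack's inequality makes the real part vanish and the
  null measure serves.\<close>

lemma herglotz:
  assumes G: "G holomorphic_on ball 0 1" and pos: "\<And>z. cmod z < 1 \<Longrightarrow> 0 \<le> Re (G z)"
  obtains \<nu> where "circle_measure \<nu>" "\<And>z. cmod z < 1 \<Longrightarrow> integral\<^sup>L \<nu> (poisson_kernel z) = Re (G z)"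
proof (cases "Re (G 0) = 0")
  case True
  have "Re (G z) = 0" if "cmod z < 1" for z using harnack[OF G pos that] pos[OF that] True by simp
  moreover have "circle_measure (null_measure borel)"
    by (auto simp: circle_measure_def intro!: finite_measureI)
  ultimately show ?thesis using that[of "null_measure borel"] by simp
next
  case False
  have [measurable]: "cis \<in> borel_measurable borel" by (intro borel_measurable_continuous_onI continuous_intros)
  define c where "c = Re (G 0)"
  have c: "0 < c" using False pos[of 0] by (simp add: c_def)
  define r where "r n = 1 - 1 / (real n + 2)" for n
  have r: "0 < r n" "r n < 1" for n by (auto simp: r_def)
  define f where "f n t = Re (G (of_real (r n) * cis t)) / c" for n t
  have fc: "continuous_on UNIV (f n)" for n
    unfolding f_def using c by (intro continuous_intros poisson_Re_dilation(2)[OF G r, of 0]) auto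
  have [measurable]: "f n \<in> borel_measurable borel" for n using fc by (rule borel_measurable_continuous_onI)
  have f0: "0 \<le> f n t" for n t
    unfolding f_def using c r[of n] by (intro divide_nonneg_pos pos) (auto simp: norm_mult)
  have fP: "integral\<^sup>L circ (\<lambda>t. f n t * poisson_kernel z (cis t)) = Re (G (of_real (r n) * z)) / c" if "cmod z < 1" for n z
    unfolding f_def poisson_Re_dilation(1)[OF G r that] by (simp add: mult.commute)
  have f1: "integral\<^sup>L circ (f n) = 1" for n using fP[of 0 n] c by (simp add: poisson_kernel_def c_def)
  define \<mu> where "\<mu> n = density circ (\<lambda>t. ennreal (f n t))" for n
  have dist: "real_distribution (\<mu> n)" for n
  proof -
    have "emeasure (\<mu> n) (space (\<mu> n)) = \<integral>\<^sup>+ t. ennreal (f n t) \<partial>circ"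
      unfolding \<mu>_def by (simp add: emeasure_density)
    also have "\<dots> = ennreal (integral\<^sup>L circ (f n))"
      using f0 by (intro nn_integral_eq_integral integral_circ fc) auto
    finally have "emeasure (\<mu> n) (space (\<mu> n)) = 1" using f1 by simp
    then show ?thesis
      by (auto simp: real_distribution_def real_distribution_axioms_def \<mu>_def intro!: prob_spaceI)
  qed
  have "tight \<mu>"
    unfolding tight_def
  proof (intro conjI allI impI dist)
    fix \<epsilon> :: real assume \<epsilon>: "0 < \<epsilon>"
    \<comment> \<open>The interval contains all angles in [0, 2 * pi], since pi < 4.\<close>
    have "measure (\<mu> n) {-1<..9} = 1" for n
    proof -
      interpret real_distribution "\<mu> n" by (rule dist)
      have "AE t in circ. t \<in> {-1<..9}"
        unfolding circ_def by (rule AE_uniform_measureI) (use pi_less_4 in \<open>auto intro!: AE_I2\<close>)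
      then have "AE t in \<mu> n. t \<in> {-1<..9}" unfolding \<mu>_def by (subst AE_density) auto
      then show ?thesis by (subst prob_eq_1) auto
    qed
    then show "\<exists>a b. a < b \<and> (\<forall>n. 1 - \<epsilon> < measure (\<mu> n) {a<..b})"
      using \<epsilon> by (intro exI[of _ "-1"] exI[of _ 9]) auto
  qed
  from tight_imp_convergent_subsubsequence[OF this strict_mono_id]
  obtain s M where s: "strict_mono s" and M: "real_distribution M" and conv: "weak_conv_m (\<mu> \<circ> s) M"
    by (auto simp: o_def)
  interpret M: real_distribution M by (rule M)
  have lim: "integral\<^sup>L M (\<lambda>t. poisson_kernel z (cis t)) = Re (G z) / c" if z: "cmod z < 1" for z
  proof -
    have "(\<lambda>n. integral\<^sup>L ((\<mu> \<circ> s) n) (\<lambda>t. poisson_kernel z (cis t))) \<longlonglongrightarrow> integral\<^sup>L M (\<lambda>t. poisson_kernel z (cis t))"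
    proof (rule weak_conv_imp_integral_bdd_continuous_conv[OF _ M conv])
      show "isCont (\<lambda>t. poisson_kernel z (cis t)) x" for x
        using poisson_kernel_continuous[OF z] by (simp add: continuous_on_eq_continuous_at)
      show "norm (poisson_kernel z (cis x)) \<le> 2 / (1 - cmod z)" for x
        using poisson_kernel_bound[of z "cmod z" "cis x"] z by simp
    qed (simp add: dist)
    moreover have "integral\<^sup>L ((\<mu> \<circ> s) n) (\<lambda>t. poisson_kernel z (cis t)) = Re (G (of_real (r (s n)) * z)) / c" for n
      unfolding \<mu>_def o_def
      by (subst integral_density) (auto simp: f0 fP[OF z])
    moreover have "(\<lambda>n. Re (G (of_real (r (s n)) * z)) / c) \<longlonglongrightarrow> Re (G (of_real 1 * z)) / c"
    proof (intro tendsto_divide tendsto_Re isCont_tendsto_compose[of _ G] tendsto_mult tendsto_of_real tendsto_const)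
      show "isCont G (of_real 1 * z)"
        using G z holomorphic_on_imp_continuous_on continuous_on_eq_continuous_at[of "ball 0 1" G] by auto
      have "r \<longlonglongrightarrow> 1" unfolding r_def by real_asymp
      from LIMSEQ_subseq_LIMSEQ[OF this s] show "(\<lambda>n. r (s n)) \<longlonglongrightarrow> 1" by (simp add: o_def)
    qed (use c in auto)
    ultimately show ?thesis using LIMSEQ_unique by fastforce
  qed
  \<comment> \<open>The density c undoes the normalisation, and \<open>cis\<close> identifies angles
    modulo 2 * pi.\<close>
  define \<nu> where "\<nu> = distr (density M (\<lambda>_. ennreal c)) borel cis"
  have "circle_measure \<nu>"
    unfolding circle_measure_def
  proof (intro conjI)
    have "emeasure \<nu> (space \<nu>) = ennreal c"
      unfolding \<nu>_def using M.emeasure_space_1 by (simp add: emeasure_distr emeasure_density)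
    then show "finite_measure \<nu>" by (intro finite_measureI) simp
    have "cis -` (- sphere 0 1) = {}" by auto
    then show "emeasure \<nu> (- sphere 0 1) = 0" unfolding \<nu>_def by (subst emeasure_distr) auto
  qed (simp add: \<nu>_def)
  moreover have "integral\<^sup>L \<nu> (poisson_kernel z) = Re (G z)" if z: "cmod z < 1" for z
  proof -
    have "integral\<^sup>L \<nu> (poisson_kernel z) = integral\<^sup>L (density M (\<lambda>_. ennreal c)) (\<lambda>t. poisson_kernel z (cis t))"
      unfolding \<nu>_def by (subst integral_distr) auto
    also have "\<dots> = c * integral\<^sup>L M (\<lambda>t. poisson_kernel z (cis t))"
      using c by (subst integral_density) auto
    finally show ?thesis using lim[OF z] c by simp
  qed
  ultimately show ?thesis using that by blast
qed

section \<open>The boundary measure of a Schur function\<close>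

locale schur_function =
  fixes b :: "complex \<Rightarrow> complex"
  assumes hol: "b holomorphic_on ball 0 1" and le_1: "\<forall>z\<in>ball 0 1. cmod (b z) \<le> 1"
    and nz: "\<exists>w\<in>ball 0 1. b w \<noteq> 0"
begin

lemma boundary_rep_circle_measure: "boundary_rep b \<nu> \<Longrightarrow> circle_measure \<nu>"
  by (simp add: boundary_rep_def circle_measure_def)

text \<open>The defining identity is available only off the zeros of \<open>b\<close>. These are
  isolated, so a zero is approached by other points, and Poisson integrals are continuous in the
  disc.\<close>

lemma boundary_rep_unique:
  assumes \<nu>: "boundary_rep b \<nu>" "boundary_rep b \<nu>'" shows "\<nu> = \<nu>'"
proof (rule circle_measure_unique)
  note cm = \<nu>[THEN boundary_rep_circle_measure]
  show "circle_measure \<nu>" "circle_measure \<nu>'" by (fact cm)+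
  fix z :: complex assume z: "cmod z < 1"
  have eq: "integral\<^sup>L \<nu> (poisson_kernel w) = integral\<^sup>L \<nu>' (poisson_kernel w)" if "cmod w < 1" "b w \<noteq> 0" for w
    using \<nu> that unfolding boundary_rep_def by (metis mem_ball_0)
  define R where "R = (1 + cmod z) / 2"
  have R: "cmod z < R" "R < 1" using z by (auto simp: R_def)
  define zn where "zn n = z + of_real (1 / (real n + 1))" for n
  have lim: "zn \<longlonglongrightarrow> z"
  proof -
    have "(\<lambda>n. 1 / (real n + 1)) \<longlonglongrightarrow> 0" by real_asymp
    then have "(\<lambda>n. z + complex_of_real (1 / (real n + 1))) \<longlonglongrightarrow> z + of_real 0" by (intro tendsto_intros)
    then show ?thesis unfolding zn_def by (simp only: of_real_0 add_0_right)
  qed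
  define U where "U = ball 0 R - (zeros_in b \<inter> cball 0 R - {z})"
  have "open U" unfolding U_def using finite_zeros_cball[OF hol nz R(2)]
    by (intro open_Diff open_ball finite_imp_closed) auto
  moreover have "z \<in> U" using R by (simp add: U_def)
  ultimately have "\<forall>\<^sub>F n in sequentially. zn n \<in> U" using lim topological_tendstoD by blast
  then have ev: "\<forall>\<^sub>F n in sequentially. integral\<^sup>L \<nu> (poisson_kernel (zn n)) = integral\<^sup>L \<nu>' (poisson_kernel (zn n))"
  proof eventually_elim
    case (elim n)
    have "complex_of_real (1 / (real n + 1)) \<noteq> 0" by (subst of_real_eq_0_iff) auto
    then have "zn n \<noteq> z" unfolding zn_def by (metis add_cancel_right_right)
    then show ?case using elim R by (intro eq) (auto simp: U_def zeros_in_def)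
  qed
  show "integral\<^sup>L \<nu> (poisson_kernel z) = integral\<^sup>L \<nu>' (poisson_kernel z)"
    using LIMSEQ_unique[OF poisson_integral_measure_tendsto[OF cm(1) z lim]]
      tendsto_cong[OF ev] poisson_integral_measure_tendsto[OF cm(2) z lim] by blast
qed

definition blaschke_log :: "complex \<Rightarrow> complex \<Rightarrow> real" where
  "blaschke_log z a = - (real (nat (zorder b a)) * ln (cmod (mob a z)))"

text \<open>The quotient by all zeros has no zeros and modulus at most 1, so it is exp G with Re (-
  G) \<ge> 0, and Herglotz' theorem represents - G. Summability is recorded too, because
  \<open>infsum\<close> of a non-summable family would be 0 by default.\<close>

lemma boundary_rep_exists:
  shows "\<exists>\<nu>. boundary_rep b \<nu>"
    and blaschke_log_summable: "cmod z < 1 \<Longrightarrow> b z \<noteq> 0 \<Longrightarrow> blaschke_log z summable_on zeros_in b"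
proof -
  obtain g where g: "g holomorphic_on ball 0 1" "\<And>z. cmod z < 1 \<Longrightarrow> g z \<noteq> 0 \<and> cmod (g z) \<le> 1"
    "\<And>z. cmod z < 1 \<Longrightarrow> b z \<noteq> 0 \<Longrightarrow>
      ((\<lambda>a. real (nat (zorder b a)) * ln (cmod (mob a z))) has_sum (ln (cmod (b z)) - ln (cmod (g z)))) (zeros_in b)"
    by (rule blaschke_division[OF hol nz le_1]) (rule that; assumption)
  show "blaschke_log z summable_on zeros_in b" if "cmod z < 1" "b z \<noteq> 0" for z
    unfolding blaschke_log_def summable_on_uminus using g(3)[OF that] by (auto simp: summable_on_def)
  have "\<exists>G. G holomorphic_on ball 0 1 \<and> (\<forall>z\<in>ball 0 1. g z = exp (G z))"
    by (rule contractible_imp_holomorphic_log[OF g(1)]) (use g(2) convex_imp_contractible in auto)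
  then obtain G where G: "G holomorphic_on ball 0 1" "\<And>z. cmod z < 1 \<Longrightarrow> g z = exp (G z)" by auto
  have ReG: "Re (- G z) = - ln (cmod (g z))" if "cmod z < 1" for z using G(2)[OF that] by simp
  have G': "(\<lambda>z. - G z) holomorphic_on ball 0 1" using G by (intro holomorphic_intros)
  have pos: "0 \<le> Re (- G z)" if "cmod z < 1" for z
    unfolding ReG[OF that] using g(2)[OF that] by simp
  obtain \<nu> where \<nu>: "circle_measure \<nu>" "\<And>z. cmod z < 1 \<Longrightarrow> integral\<^sup>L \<nu> (poisson_kernel z) = Re (- G z)"
    by (rule herglotz[OF G' pos], assumption) (rule that; assumption)
  have "boundary_rep b \<nu>"
    unfolding boundary_rep_def
  proof (intro conjI ballI impI)
    fix z assume z: "z \<in> ball 0 1" "b z \<noteq> 0"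
    then have z1: "cmod z < 1" by simp
    show "integrable \<nu> (poisson_kernel z)" by (rule poisson_kernel_integrable[OF \<nu>(1) z1])
    have "log_blaschke b z = ln (cmod (b z)) - ln (cmod (g z))"
      unfolding log_blaschke_def using infsumI[OF g(3)[OF z1 z(2)]] by (simp add: mob_def)
    then show "- ln (cmod (b z)) + log_blaschke b z = integral\<^sup>L \<nu> (poisson_kernel z)"
      using \<nu>(2)[OF z1] ReG[OF z1] by simp
  qed (use \<nu> in \<open>auto simp: circle_measure_def\<close>)
  then show "\<exists>\<nu>. boundary_rep b \<nu>" by blast
qed

abbreviation \<nu> where "\<nu> \<equiv> boundary_measure b"

text \<open>Existence and uniqueness give the definite description its intended meaning.\<close>

lemma boundary_rep_boundary_measure: "boundary_rep b \<nu>"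
  unfolding boundary_measure_def using boundary_rep_exists(1) boundary_rep_unique by (metis theI')

lemma circle_measure_\<nu>: "circle_measure \<nu>"
  by (rule boundary_rep_circle_measure[OF boundary_rep_boundary_measure])

lemma sets_\<nu>[measurable_cong, simp]: "sets \<nu> = sets borel"
  using circle_measure_\<nu> by (simp add: circle_measure_def)

lemma finite_measure_\<nu>: "finite_measure \<nu>"
  using circle_measure_\<nu> by (simp add: circle_measure_def)

lemma zeros_inD: "a \<in> zeros_in b \<Longrightarrow> cmod a < 1" by (simp add: zeros_in_def)

lemma blaschke_log_nonneg:
  assumes "a \<in> zeros_in b" "cmod z < 1" shows "0 \<le> blaschke_log z a"
proof -
  have "ln (cmod (mob a z)) \<le> 0"
    using mob_le_1[of a z] zeros_inD[OF assms(1)] assms(2) by (cases "mob a z = 0") auto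
  then show ?thesis by (simp add: blaschke_log_def mult_nonneg_nonpos)
qed

lemma ln_b_eq:
  assumes "cmod z < 1" "b z \<noteq> 0"
  shows "- ln (cmod (b z)) = integral\<^sup>L \<nu> (poisson_kernel z) + infsum (blaschke_log z) (zeros_in b)"
proof -
  have "infsum (blaschke_log z) (zeros_in b) = - log_blaschke b z"
    unfolding blaschke_log_def log_blaschke_def mob_def by (rule infsum_uminus)
  moreover have "- ln (cmod (b z)) + log_blaschke b z = integral\<^sup>L \<nu> (poisson_kernel z)"
    using boundary_rep_boundary_measure assms unfolding boundary_rep_def by simp
  ultimately show ?thesis by simp
qed

text \<open>Every zero has positive multiplicity and positive distance to the circle, so each weight
  is strictly positive. From here on \<open>sigma_b\<close> enters only through this location
  statement.\<close>

lemma sigma_b_eq_0_iff: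
  "sigma_b b A = 0 \<longleftrightarrow> zeros_in b \<inter> A = {} \<and> emeasure \<nu> (A \<inter> sphere 0 1) = 0"
proof -
  let ?f = "\<lambda>a. ennreal ((1 - cmod a) * real (nat (zorder b a)))"
  have "infsum ?f (zeros_in b \<inter> A) = 0 \<longleftrightarrow> zeros_in b \<inter> A = {}"
  proof
    assume 0: "infsum ?f (zeros_in b \<inter> A) = 0"
    have "infsum ?f (zeros_in b \<inter> A) = (SUP F\<in>{F. finite F \<and> F \<subseteq> zeros_in b \<inter> A}. sum ?f F)"
      by (rule nonneg_infsum_complete) auto
    then have z: "sum ?f F = 0" if "finite F" "F \<subseteq> zeros_in b \<inter> A" for F
      using that 0 by (metis (mono_tags, lifting) SUP_upper le_zero_eq mem_Collect_eq)
    show "zeros_in b \<inter> A = {}"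
    proof (rule ccontr)
      assume "zeros_in b \<inter> A \<noteq> {}"
      then obtain a where a: "a \<in> zeros_in b" "a \<in> A" by auto
      have "0 < (1 - cmod a) * real (nat (zorder b a))"
        using zeros_inD[OF a(1)] mob_factor(1)[OF hol nz a(1)] by simp
      then have "0 < ?f a" by (simp only: ennreal_less_zero_iff)
      moreover have "sum ?f {a} = ?f a" by simp
      ultimately show False using z[of "{a}"] a by (metis (no_types, lifting) Int_iff empty_subsetI finite.emptyI finite.insertI insert_subset less_irrefl)
    qed
  qed simp
  then show ?thesis by (simp add: sigma_b_def)
qed

text \<open>Near \<xi> one has - ln |b(z)| \<le> A * (1 - |z|). The measure is handled by the kernel
  bound away from its mass. Each zero contributes at most K * (1 - |z|) times its contribution at a
  fixed point \<open>z0\<close>, where the sum is known to converge.\<close>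

lemma tendsto_1_near_null_arc:
  assumes \<xi>: "cmod \<xi> = 1" and d: "0 < d" and Z: "zeros_in b \<inter> ball \<xi> d = {}" and N: "emeasure \<nu> (ball \<xi> d) = 0"
  shows "((\<lambda>z. cmod (b z)) \<longlongrightarrow> 1) (at \<xi> within ball 0 1)"
proof -
  interpret F: finite_measure \<nu> by (rule finite_measure_\<nu>)
  obtain z0 where z0: "cmod z0 < 1" "b z0 \<noteq> 0" using nz unfolding Bex_def mem_ball_0 by blast
  \<comment> \<open>64 = 8 * 8. One factor 8 comes with d^2, from distances of at least d/2 and 1 -
    |z|^2 \<le> 2 * (1 - |z|). The other is 2 * 4, from the square in the logarithm and |1 - cnj a *
    z0|^2 \<le> 4.\<close>
  define K where "K = 64 / (d\<^sup>2 * (1 - (cmod z0)\<^sup>2))"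
  define L where "L = infsum (blaschke_log z0) (zeros_in b)"
  define A where "A = 8 / d\<^sup>2 * measure \<nu> UNIV + K * L"
  have n0: "0 < 1 - (cmod z0)\<^sup>2" using z0 by (simp add: power_less_one_iff)
  have K: "0 < K" unfolding K_def using d n0 by simp
  have bd: "exp (- (A * (1 - cmod z))) \<le> cmod (b z)"
    if z: "cmod z < 1" "dist z \<xi> < d / 2" and small: "8 / d\<^sup>2 * (1 - cmod z) \<le> 1/2" for z
  proof -
    have bz: "b z \<noteq> 0" using Z z d by (auto simp: zeros_in_def dist_commute)
    have one: "0 \<le> 1 - (cmod z)\<^sup>2" "1 - (cmod z)\<^sup>2 \<le> 2 * (1 - cmod z)"
    proof -
      have "1 - (cmod z)\<^sup>2 = (1 - cmod z) * (1 + cmod z)" by (simp add: power2_eq_square algebra_simps)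
      also have "\<dots> \<le> (1 - cmod z) * 2" using z by (intro mult_left_mono) auto
      finally show "1 - (cmod z)\<^sup>2 \<le> 2 * (1 - cmod z)" by simp
    qed (use z in \<open>simp add: power_le_one\<close>)
    have P: "integral\<^sup>L \<nu> (poisson_kernel z) \<le> integral\<^sup>L \<nu> (\<lambda>_. 8 / d\<^sup>2 * (1 - cmod z))"
    proof (rule integral_mono_AE)
      show "integrable \<nu> (poisson_kernel z)" by (rule poisson_kernel_integrable[OF circle_measure_\<nu> z(1)])
      have "AE \<eta> in \<nu>. \<eta> \<notin> ball \<xi> d" using N by (intro AE_not_in) (auto simp: null_sets_def)
      with circle_measure_AE[OF circle_measure_\<nu>]
      show "AE \<eta> in \<nu>. poisson_kernel z \<eta> \<le> 8 / d\<^sup>2 * (1 - cmod z)"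
      proof eventually_elim
        case (elim \<eta>)
        have "d / 2 \<le> cmod (\<eta> - z)" using elim(2) z(2) dist_triangle[of \<xi> \<eta> z]
          by (simp add: dist_norm norm_minus_commute)
        then have "poisson_kernel z \<eta> \<le> (2 * (1 - cmod z)) / (d/2)\<^sup>2"
          unfolding poisson_kernel_def using d one by (intro frac_le power_mono) auto
        then show ?case by (simp add: power2_eq_square)
      qed
    qed simp
    also have "\<dots> = 8 / d\<^sup>2 * measure \<nu> UNIV * (1 - cmod z)"
      using sets_eq_imp_space_eq[OF sets_\<nu>] by simp
    finally have P: "integral\<^sup>L \<nu> (poisson_kernel z) \<le> 8 / d\<^sup>2 * measure \<nu> UNIV * (1 - cmod z)" .
    have zero_term: "blaschke_log z a \<le> K * (1 - cmod z) * blaschke_log z0 a" if a: "a \<in> zeros_in b" for a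
    proof -
      have a1: "cmod a < 1" by (rule zeros_inD[OF a])
      have a2: "0 \<le> 1 - (cmod a)\<^sup>2" "1 - (cmod a)\<^sup>2 \<le> 1" using a1 by (auto simp: power_le_one)
      define x where "x = 1 - (cmod (mob a z))\<^sup>2"
      define y where "y = 1 - (cmod (mob a z0))\<^sup>2"
      have ne: "mob a z \<noteq> 0" "mob a z0 \<noteq> 0"
        using mob_eq_0_iff[OF a1, of z] mob_eq_0_iff[OF a1, of z0] z z0 bz a by (auto simp: zeros_in_def)
      have "d / 2 \<le> cmod (z - a)" using Z a z(2) dist_triangle[of \<xi> a z]
        by (force simp: dist_norm norm_minus_commute)
      also have "\<dots> \<le> cmod (1 - cnj a * z)"
        using mob_le_1[OF a1, of z] z mob_denom_nonzero[OF a1, of z] by (simp add: mob_def norm_divide)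
      finally have dd: "(d/2)\<^sup>2 \<le> (cmod (1 - cnj a * z))\<^sup>2" using d by (intro power_mono) auto
      have "x \<le> ((1 - (cmod a)\<^sup>2) * (2 * (1 - cmod z))) / (d/2)\<^sup>2"
        unfolding x_def one_minus_mob[OF a1 less_imp_le[OF z(1)]]
        using dd one a2 d z by (intro frac_le mult_left_mono mult_nonneg_nonneg) auto
      then have x1: "x \<le> (8 / d\<^sup>2 * (1 - cmod z)) * (1 - (cmod a)\<^sup>2)"
        using d by (simp add: power_divide field_simps)
      also have "\<dots> \<le> 1/2 * 1" using small a2 d z by (intro mult_mono) auto
      finally have x2: "x \<le> 1/2" by simp
      have x0: "0 \<le> x" using mob_le_1[OF a1, of z] z by (simp add: x_def power_le_one)
      have "- ln (cmod (mob a z)) = - ln (1 - x) / 2"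
        using ne by (simp add: x_def ln_realpow)
      \<comment> \<open>From - ln (1 - x) \<le> x + 2 * x^2 \<le> 2 * x. This is why z is taken so
        close to the circle that x \<le> 1/2.\<close>
      also have "\<dots> \<le> x" using ln_one_minus_pos_lower_bound[OF x0 x2] mult_left_mono[OF x2 x0]
        by (simp add: power2_eq_square)
      finally have l1: "- ln (cmod (mob a z)) \<le> x" .
      have "1 - (cmod a)\<^sup>2 = y * (cmod (1 - cnj a * z0))\<^sup>2 / (1 - (cmod z0)\<^sup>2)"
        unfolding y_def one_minus_mob[OF a1 less_imp_le[OF z0(1)]]
        using n0 mob_denom_nonzero[OF a1, of z0] z0 by simp
      also have "\<dots> \<le> y * 4 / (1 - (cmod z0)\<^sup>2)"
      proof (intro divide_right_mono mult_left_mono)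
        have "cmod (1 - cnj a * z0) \<le> 1 + cmod a * cmod z0"
          using norm_triangle_ineq4[of 1 "cnj a * z0"] by (simp add: norm_mult)
        also have "\<dots> \<le> 1 + 1 * 1" using a1 z0 by (intro add_mono mult_mono) auto
        finally have "(cmod (1 - cnj a * z0))\<^sup>2 \<le> 2\<^sup>2" by (intro power_mono) auto
        then show "(cmod (1 - cnj a * z0))\<^sup>2 \<le> 4" by simp
        show "0 \<le> y" using mob_le_1[OF a1, of z0] z0 by (simp add: y_def power_le_one)
      qed (use n0 in auto)
      also have "\<dots> \<le> (- 2 * ln (cmod (mob a z0))) * 4 / (1 - (cmod z0)\<^sup>2)"
      proof (intro divide_right_mono mult_right_mono)
        have "ln ((cmod (mob a z0))\<^sup>2) \<le> (cmod (mob a z0))\<^sup>2 - 1" using ne by (intro ln_le_minus_one) auto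
        then show "y \<le> - 2 * ln (cmod (mob a z0))" using ne by (simp add: y_def ln_realpow)
      qed (use n0 in auto)
      finally have l2: "1 - (cmod a)\<^sup>2 \<le> (- 2 * ln (cmod (mob a z0))) * 4 / (1 - (cmod z0)\<^sup>2)" .
      have "- ln (cmod (mob a z)) \<le> (8 / d\<^sup>2 * (1 - cmod z)) * ((- 2 * ln (cmod (mob a z0))) * 4 / (1 - (cmod z0)\<^sup>2))"
        using order_trans[OF l1 x1] mult_left_mono[OF l2, of "8 / d\<^sup>2 * (1 - cmod z)"] z by simp
      also have "\<dots> = K * (1 - cmod z) * (- ln (cmod (mob a z0)))"
        unfolding K_def by simp
      finally have "real (nat (zorder b a)) * (- ln (cmod (mob a z))) \<le> real (nat (zorder b a)) * (K * (1 - cmod z) * (- ln (cmod (mob a z0))))"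
        by (intro mult_left_mono) auto
      then show ?thesis by (simp add: blaschke_log_def mult_ac)
    qed
    have "infsum (blaschke_log z) (zeros_in b) \<le> infsum (\<lambda>a. K * (1 - cmod z) * blaschke_log z0 a) (zeros_in b)"
      by (intro infsum_mono zero_term blaschke_log_summable summable_on_cmult_right z bz z0)
    also have "\<dots> = K * (1 - cmod z) * L"
      unfolding L_def by (rule infsum_cmult_right) (use blaschke_log_summable[OF z0] in auto)
    finally have "- ln (cmod (b z)) \<le> A * (1 - cmod z)"
      unfolding ln_b_eq[OF z(1) bz] A_def using P by (simp add: algebra_simps)
    then have "- (A * (1 - cmod z)) \<le> ln (cmod (b z))" by simp
    then show ?thesis using bz by (metis exp_le_cancel_iff exp_ln zero_less_norm_iff)
  qed
  have ev1: "\<forall>\<^sub>F z in at \<xi> within ball 0 1. cmod z < 1" by (auto simp: eventually_at_filter)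
  have ev2: "\<forall>\<^sub>F z in at \<xi> within ball 0 1. dist z \<xi> < d/2"
    using d by (auto simp: eventually_at intro!: exI[of _ "d/2"])
  have "((\<lambda>z. 8 / d\<^sup>2 * (1 - cmod z)) \<longlongrightarrow> 8 / d\<^sup>2 * (1 - cmod \<xi>)) (at \<xi> within ball 0 1)" by (intro tendsto_intros)
  then have ev3: "\<forall>\<^sub>F z in at \<xi> within ball 0 1. 8 / d\<^sup>2 * (1 - cmod z) < 1/2"
    using \<xi> by (intro order_tendstoD) auto
  have lo: "\<forall>\<^sub>F z in at \<xi> within ball 0 1. exp (- (A * (1 - cmod z))) \<le> cmod (b z)"
    using ev1 ev2 ev3 by eventually_elim (rule bd, auto)
  have up: "\<forall>\<^sub>F z in at \<xi> within ball 0 1. cmod (b z) \<le> 1"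
    using ev1 by eventually_elim (use le_1 in auto)
  have "((\<lambda>z. exp (- (A * (1 - cmod z)))) \<longlongrightarrow> exp (- (A * (1 - cmod \<xi>)))) (at \<xi> within ball 0 1)"
    by (intro tendsto_intros)
  then have "((\<lambda>z. exp (- (A * (1 - cmod z)))) \<longlongrightarrow> 1) (at \<xi> within ball 0 1)" using \<xi> by simp
  from tendsto_sandwich[OF lo up this tendsto_const] show ?thesis .
qed

section \<open>The spectrum and arcs without mass\<close>

lemma tendsto_1_not_spec:
  assumes "((\<lambda>z. cmod (b z)) \<longlongrightarrow> 1) (at \<xi> within ball 0 1)" "cmod \<xi> = 1" shows "\<xi> \<notin> spec b"
proof -
  have "at \<xi> within ball (0::complex) 1 \<noteq> bot"
    using assms(2) by (simp add: trivial_limit_within islimpt_ball)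
  moreover have "((\<lambda>z. ereal (cmod (b z))) \<longlongrightarrow> ereal 1) (at \<xi> within ball 0 1)"
    using assms(1) by (intro tendsto_intros)
  ultimately have "Liminf (at \<xi> within ball 0 1) (\<lambda>z. ereal (cmod (b z))) = ereal 1"
    by (intro lim_imp_Liminf)
  then show ?thesis by (simp add: spec_def one_ereal_def)
qed

lemma not_spec_eventually:
  assumes "\<xi> \<notin> spec b" "cmod \<xi> = 1" "0 < \<epsilon>"
  shows "\<forall>\<^sub>F z in at \<xi> within ball 0 1. 1 - \<epsilon> < cmod (b z)"
proof -
  have "1 \<le> Liminf (at \<xi> within ball 0 1) (\<lambda>z. ereal (cmod (b z)))"
    using assms by (simp add: spec_def not_less)
  moreover have "ereal (1 - \<epsilon>) < 1" using assms by (simp add: one_ereal_def)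
  ultimately have "\<forall>\<^sub>F z in at \<xi> within ball 0 1. ereal (1 - \<epsilon>) < ereal (cmod (b z))"
    unfolding le_Liminf_iff by blast
  then show ?thesis by simp
qed

text \<open>At the point of depth \<delta> below \<xi> the kernel is at least 1 / (4 * \<delta>) on
  this ball: distances are at most 2 * \<delta>, and 1 - |z|^2 \<ge> \<delta>. Hence the value of -
  ln |b| at that point bounds the mass per length.\<close>

lemma measure_small_cball:
  assumes \<xi>: "cmod \<xi> = 1" and \<delta>: "0 < \<delta>" "\<delta> < 1" and nz: "b (of_real (1 - \<delta>) * \<xi>) \<noteq> 0"
  shows "measure \<nu> (cball \<xi> \<delta>) \<le> 4 * \<delta> * (- ln (cmod (b (of_real (1 - \<delta>) * \<xi>))))"
proof -
  interpret F: finite_measure \<nu> by (rule finite_measure_\<nu>)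
  define z where "z = of_real (1 - \<delta>) * \<xi>"
  have cz: "cmod z = 1 - \<delta>" unfolding z_def norm_mult norm_of_real using \<xi> \<delta> by simp
  then have z: "cmod z < 1" using \<delta> by simp
  have zx: "\<xi> - z = of_real \<delta> * \<xi>" by (simp add: z_def algebra_simps)
  have ge: "0 \<le> infsum (blaschke_log z) (zeros_in b)"
    by (rule infsum_nonneg) (use blaschke_log_nonneg z in auto)
  have "1 / (4 * \<delta>) * measure \<nu> (cball \<xi> \<delta>) = integral\<^sup>L \<nu> (\<lambda>\<eta>. 1 / (4 * \<delta>) * indicator (cball \<xi> \<delta>) \<eta>)"
    using sets_eq_imp_space_eq[OF sets_\<nu>] by simp
  also have "\<dots> \<le> integral\<^sup>L \<nu> (poisson_kernel z)"
  proof (rule integral_mono_AE)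
    show "integrable \<nu> (poisson_kernel z)" by (rule poisson_kernel_integrable[OF circle_measure_\<nu> z])
    show "integrable \<nu> (\<lambda>\<eta>. 1 / (4 * \<delta>) * indicator (cball \<xi> \<delta>) \<eta>)"
      by (intro integrable_mult_right integrable_real_indicator) (auto simp: F.emeasure_eq_measure)
    show "AE \<eta> in \<nu>. 1 / (4 * \<delta>) * indicator (cball \<xi> \<delta>) \<eta> \<le> poisson_kernel z \<eta>"
      using circle_measure_AE[OF circle_measure_\<nu>]
    proof eventually_elim
      case (elim \<eta>)
      show ?case
      proof (cases "\<eta> \<in> cball \<xi> \<delta>")
        case True
        have "cmod (\<eta> - z) \<le> cmod (\<eta> - \<xi>) + cmod (\<xi> - z)" using norm_triangle_ineq[of "\<eta> - \<xi>" "\<xi> - z"] by simp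
        also have "\<dots> \<le> 2 * \<delta>" using True \<xi> \<delta> by (simp add: zx norm_mult dist_norm norm_minus_commute)
        finally have "(cmod (\<eta> - z))\<^sup>2 \<le> (2 * \<delta>)\<^sup>2" by (intro power_mono) auto
        moreover have "\<eta> \<noteq> z" using z elim by auto
        moreover have "\<delta> \<le> 1 - (cmod z)\<^sup>2"
        proof -
          have "(cmod z)\<^sup>2 \<le> cmod z" using z by (simp add: power2_eq_square mult_left_le)
          then show ?thesis using cz by simp
        qed
        ultimately have "\<delta> / (2 * \<delta>)\<^sup>2 \<le> poisson_kernel z \<eta>"
          unfolding poisson_kernel_def using \<delta> by (intro frac_le) auto
        then show ?thesis using True \<delta> by (simp add: power2_eq_square)
      next
        case False
        then show ?thesis using poisson_kernel_pos[OF z elim] by simp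
      qed
    qed
  qed
  also have "\<dots> \<le> - ln (cmod (b z))" using ln_b_eq[OF z] nz ge by (simp add: z_def)
  finally show ?thesis using \<delta> by (simp add: z_def field_simps)
qed

lemma cis_dist_le: "dist (cis s) (cis t) \<le> \<bar>s - t\<bar>"
proof -
  have "cis s - cis t = cis t * (cis (s - t) - 1)" by (simp add: algebra_simps cis_mult)
  then have "dist (cis s) (cis t) = dist (cis (s - t)) 1" by (simp add: dist_norm norm_mult)
  also have "\<dots> = 2 * \<bar>sin ((s - t) / 2)\<bar>" unfolding cis_conv_exp dist_norm by (rule dist_exp_i_1)
  also have "\<dots> \<le> \<bar>s - t\<bar>" using abs_sin_x_le_abs_x[of "(s - t) / 2"] by simp
  finally show ?thesis .
qed

text \<open>By compactness |b| > 1 - \<epsilon> holds uniformly near \<open>K\<close>. About 2 * pi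
  / \<delta> balls of radius \<delta> cover \<open>K\<close>, and each has mass at most 4 * \<delta>
  * (- ln (1 - \<epsilon>)). The factor \<delta> cancels, and then \<epsilon> tends to 0.\<close>

lemma measure_compact_avoiding_spec:
  assumes K: "compact K" "K \<subseteq> sphere 0 1" "K \<inter> spec b = {}"
  shows "measure \<nu> K = 0"
proof -
  interpret F: finite_measure \<nu> by (rule finite_measure_\<nu>)
  have bound: "measure \<nu> K \<le> 8 * pi * (- ln (1 - \<epsilon>))" if \<epsilon>: "0 < \<epsilon>" "\<epsilon> < 1" for \<epsilon>
  proof -
    have "\<forall>\<xi>\<in>K. \<exists>U. open U \<and> \<xi> \<in> U \<and> (\<forall>z\<in>U. z \<noteq> \<xi> \<longrightarrow> z \<in> ball 0 1 \<longrightarrow> 1 - \<epsilon> < cmod (b z))"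
    proof
      fix \<xi> assume "\<xi> \<in> K"
      then have "\<xi> \<notin> spec b" "cmod \<xi> = 1" using K by auto
      from not_spec_eventually[OF this \<epsilon>(1)]
      show "\<exists>U. open U \<and> \<xi> \<in> U \<and> (\<forall>z\<in>U. z \<noteq> \<xi> \<longrightarrow> z \<in> ball 0 1 \<longrightarrow> 1 - \<epsilon> < cmod (b z))"
        unfolding eventually_at_topological .
    qed
    then obtain U where U: "\<And>\<xi>. \<xi> \<in> K \<Longrightarrow> open (U \<xi>) \<and> \<xi> \<in> U \<xi> \<and> (\<forall>z\<in>U \<xi>. z \<noteq> \<xi> \<longrightarrow> z \<in> ball 0 1 \<longrightarrow> 1 - \<epsilon> < cmod (b z))"
      by metis
    have "K \<subseteq> \<Union>(U ` K)" "\<And>B. B \<in> U ` K \<Longrightarrow> open B" using U by auto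
    then obtain e where e: "0 < e" "\<forall>\<xi>\<in>K. \<exists>B\<in>U ` K. ball \<xi> e \<subseteq> B"
      using Heine_Borel_lemma[OF K(1)] by metis
    have near: "1 - \<epsilon> < cmod (b z)" if z: "\<xi> \<in> K" "dist \<xi> z < e" "cmod z < 1" for \<xi> z
    proof -
      obtain \<xi>' where "\<xi>' \<in> K" "ball \<xi> e \<subseteq> U \<xi>'" using e(2) z(1) by auto
      moreover have "z \<noteq> \<xi>'" using K(2) \<open>\<xi>' \<in> K\<close> z(3) by auto
      moreover have "z \<in> ball \<xi> e" using z by simp
      ultimately show ?thesis using U[of \<xi>'] z(3) by (meson mem_ball_0 subsetD)
    qed
    obtain n :: nat where n: "2 * pi / min e 1 < real n" using reals_Archimedean2 by blast
    have npos: "0 < real n" using n e pi_gt_zero by (smt (verit) divide_pos_pos min_less_iff_conj)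
    define \<delta> where "\<delta> = 2 * pi / real n"
    have "2 * pi / real n < m" if "2 * pi / m < real n" "0 < m" for m using that npos by (simp add: field_simps)
    from this[OF n] have \<delta>: "0 < \<delta>" "\<delta> < min e 1"
      using npos e unfolding \<delta>_def by auto
    define I where "I k = {2 * pi * real k / real n .. 2 * pi * (real k + 1) / real n}" for k :: nat
    \<comment> \<open>The centres must lie in \<open>K\<close>, where the lower bound for |b| is
      known. For an arc that misses \<open>K\<close> the choice is meaningless, and
      \<open>f k\<close> is set to be empty.\<close>
    define \<xi> where "\<xi> k = (SOME \<xi>. \<xi> \<in> K \<inter> cis ` I k)" for k
    define f where "f k = (if K \<inter> cis ` I k = {} then {} else cball (\<xi> k) \<delta>)" for k
    have \<xi>: "\<xi> k \<in> K \<inter> cis ` I k" if "K \<inter> cis ` I k \<noteq> {}" for k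
      unfolding \<xi>_def using that by (metis ex_in_conv someI_ex)
    have cover: "K \<subseteq> (\<Union>k<n. f k)"
    proof
      fix x assume x: "x \<in> K"
      then have "cmod x = 1" using K(2) by auto
      then have "x \<noteq> 0" by auto
      define t where "t = Arg2pi x"
      have t: "0 \<le> t" "t < 2 * pi" "x = cis t"
        using Arg2pi[of x] \<open>cmod x = 1\<close> by (auto simp: t_def cis_conv_exp is_Arg_def)
      define k where "k = nat \<lfloor>t * real n / (2 * pi)\<rfloor>"
      have fl: "real k \<le> t * real n / (2 * pi)" "t * real n / (2 * pi) < real k + 1"
        using t npos unfolding k_def by auto
      have "t * real n / (2 * pi) < real n" using t npos pi_gt_zero by (simp add: field_simps)
      then have "k < n" using fl by linarith
      moreover have "t \<in> I k" unfolding I_def using fl npos pi_gt_zero by (simp add: field_simps)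
      then have ne: "x \<in> K \<inter> cis ` I k" using x t by auto
      then obtain s where s: "s \<in> I k" "\<xi> k = cis s" using \<xi>[of k] by auto
      have "dist (cis s) (cis t) \<le> \<delta>"
      proof (rule order_trans[OF cis_dist_le])
        have "2 * pi * (real k + 1) / real n - 2 * pi * real k / real n = \<delta>"
          unfolding \<delta>_def by (simp add: diff_divide_distrib[symmetric] algebra_simps)
        then show "\<bar>s - t\<bar> \<le> \<delta>" using s(1) \<open>t \<in> I k\<close> unfolding I_def atLeastAtMost_iff by linarith
      qed
      then have "x \<in> f k" unfolding f_def using ne s t by auto
      ultimately show "x \<in> (\<Union>k<n. f k)" by blast
    qed
    have fk: "measure \<nu> (f k) \<le> 4 * \<delta> * (- ln (1 - \<epsilon>))" for k
    proof (cases "K \<inter> cis ` I k = {}")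
      case True
      have "ln (1 - \<epsilon>) \<le> 0" using \<epsilon> by simp
      then show ?thesis using True \<delta> by (simp add: f_def mult_nonneg_nonpos)
    next
      case False
      from \<xi>[OF this] have xk: "\<xi> k \<in> K" "cmod (\<xi> k) = 1" using K(2) by auto
      let ?z = "of_real (1 - \<delta>) * \<xi> k"
      have "\<xi> k - ?z = of_real \<delta> * \<xi> k" by (simp add: algebra_simps)
      then have "dist (\<xi> k) ?z = \<delta>" using xk \<delta> by (simp add: dist_norm norm_mult)
      moreover have "cmod ?z = 1 - \<delta>" unfolding norm_mult norm_of_real using xk \<delta> by simp
      ultimately have big: "1 - \<epsilon> < cmod (b ?z)" using near[OF xk(1), of ?z] \<delta> by simp
      then have nz: "b ?z \<noteq> 0" using \<epsilon> by auto
      have "ln (1 - \<epsilon>) \<le> ln (cmod (b ?z))" using big \<epsilon> nz by (subst ln_le_cancel_iff) auto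
      then have "4 * \<delta> * (- ln (cmod (b ?z))) \<le> 4 * \<delta> * (- ln (1 - \<epsilon>))" using \<delta> by (intro mult_left_mono) auto
      moreover have "measure \<nu> (f k) \<le> 4 * \<delta> * (- ln (cmod (b ?z)))"
        using measure_small_cball[OF xk(2) \<delta>(1) _ nz] \<delta>(2) False by (simp add: f_def del: of_real_diff)
      ultimately show ?thesis by (rule order_trans[rotated])
    qed
    have "measure \<nu> K \<le> measure \<nu> (\<Union>k<n. f k)"
      by (rule F.finite_measure_mono[OF cover]) (auto simp: f_def)
    also have "\<dots> \<le> (\<Sum>k<n. measure \<nu> (f k))"
      by (rule F.finite_measure_subadditive_finite) (auto simp: f_def)
    also have "\<dots> \<le> (\<Sum>k<n. 4 * \<delta> * (- ln (1 - \<epsilon>)))" by (rule sum_mono) (rule fk)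
    also have "\<dots> = 8 * pi * (- ln (1 - \<epsilon>))" using npos by (simp add: \<delta>_def)
    finally show ?thesis .
  qed
  have "((\<lambda>\<epsilon>. 8 * pi * (- ln (1 - \<epsilon>))) \<longlongrightarrow> 8 * pi * (- ln (1 - 0))) (at_right 0)"
    by (intro tendsto_intros) auto
  moreover have "\<forall>\<^sub>F \<epsilon> in at_right 0. measure \<nu> K \<le> 8 * pi * (- ln (1 - \<epsilon>))"
    using eventually_at_right_real[of 0 1, OF zero_less_one] by eventually_elim (use bound in auto)
  ultimately have "measure \<nu> K \<le> 8 * pi * (- ln (1 - 0))"
    by (intro tendsto_lowerbound) auto
  then show ?thesis using measure_nonneg[of \<nu> K] by simp
qed

text \<open>The uniform bound near the set needs compactness, so the open arc is exhausted by
  countably many compact ones.\<close>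

lemma arc_avoiding_spec_null:
  assumes "sphere 0 1 \<inter> ball \<xi>0 \<rho> \<inter> spec b = {}"
  shows "emeasure \<nu> (sphere 0 1 \<inter> ball \<xi>0 \<rho>) = 0"
proof -
  interpret F: finite_measure \<nu> by (rule finite_measure_\<nu>)
  define K where "K n = sphere 0 1 \<inter> cball \<xi>0 (\<rho> - 1 / (real n + 1))" for n :: nat
  have K: "compact (K n)" "K n \<subseteq> sphere 0 1 \<inter> ball \<xi>0 \<rho>" for n
  proof -
    show "compact (K n)" unfolding K_def by (intro compact_Int_closed) auto
    have "0 < 1 / (real n + 1)" by simp
    then have "dist \<xi>0 x < \<rho>" if "dist \<xi>0 x \<le> \<rho> - 1 / (real n + 1)" for x using that by linarith
    then show "K n \<subseteq> sphere 0 1 \<inter> ball \<xi>0 \<rho>" unfolding K_def by auto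
  qed
  have "emeasure \<nu> (K n) = 0" for n
    using measure_compact_avoiding_spec[of "K n"] K[of n] assms by (auto simp: F.emeasure_eq_measure)
  then have "emeasure \<nu> (\<Union>n. K n) = 0"
    using K by (intro emeasure_UN_eq_0) (auto intro!: borel_compact)
  moreover have "(\<Union>n. K n) = sphere 0 1 \<inter> ball \<xi>0 \<rho>"
  proof
    show "(\<Union>n. K n) \<subseteq> sphere 0 1 \<inter> ball \<xi>0 \<rho>" using K by blast
    show "sphere 0 1 \<inter> ball \<xi>0 \<rho> \<subseteq> (\<Union>n. K n)"
    proof
      fix x assume x: "x \<in> sphere 0 1 \<inter> ball \<xi>0 \<rho>"
      then obtain n where "inverse (real (Suc n)) < \<rho> - dist \<xi>0 x" using reals_Archimedean[of "\<rho> - dist \<xi>0 x"] by auto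
      then have "x \<in> K n" using x by (auto simp: K_def inverse_eq_divide algebra_simps)
      then show "x \<in> (\<Union>n. K n)" by blast
    qed
  qed
  ultimately show ?thesis by simp
qed

end

section \<open>From one component to empty squares\<close>

lemma fashoda_complex:
  assumes "path f" "path g"
    and "path_image f \<subseteq> {z. Re z \<in> {0..1} \<and> Im z \<in> {0..1}}" "path_image g \<subseteq> {z. Re z \<in> {0..1} \<and> Im z \<in> {0..1}}"
    and "Re (pathstart f) = 0" "Re (pathfinish f) = 1" "Im (pathstart g) = 0" "Im (pathfinish g) = 1"
  shows "path_image f \<inter> path_image g \<noteq> {}"
proof -
  define V :: "complex \<Rightarrow> real^2" where "V z = vector [Re z, Im z]" for z
  have V: "V z $ 1 = Re z" "V z $ 2 = Im z" for z by (auto simp: V_def)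
  have V_alt: "V z = (\<chi> i. if i = 1 then Re z else Im z)" for z
    by (simp add: vec_eq_iff forall_2 V)
  have cV: "continuous_on S V" for S unfolding V_alt[abs_def]
  proof (intro continuous_on_vec_lambda)
    show "continuous_on S (\<lambda>x. if i = 1 then Re x else Im x)" for i :: 2
      by (cases "i = 1") (auto intro!: continuous_intros)
  qed
  have in_box: "V z \<in> cbox 0 1" if "Re z \<in> {0..1} \<and> Im z \<in> {0..1}" for z
    using that by (auto simp: mem_box_cart forall_2 V)
  obtain p where "p \<in> path_image (V \<circ> f)" "p \<in> path_image (V \<circ> g)"
  proof (rule fashoda[of "V \<circ> f" "V \<circ> g" 0 1])
    show "path (V \<circ> f)" "path (V \<circ> g)" using assms cV by (auto intro: path_continuous_image)
    show "path_image (V \<circ> f) \<subseteq> cbox 0 1" "path_image (V \<circ> g) \<subseteq> cbox 0 1"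
      unfolding path_image_compose using assms(3,4) in_box by blast+
  qed (use assms in \<open>auto simp: pathstart_compose pathfinish_compose V\<close>)
  then obtain u v where uv: "u \<in> path_image f" "v \<in> path_image g" "p = V u" "p = V v"
    by (auto simp: path_image_compose)
  then have "V u = V v" by simp
  then have "u = v" using V by (metis complex_eqI)
  then show ?thesis using uv by blast
qed

text \<open>Cut at the first time with real part at least 1 and, before it, at the last time with
  real part at most 0. In between the real part stays strictly between 0 and 1.\<close>

lemma crossing_subpath:
  assumes q: "path q" and s: "Re (pathstart q) \<le> 0" and f: "1 \<le> Re (pathfinish q)"
  obtains p where "path p" "path_image p \<subseteq> path_image q" "Re (pathstart p) = 0" "Re (pathfinish p) = 1"
    "\<And>w. w \<in> path_image p \<Longrightarrow> Re w \<in> {0..1}"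
proof -
  define h where "h t = Re (q t)" for t
  have hc: "continuous_on {0..1} h" using q unfolding h_def path_def by (intro continuous_intros)
  have h01: "h 0 \<le> 0" "1 \<le> h 1" using s f by (auto simp: h_def pathstart_def pathfinish_def)
  have cl: "compact {t \<in> {0..1}. 1 \<le> h t}"
    using continuous_closed_preimage[OF hc closed_atLeastAtMost closed_atLeast, of 1]
    by (auto simp: vimage_def Int_def conj_commute compact_eq_bounded_closed intro: bounded_subset[OF bounded_closed_interval[of 0 1]])
  have ne: "{t \<in> {0..1}. 1 \<le> h t} \<noteq> {}" using h01 by auto
  obtain b where b: "b \<in> {0..1}" "1 \<le> h b" "\<And>t. t \<in> {0..1} \<Longrightarrow> 1 \<le> h t \<Longrightarrow> b \<le> t"
    using compact_attains_inf[OF cl ne] by auto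
  have cl2: "compact {t \<in> {0..b}. h t \<le> 0}"
    using continuous_closed_preimage[OF continuous_on_subset[OF hc, of "{0..b}"] closed_atLeastAtMost closed_atMost, of 0] b(1)
    by (auto simp: vimage_def Int_def conj_commute compact_eq_bounded_closed intro: bounded_subset[OF bounded_closed_interval[of 0 b]])
  have ne2: "{t \<in> {0..b}. h t \<le> 0} \<noteq> {}" using h01 b by auto
  obtain a where a: "a \<in> {0..b}" "h a \<le> 0" "\<And>t. t \<in> {0..b} \<Longrightarrow> h t \<le> 0 \<Longrightarrow> t \<le> a"
    using compact_attains_sup[OF cl2 ne2] by auto
  have ab: "a < b" using a b by (smt (verit) atLeastAtMost_iff)
  have mid: "0 < h t \<and> h t < 1" if "a < t" "t < b" for t
    using a(3)[of t] b(3)[of t] that a(1) b(1) by force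
  have cont: "continuous_on {a..b} h" using a b by (intro continuous_on_subset[OF hc]) auto
  have hb: "h b = 1"
  proof (rule antisym[OF _ b(2)])
    have "(h \<longlongrightarrow> h b) (at_left b)"
      using cont ab by (meson continuous_on_Icc_at_leftD)
    moreover have "\<forall>\<^sub>F t in at_left b. h t \<le> 1"
      using eventually_at_left_real[OF ab] by eventually_elim (use mid in force)
    ultimately show "h b \<le> 1" by (intro tendsto_upperbound) auto
  qed
  have ha: "h a = 0"
  proof (rule antisym[OF a(2)])
    have "(h \<longlongrightarrow> h a) (at_right a)"
      using cont ab by (meson continuous_on_Icc_at_rightD)
    moreover have "\<forall>\<^sub>F t in at_right a. 0 \<le> h t"
      using eventually_at_right_real[OF ab] by eventually_elim (use mid in force)
    ultimately show "0 \<le> h a" by (intro tendsto_lowerbound) auto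
  qed
  show ?thesis
  proof (rule that[of "subpath a b q"])
    show "path (subpath a b q)" using q a b by (intro path_subpath) auto
    show "path_image (subpath a b q) \<subseteq> path_image q" using a b by (intro path_image_subpath_subset) auto
    show "Re (pathstart (subpath a b q)) = 0" "Re (pathfinish (subpath a b q)) = 1"
      using ha hb by (auto simp: h_def)
    fix w assume "w \<in> path_image (subpath a b q)"
    then obtain t where "t \<in> {a..b}" "w = q t" using path_image_subpath[of a b q] ab by auto
    then have "t = a \<or> t = b \<or> (a < t \<and> t < b)" "Re w = h t" by (auto simp: h_def)
    then show "Re w \<in> {0..1}" using ha hb mid[of t] by auto
  qed
qed

text \<open>The maximum principle is applied in the part of the unit square above the curve, with a barrier that vanishes on the
  vertical sides and on top. Fashoda's theorem keeps this part away from the bottom side.\<close>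
lemma crossing_bound:
  fixes f :: "complex \<Rightarrow> complex"
  assumes hol: "f holomorphic_on {z. 0 < Im z}" and le1: "\<And>z. 0 < Im z \<Longrightarrow> cmod (f z) \<le> 1"
    and q: "path q" and q_im: "\<And>w. w \<in> path_image q \<Longrightarrow> 0 < Im w \<and> Im w < 1/2"
    and s: "Re (pathstart q) \<le> 0" and fin: "1 \<le> Re (pathfinish q)"
    and C: "0 < C" "C < 1" and small: "\<And>w. w \<in> path_image q \<Longrightarrow> cmod (f w) \<le> C"
  shows "cmod (f (Complex (1/2) (1/2))) \<le> C powr (sinh (pi/2) / sinh pi)"
proof -
  obtain p where p: "path p" "path_image p \<subseteq> path_image q" "Re (pathstart p) = 0" "Re (pathfinish p) = 1"
    and p_re: "\<And>w. w \<in> path_image p \<Longrightarrow> Re w \<in> {0..1}"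
    by (rule crossing_subpath[OF q s fin]) (rule that; assumption)
  have p_im: "0 < Im w \<and> Im w < 1/2" if "w \<in> path_image p" for w using q_im p(2) that by blast
  define c where "c = Complex (1/2) (1/2)"
  define R where "R = {z. 0 < Re z \<and> Re z < 1 \<and> 0 < Im z \<and> Im z < 1}"
  have oR: "open R"
  proof -
    have "R = {z. 0 < Re z} \<inter> {z. Re z < 1} \<inter> {z. 0 < Im z} \<inter> {z. Im z < 1}" by (auto simp: R_def)
    then show ?thesis by (auto intro!: open_Int open_halfspace_Re_gt open_halfspace_Re_lt open_halfspace_Im_gt open_halfspace_Im_lt)
  qed
  define R' where "R' = {z. 0 \<le> Re z \<and> Re z \<le> 1 \<and> 0 \<le> Im z \<and> Im z \<le> 1}"
  have cR': "closed R'"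
  proof -
    have "R' = {z. 0 \<le> Re z} \<inter> {z. Re z \<le> 1} \<inter> {z. 0 \<le> Im z} \<inter> {z. Im z \<le> 1}" by (auto simp: R'_def)
    then show ?thesis by (auto intro!: closed_Int closed_halfspace_Re_ge closed_halfspace_Re_le closed_halfspace_Im_ge closed_halfspace_Im_le)
  qed
  have bR: "bounded R"
  proof (rule boundedI[of _ 2])
    fix x assume "x \<in> R"
    then have "\<bar>Re x\<bar> + \<bar>Im x\<bar> \<le> 2" by (auto simp: R_def)
    then show "cmod x \<le> 2" using cmod_le[of x] by linarith
  qed
  have cpt: "compact (path_image p)" using p(1) by (rule compact_path_image)
  define S where "S = R - path_image p"
  have oS: "open S" unfolding S_def using oR cpt by (intro open_Diff compact_imp_closed)
  have cS: "c \<in> S" using p_im[of c] by (auto simp: S_def R_def c_def)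
  define G where "G = connected_component_set S c"
  have G: "open G" "connected G" "G \<subseteq> S" "c \<in> G"
    unfolding G_def using oS cS open_connected_component[of S c] connected_component_subset[of S c]
    by (simp_all add: connected_component_refl_eq)
  have GR: "G \<subseteq> R" using G(3) by (auto simp: S_def)
  have cG: "closure G \<subseteq> R'" using GR cR' by (intro closure_minimal) (auto simp: R_def R'_def)
  have "\<exists>x\<in>path_image p. \<forall>y\<in>path_image p. Im x \<le> Im y"
    by (rule continuous_attains_inf[OF cpt]) (auto intro!: continuous_intros)
  then obtain w0 where w0: "w0 \<in> path_image p" "\<And>w. w \<in> path_image p \<Longrightarrow> Im w0 \<le> Im w"
    by blast
  define m where "m = Im w0"
  have m: "0 < m" using p_im[OF w0(1)] by (simp add: m_def)
  have above: "m \<le> Im z" if zG: "z \<in> G" for z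
  proof (rule ccontr)
    assume zm: "\<not> m \<le> Im z"
    have "path_connected G" by (rule connected_open_path_connected[OF G(1,2)])
    from this[unfolded path_connected_def, rule_format, OF zG G(4)]
    obtain g where g: "path g" "path_image g \<subseteq> G" "pathstart g = z" "pathfinish g = c" by blast
    \<comment> \<open>The path in \<open>G\<close> is extended straight down to the bottom and
      straight up to the top. The lower piece runs below the lowest point of \<open>p\<close>, the
      upper piece above height 1/2, so neither can meet \<open>p\<close>; Fashoda's theorem is
      contradicted.\<close>
    define g' where "g' = linepath (Complex (Re z) 0) z +++ (g +++ linepath c (Complex (1/2) 1))"
    have zR: "z \<in> R" using zG GR by blast
    have seg1: "Re w = Re z \<and> 0 \<le> Im w \<and> Im w \<le> Im z" if w: "w \<in> closed_segment (Complex (Re z) 0) z" for w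
    proof -
      obtain u where u: "0 \<le> u" "u \<le> 1" "w = (1 - u) *\<^sub>R Complex (Re z) 0 + u *\<^sub>R z" using w by (auto simp: in_segment)
      have "Re w = Re z" "Im w = u * Im z" unfolding u(3) by (auto simp: algebra_simps)
      then show ?thesis using zR u mult_left_le_one_le[of "Im z" u] by (simp add: R_def)
    qed
    have seg2: "Re w = 1/2 \<and> 1/2 \<le> Im w \<and> Im w \<le> 1" if w: "w \<in> closed_segment c (Complex (1/2) 1)" for w
    proof -
      obtain u where u: "0 \<le> u" "u \<le> 1" "w = (1 - u) *\<^sub>R c + u *\<^sub>R Complex (1/2) 1" using w by (auto simp: in_segment)
      have "Re w = 1/2" "Im w = 1/2 + u / 2" unfolding u(3) by (auto simp: algebra_simps c_def)
      then show ?thesis using u by simp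
    qed
    have img: "path_image g' = closed_segment (Complex (Re z) 0) z \<union> (path_image g \<union> closed_segment c (Complex (1/2) 1))"
      unfolding g'_def using g by (simp add: path_image_join)
    have "path_image p \<inter> path_image g' \<noteq> {}"
    proof (rule fashoda_complex)
      show "path p" by (rule p)
      show "path g'" unfolding g'_def using g by (intro path_join_imp) auto
      show "path_image p \<subseteq> {z. Re z \<in> {0..1} \<and> Im z \<in> {0..1}}" using p_re p_im by fastforce
      have "path_image g \<subseteq> R" using g(2) GR by blast
      then have gR: "0 \<le> Re x \<and> Re x \<le> 1 \<and> 0 \<le> Im x \<and> Im x \<le> 1" if "x \<in> path_image g" for x
        using that by (force simp: R_def)
      have zR': "0 \<le> Re z \<and> Re z \<le> 1 \<and> 0 \<le> Im z \<and> Im z \<le> 1" using zR by (simp add: R_def)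
      show "path_image g' \<subseteq> {z. Re z \<in> {0..1} \<and> Im z \<in> {0..1}}"
      proof
        fix x assume "x \<in> path_image g'"
        then consider "x \<in> closed_segment (Complex (Re z) 0) z" | "x \<in> path_image g" | "x \<in> closed_segment c (Complex (1/2) 1)"
          unfolding img by blast
        then show "x \<in> {z. Re z \<in> {0..1} \<and> Im z \<in> {0..1}}"
        proof cases
          case 1 from seg1[OF this] zR' show ?thesis by simp
        next
          case 2 from gR[OF this] show ?thesis by simp
        next
          case 3 from seg2[OF this] show ?thesis by simp
        qed
      qed
      show "Re (pathstart p) = 0" "Re (pathfinish p) = 1" by (fact p)+
      show "Im (pathstart g') = 0" "Im (pathfinish g') = 1" by (auto simp: g'_def)
    qed
    then obtain w where w: "w \<in> path_image p" "w \<in> path_image g'" by blast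
    then have "w \<in> closed_segment (Complex (Re z) 0) z \<or> w \<in> path_image g \<or> w \<in> closed_segment c (Complex (1/2) 1)"
      unfolding img by blast
    then show False
    proof (elim disjE)
      assume "w \<in> closed_segment (Complex (Re z) 0) z"
      from seg1[OF this] show False using w0(2)[OF w(1)] zm by (simp add: m_def)
    next
      assume "w \<in> path_image g"
      then show False using g(2) G(3) w(1) by (auto simp: S_def)
    next
      assume "w \<in> closed_segment c (Complex (1/2) 1)"
      from seg2[OF this] show False using p_im[OF w(1)] by simp
    qed
  qed
  have cG_im: "m \<le> Im z" if "z \<in> closure G" for z
  proof -
    have "closure G \<subseteq> {z. m \<le> Im z}" using above by (intro closure_minimal closed_halfspace_Im_ge) auto
    then show ?thesis using that by blast
  qed
  define L where "L = ln (1 / C)"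
  have L: "0 < L" using C by (simp add: L_def)
  \<comment> \<open>Chosen so that Re B is the harmonic function sin (pi * x) * sinh (pi * (1 - y))
    / sinh pi. It has maximum 1 at the midpoint of the bottom side, and its value at the centre of
    the square is the exponent in the claim.\<close>
  define B where "B z = - \<i> * cos (of_real pi * (z - \<i>)) / of_real (sinh pi)" for z
  have sp: "0 < sinh pi" by simp
  have ReB: "Re (B z) = sin (pi * Re z) * sinh (pi * (1 - Im z)) / sinh pi" for z
  proof -
    have "Re (B z) = Im (cos (of_real pi * (z - \<i>))) / sinh pi" unfolding B_def by simp
    also have "Im (cos (of_real pi * (z - \<i>))) = sin (pi * Re z) * (exp (- (pi * (Im z - 1))) - exp (pi * (Im z - 1))) / 2"
      by (subst Im_cos) simp
    also have "\<dots> = sin (pi * Re z) * sinh (pi * (1 - Im z))"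
    proof -
      have "sinh (pi * (1 - Im z)) = (exp (- (pi * (Im z - 1))) - exp (pi * (Im z - 1))) / 2"
        unfolding sinh_field_def by (simp add: right_diff_distrib)
      then show ?thesis by simp
    qed
    finally show ?thesis .
  qed
  have B_hol: "B holomorphic_on A" for A unfolding B_def using sp by (intro holomorphic_intros) auto
  have ReB_bd: "0 \<le> Re (B z) \<and> Re (B z) \<le> 1" if "z \<in> R'" for z
  proof -
    have s1: "0 \<le> sin (pi * Re z)" using that by (intro sin_ge_zero) (auto simp: R'_def)
    have s2: "0 \<le> sinh (pi * (1 - Im z))" "sinh (pi * (1 - Im z)) \<le> sinh pi" using that by (auto simp: R'_def)
    have "sin (pi * Re z) * sinh (pi * (1 - Im z)) \<le> 1 * sinh pi" using s1 s2 by (intro mult_mono) auto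
    then show ?thesis unfolding ReB using s1 s2 sp by simp
  qed
  \<comment> \<open>On the curve |f| \<le> C is compensated by exp L = 1 / C; on the sides where Re
    B = 0 the bound |f| \<le> 1 suffices.\<close>
  define F where "F z = f z * exp (of_real L * B z)" for z
  have F_hol: "F holomorphic_on {z. 0 < Im z}" unfolding F_def using hol B_hol by (intro holomorphic_intros)
  have F_norm: "cmod (F z) = cmod (f z) * exp (L * Re (B z))" for z by (simp add: F_def norm_mult)
  have pos: "0 < Im z" if "z \<in> closure G" for z using cG_im[OF that] m by linarith
  have F_cont: "continuous_on (closure G) F"
    using holomorphic_on_imp_continuous_on[OF F_hol] by (rule continuous_on_subset) (use pos in auto)
  have "cmod (F c) \<le> 1"
  proof (rule max_mod_limsup[of G F])
    show "F holomorphic_on G" using F_hol by (rule holomorphic_on_subset) (use pos closure_subset in blast)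
    show "bounded G" using bR GR bounded_subset by blast
    fix \<xi> and \<epsilon> :: real assume \<xi>: "\<xi> \<in> frontier G" and \<epsilon>: "0 < \<epsilon>"
    then have \<xi>c: "\<xi> \<in> closure G" "\<xi> \<notin> G" using G(1) by (auto simp: frontier_def interior_open)
    have \<xi>R: "\<xi> \<in> R'" "0 < Im \<xi>" using \<xi>c cG pos by auto
    have "\<xi> \<notin> S"
    proof
      assume "\<xi> \<in> S"
      then obtain e where e: "0 < e" "ball \<xi> e \<subseteq> S" using oS openE by blast
      obtain x where x: "x \<in> G" "dist x \<xi> < e" using \<xi>c(1) e(1) unfolding closure_approachable by blast
      have "G \<union> ball \<xi> e \<subseteq> G" unfolding G_def
      proof (rule connected_component_maximal)
        show "connected (connected_component_set S c \<union> ball \<xi> e)"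
          using x by (intro connected_Un) (auto simp: G_def dist_commute)
      qed (use e G G_def in auto)
      then show False using \<xi>c(2) e(1) centre_in_ball[of \<xi> e] by blast
    qed
    have "cmod (F \<xi>) \<le> 1"
    proof (cases "\<xi> \<in> path_image p")
      case True
      then have "cmod (f \<xi>) \<le> C" using small p(2) by blast
      then have "cmod (F \<xi>) \<le> C * exp (L * 1)" unfolding F_norm
        using L ReB_bd[OF \<xi>R(1)] C by (intro mult_mono) auto
      also have "\<dots> = 1" using C by (simp add: L_def exp_minus ln_div)
      finally show ?thesis .
    next
      case False
      then have "\<xi> \<notin> R" using \<open>\<xi> \<notin> S\<close> by (auto simp: S_def)
      then have "Re \<xi> = 0 \<or> Re \<xi> = 1 \<or> Im \<xi> = 1" using \<xi>R by (auto simp: R_def R'_def)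
      then have "Re (B \<xi>) = 0" unfolding ReB by auto
      then show ?thesis unfolding F_norm using le1[OF \<xi>R(2)] by simp
    qed
    moreover have "(F \<longlongrightarrow> F \<xi>) (at \<xi> within G)"
      using F_cont \<xi>c(1) closure_subset by (meson continuous_on_def tendsto_within_subset)
    then have "((\<lambda>z. cmod (F z)) \<longlongrightarrow> cmod (F \<xi>)) (at \<xi> within G)" by (rule tendsto_norm)
    ultimately have "\<forall>\<^sub>F z in at \<xi> within G. cmod (F z) < 1 + \<epsilon>" using \<epsilon> by (intro order_tendstoD(2)) auto
    then show "\<forall>\<^sub>F z in at \<xi> within G. cmod (F z) \<le> 1 + \<epsilon>" by eventually_elim simp
  qed (use G in auto)
  moreover have "Re (B c) = sinh (pi/2) / sinh pi" unfolding ReB by (simp add: c_def)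
  ultimately have "cmod (f c) * exp (L * (sinh (pi/2) / sinh pi)) \<le> 1" unfolding F_norm by simp
  then have "cmod (f c) \<le> exp (- (L * (sinh (pi/2) / sinh pi)))"
    by (simp add: exp_minus field_simps)
  also have "\<dots> = C powr (sinh (pi/2) / sinh pi)"
    using C by (simp add: powr_def L_def ln_div)
  finally show ?thesis by (simp add: c_def)
qed


lemma crossing_bound_shift:
  fixes f :: "complex \<Rightarrow> complex" and a :: real
  assumes hol: "f holomorphic_on {z. 0 < Im z}" and le1: "\<And>z. 0 < Im z \<Longrightarrow> cmod (f z) \<le> 1"
    and q: "path q" and q_im: "\<And>w. w \<in> path_image q \<Longrightarrow> 0 < Im w \<and> Im w < 1/2"
    and s: "Re (pathstart q) \<le> a" and fin: "a + 1 \<le> Re (pathfinish q)"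
    and C: "0 < C" "C < 1" and small: "\<And>w. w \<in> path_image q \<Longrightarrow> cmod (f w) \<le> C"
  shows "cmod (f (Complex (a + 1/2) (1/2))) \<le> C powr (sinh (pi/2) / sinh pi)"
proof -
  have "f \<circ> (\<lambda>z. z + of_real a) holomorphic_on {z. 0 < Im z}"
    by (rule holomorphic_on_compose_gen[OF _ hol]) (auto intro!: holomorphic_intros)
  then have h: "(\<lambda>z. f (z + of_real a)) holomorphic_on {z. 0 < Im z}" by (simp add: o_def)
  have "cmod (f (Complex (1/2) (1/2) + of_real a)) \<le> C powr (sinh (pi/2) / sinh pi)"
  proof (rule crossing_bound[OF h, of "(\<lambda>z. z - of_real a) \<circ> q"])
    show "path ((\<lambda>z. z - of_real a) \<circ> q)" using q by (intro path_continuous_image continuous_intros)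
  qed (use le1 q_im s fin small C in \<open>auto simp: path_image_compose pathstart_compose pathfinish_compose\<close>)
  moreover have "Complex (1/2) (1/2) + of_real a = Complex (a + 1/2) (1/2)" by (simp add: complex_eq_iff)
  ultimately show ?thesis by simp
qed

text \<open>With a unimodular c making cnj c * f(i) nonnegative, Harnack's inequality for 1 - cnj c
  * f bounds Re (cnj c * f), and hence |f|, from below. The Cayley transform carries the box into
  |w| \<le> 7/8, which gives 2 / (1 - 7/8) = 16.\<close>

lemma harnack_half_plane:
  fixes f :: "complex \<Rightarrow> complex"
  assumes hol: "f holomorphic_on {z. 0 < Im z}" and le1: "\<And>z. 0 < Im z \<Longrightarrow> cmod (f z) \<le> 1"
    and z: "\<bar>Re z\<bar> \<le> 2" "1/2 \<le> Im z" "Im z \<le> 1"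
  shows "1 - 16 * (1 - cmod (f \<i>)) \<le> cmod (f z)"
proof (cases "f \<i> = 0")
  case True
  then show ?thesis using norm_ge_zero[of "f z"] by (simp del: norm_ge_zero)
next
  case False
  define c where "c = f \<i> / of_real (cmod (f \<i>))"
  have c: "cmod c = 1" "cnj c * f \<i> = of_real (cmod (f \<i>))"
  proof -
    show "cmod c = 1" using False by (simp add: c_def norm_divide)
    have "cnj c * f \<i> = (f \<i> * cnj (f \<i>)) / of_real (cmod (f \<i>))" by (simp add: c_def)
    also have "\<dots> = of_real ((cmod (f \<i>))\<^sup>2) / of_real (cmod (f \<i>))" by (simp only: complex_norm_square)
    finally show "cnj c * f \<i> = of_real (cmod (f \<i>))" using False by (simp add: power2_eq_square)
  qed
  define \<tau> where "\<tau> w = \<i> * (1 + w) / (1 - w)" for w :: complex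
  have \<tau>_pos: "0 < Im (\<tau> w)" if w: "cmod w < 1" for w
  proof -
    have ne: "1 - w \<noteq> 0" using w by auto
    have n1: "cmod (1 - w) > 0" using ne by simp
    have "\<tau> w = \<i> * (1 + w) * cnj (1 - w) / of_real ((cmod (1 - w))\<^sup>2)"
      unfolding \<tau>_def by (subst complex_div_cnj) simp
    then have "Im (\<tau> w) = Im (\<i> * (1 + w) * cnj (1 - w)) / (cmod (1 - w))\<^sup>2" by (simp only: Im_divide_of_real)
    also have "Im (\<i> * (1 + w) * cnj (1 - w)) = 1 - (cmod w)\<^sup>2"
      unfolding cmod_power2 by (simp add: algebra_simps power2_eq_square)
    finally show ?thesis using w n1 by (simp add: power_less_one_iff)
  qed
  have \<tau>_hol: "\<tau> holomorphic_on ball 0 1" unfolding \<tau>_def by (intro holomorphic_intros) auto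
  define G where "G w = 1 - cnj c * f (\<tau> w)" for w
  have "f \<circ> \<tau> holomorphic_on ball 0 1"
    by (rule holomorphic_on_compose_gen[OF \<tau>_hol hol]) (use \<tau>_pos in auto)
  then have "(\<lambda>w. f (\<tau> w)) holomorphic_on ball 0 1" by (simp add: o_def)
  then have G: "G holomorphic_on ball 0 1" unfolding G_def by (intro holomorphic_intros)
  have pos: "0 \<le> Re (G w)" if "cmod w < 1" for w
  proof -
    have "Re (cnj c * f (\<tau> w)) \<le> cmod (cnj c * f (\<tau> w))" by (rule complex_Re_le_cmod)
    also have "\<dots> \<le> 1" using le1[OF \<tau>_pos[OF that]] c by (simp add: norm_mult)
    finally show ?thesis by (simp add: G_def)
  qed
  define w where "w = (z - \<i>) / (z + \<i>)"
  have zi: "z + \<i> \<noteq> 0"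
  proof
    assume "z + \<i> = 0"
    then have "Im (z + \<i>) = 0" by simp
    then show False using z by simp
  qed
  have "\<tau> w = z"
  proof -
    have "1 + w = 2 * z / (z + \<i>)" "1 - w = 2 * \<i> / (z + \<i>)" unfolding w_def using zi by (auto simp: field_simps)
    then show ?thesis unfolding \<tau>_def using zi by simp
  qed
  have "(cmod (z - \<i>))\<^sup>2 * 64 \<le> 49 * (cmod (z + \<i>))\<^sup>2"
  proof -
    define x where "x = Re z" define y where "y = Im z"
    have "x\<^sup>2 \<le> 4" using z(1) abs_le_square_iff[of x 2] by (simp add: x_def)
    have "(y - 1)\<^sup>2 \<le> 1" using z(2,3) by (simp add: y_def abs_square_le_1)
    have "64 * (x\<^sup>2 + (y - 1)\<^sup>2) \<le> 49 * (x\<^sup>2 + (y + 1)\<^sup>2)"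
    proof -
      \<comment> \<open>The right-hand side is arranged so that each summand is nonnegative on the
        box.\<close>
      have "49 * (x\<^sup>2 + (y + 1)\<^sup>2) - 64 * (x\<^sup>2 + (y - 1)\<^sup>2) = 15 * (4 - x\<^sup>2) + (y - 1/2) * (15 * (1 - y) + 407/2) + 137/4"
        by (simp add: power2_eq_square field_simps)
      moreover have "0 \<le> (y - 1/2) * (15 * (1 - y) + 407/2)" using z(2,3) by (intro mult_nonneg_nonneg) (auto simp: y_def)
      ultimately have "0 \<le> 49 * (x\<^sup>2 + (y + 1)\<^sup>2) - 64 * (x\<^sup>2 + (y - 1)\<^sup>2)"
        using \<open>x\<^sup>2 \<le> 4\<close> by (simp only:) (intro add_nonneg_nonneg; simp)
      then show ?thesis by (simp only: diff_ge_0_iff_ge)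
    qed
    then show ?thesis by (simp add: cmod_power2 x_def y_def)
  qed
  then have "(8 * cmod (z - \<i>))\<^sup>2 \<le> (7 * cmod (z + \<i>))\<^sup>2" by (simp add: power_mult_distrib)
  then have "8 * cmod (z - \<i>) \<le> 7 * cmod (z + \<i>)" by (rule power2_le_imp_le) simp
  then have w: "cmod w \<le> 7/8" using zi by (simp add: w_def norm_divide field_simps)
  then have "Re (G w) \<le> 2 / (1 - cmod w) * Re (G 0)" by (intro harnack[OF G pos]) auto
  also have "\<dots> \<le> 16 * Re (G 0)"
    using w pos[of 0] by (intro mult_right_mono) (auto simp: field_simps)
  also have "Re (G 0) = 1 - cmod (f \<i>)" using c by (simp add: G_def \<tau>_def)
  finally have "1 - 16 * (1 - cmod (f \<i>)) \<le> Re (cnj c * f z)" using \<open>\<tau> w = z\<close> by (simp add: G_def)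
  also have "\<dots> \<le> cmod (cnj c * f z)" by (rule complex_Re_le_cmod)
  also have "\<dots> = cmod (f z)" using c by (simp add: norm_mult)
  finally show ?thesis .
qed

text \<open>If |b(z)| were too close to 1, Harnack would give |b| > \<kappa> \<ge> C on the whole
  box |Re \<zeta>| \<le> 2, 1/2 \<le> Im \<zeta> \<le> 1. A curve in the sublevel set from
  \<open>w\<close> to \<open>w0\<close> cannot climb through this box, so it leaves sideways and
  crosses a unit column below height 1/2. The crossing bound then contradicts the lower bound at a
  point of the box.\<close>

lemma connected_small_set_bound:
  assumes hol: "b holomorphic_on ball 0 1" and le1: "\<And>z. cmod z < 1 \<Longrightarrow> cmod (b z) \<le> 1"
    and C: "0 < C" "C < 1" and conn: "connected {z \<in> ball 0 1. cmod (b z) < C}"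
    and z: "cmod z < 1" "exp (-1) \<le> cmod z"
    and w: "w \<in> carleson_square z" "cmod w < 1" "cmod (b w) < C"
    and w0: "cmod w0 \<le> cmod z" "cmod (b w0) < C"
  shows "1 - 16 * (1 - cmod (b z)) \<le> C powr (sinh (pi/2) / sinh pi)"
proof (rule ccontr)
  define \<kappa> where "\<kappa> = C powr (sinh (pi/2) / sinh pi)"
  assume "\<not> ?thesis"
  then have big: "\<kappa> < 1 - 16 * (1 - cmod (b z))" by (simp add: \<kappa>_def)
  have C\<kappa>: "C \<le> \<kappa>"
  proof -
    have "sinh (pi/2) / sinh pi \<le> 1" by simp
    then have "C powr 1 \<le> \<kappa>" unfolding \<kappa>_def using C by (intro powr_mono') auto
    then show ?thesis using C by simp
  qed
  have z0: "0 < cmod z" using z(2) by (smt (verit) exp_gt_zero)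
  define y where "y = - ln (cmod z)"
  have y: "0 < y" "y \<le> 1" "1 - cmod z \<le> y"
  proof -
    show "0 < y" using z z0 by (simp add: y_def)
    have "-1 \<le> ln (cmod z)" using z(2) z0 by (simp add: ln_ge_iff)
    then show "y \<le> 1" by (simp add: y_def)
    show "1 - cmod z \<le> y" using ln_le_minus_one[OF z0] by (simp add: y_def)
  qed
  define \<omega> where "\<omega> = z / of_real (cmod z)"
  have \<omega>: "cmod \<omega> = 1" "\<omega> \<noteq> 0" using z0 by (auto simp: \<omega>_def norm_divide)
  \<comment> \<open>The logarithmic coordinate scaled by y: \<open>\<i>\<close> goes to z, the
    circle of radius |z| is the line Im \<zeta> = 1, and the unit circle is the real axis.\<close>
  define E where "E \<zeta> = \<omega> * exp (\<i> * of_real y * \<zeta>)" for \<zeta>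
  have E_norm: "cmod (E \<zeta>) = exp (- (y * Im \<zeta>))" for \<zeta> by (simp add: E_def norm_mult \<omega>)
  have E_lt: "cmod (E \<zeta>) < 1" if "0 < Im \<zeta>" for \<zeta> using that y by (simp add: E_norm)
  have E_hol: "E holomorphic_on A" for A unfolding E_def by (intro holomorphic_intros)
  define f where "f \<zeta> = b (E \<zeta>)" for \<zeta>
  have "b \<circ> E holomorphic_on {\<zeta>. 0 < Im \<zeta>}"
    by (rule holomorphic_on_compose_gen[OF E_hol hol]) (use E_lt in auto)
  then have f_hol: "f holomorphic_on {\<zeta>. 0 < Im \<zeta>}" by (simp add: o_def f_def[abs_def])
  have f_le: "cmod (f \<zeta>) \<le> 1" if "0 < Im \<zeta>" for \<zeta> using le1 E_lt that by (simp add: f_def)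
  have Ei: "E \<i> = z"
  proof -
    have "\<i> * of_real y * \<i> = of_real (ln (cmod z))" by (simp add: y_def algebra_simps)
    then have "exp (\<i> * of_real y * \<i>) = of_real (cmod z)" using z0 by (metis exp_ln exp_of_real)
    then show ?thesis using z0 by (simp add: E_def \<omega>_def)
  qed
  have box: "\<kappa> < cmod (f \<zeta>)" if "\<bar>Re \<zeta>\<bar> \<le> 2" "1/2 \<le> Im \<zeta>" "Im \<zeta> \<le> 1" for \<zeta>
    using harnack_half_plane[OF f_hol f_le that] big by (simp add: f_def Ei)
  define U where "U = {x. x / \<omega> \<notin> \<real>\<^sub>\<le>\<^sub>0}"
  define Lg where "Lg x = - \<i> * Ln (x / \<omega>) / of_real y" for x
  have oU: "open U"
  proof -
    have "U = (\<lambda>x. x / \<omega>) -` (- \<real>\<^sub>\<le>\<^sub>0)" by (auto simp: U_def)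
    moreover have "open ((\<lambda>x. x / \<omega>) -` (- \<real>\<^sub>\<le>\<^sub>0))"
      by (intro open_vimage) (auto intro!: continuous_intros \<omega>)
    ultimately show ?thesis by simp
  qed
  have Lg_cont: "continuous_on U Lg" unfolding Lg_def using y \<omega> by (intro continuous_intros) (auto simp: U_def)
  have U0: "x \<noteq> 0" if "x \<in> U" for x using that by (auto simp: U_def)
  have ELg: "E (Lg x) = x" if "x \<noteq> 0" for x
  proof -
    have "\<i> * of_real y * Lg x = Ln (x / \<omega>)" using y by (simp add: Lg_def)
    then show ?thesis using that \<omega> by (simp add: E_def)
  qed
  have Im_Lg: "Im (Lg x) = - ln (cmod x) / y" if "x \<noteq> 0" for x
    using that \<omega> y by (simp add: Lg_def norm_divide)
  have Re_Lg: "Re (Lg x) = Im (Ln (x / \<omega>)) / y" for x by (simp add: Lg_def)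
  have LgE: "Lg (E \<zeta>) = \<zeta>" "E \<zeta> \<in> U" if "\<bar>Re \<zeta>\<bar> \<le> 2" for \<zeta>
  proof -
    \<comment> \<open>This is where |z| \<ge> exp (-1) enters: y \<le> 1 keeps all angles of the box
      within 2 < pi, so the principal logarithm inverts \<open>E\<close>.\<close>
    have "\<bar>y * Re \<zeta>\<bar> \<le> 1 * 2" unfolding abs_mult using y that by (intro mult_mono) auto
    then have lt: "- pi < y * Re \<zeta>" "y * Re \<zeta> < pi" using pi_gt3 by auto
    have eq: "E \<zeta> / \<omega> = exp (\<i> * of_real y * \<zeta>)" using \<omega> by (simp add: E_def)
    have Ln: "Ln (exp (\<i> * of_real y * \<zeta>)) = \<i> * of_real y * \<zeta>" using lt by (intro Ln_exp) auto
    then show "Lg (E \<zeta>) = \<zeta>" unfolding Lg_def eq using y by simp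
    show "E \<zeta> \<in> U"
    proof (rule ccontr)
      assume "E \<zeta> \<notin> U"
      then have "exp (\<i> * of_real y * \<zeta>) \<in> \<real>\<^sub>\<le>\<^sub>0" by (simp add: U_def eq)
      moreover have "Im (Ln v) = pi" if "v \<in> \<real>\<^sub>\<le>\<^sub>0" "v \<noteq> 0" for v :: complex
        using that Im_Ln_eq_pi[of v] by (auto simp: complex_nonpos_Reals_iff less_le complex_eq_iff)
      ultimately have "Im (Ln (exp (\<i> * of_real y * \<zeta>))) = pi" using exp_not_eq_zero by blast
      then show False unfolding Ln using lt by simp
    qed
  qed
  \<comment> \<open>The curve starts in this window and ends outside it. Its height is 1, but inside
    the sublevel set only heights below 1/2 occur, since the box above is blocked.\<close>
  define Ob where "Ob = U \<inter> Lg -` {\<zeta>. \<bar>Re \<zeta>\<bar> < 2 \<and> Im \<zeta> < 1}"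
  have oO: "open Ob"
  proof -
    have "{\<zeta>. \<bar>Re \<zeta>\<bar> < 2 \<and> Im \<zeta> < 1} = {\<zeta>. Re \<zeta> < 2} \<inter> {\<zeta>. -2 < Re \<zeta>} \<inter> {\<zeta>. Im \<zeta> < 1}" by auto
    then have "open {\<zeta>. \<bar>Re \<zeta>\<bar> < 2 \<and> Im \<zeta> < 1}"
      by (auto intro!: open_Int open_halfspace_Re_gt open_halfspace_Re_lt open_halfspace_Im_lt)
    then show ?thesis unfolding Ob_def by (intro continuous_open_preimage Lg_cont oU)
  qed
  define \<Omega> where "\<Omega> = {z \<in> ball 0 1. cmod (b z) < C}"
  have "continuous_on (ball 0 1) (\<lambda>z. cmod (b z))"
    using holomorphic_on_imp_continuous_on[OF hol] by (intro continuous_intros)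
  then have "open (ball 0 1 \<inter> (\<lambda>z. cmod (b z)) -` {..<C})" by (intro continuous_open_preimage) auto
  moreover have "ball 0 1 \<inter> (\<lambda>z. cmod (b z)) -` {..<C} = \<Omega>" by (auto simp: \<Omega>_def)
  ultimately have o\<Omega>: "open \<Omega>" by simp
  have "path_connected \<Omega>" using conn o\<Omega> connected_open_path_connected by (simp add: \<Omega>_def)
  moreover have w\<Omega>: "w \<in> \<Omega>" "w0 \<in> \<Omega>" using w w0 z by (auto simp: \<Omega>_def)
  ultimately obtain p where p: "path p" "path_image p \<subseteq> \<Omega>" "pathstart p = w" "pathfinish p = w0"
    unfolding path_connected_def by meson
  have p\<Omega>: "p t \<in> \<Omega>" if "t \<in> {0..1}" for t using p(2) that by (auto simp: path_image_def)
  have low: "0 < Im (Lg x) \<and> Im (Lg x) < 1/2 \<and> \<bar>Re (Lg x)\<bar> < 2" if "x \<in> Ob" "x \<in> \<Omega>" for x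
  proof -
    have x0: "x \<noteq> 0" using that U0 by (auto simp: Ob_def)
    have "0 < Im (Lg x)" unfolding Im_Lg[OF x0] by (rule divide_pos_pos) (use that x0 y in \<open>auto simp: \<Omega>_def\<close>)
    moreover have "Im (Lg x) < 1/2"
    proof (rule ccontr)
      assume "\<not> Im (Lg x) < 1/2"
      then have "\<kappa> < cmod (f (Lg x))" using that by (intro box) (auto simp: Ob_def)
      then show False using ELg[OF x0] that C\<kappa> by (simp add: f_def \<Omega>_def)
    qed
    ultimately show ?thesis using that by (auto simp: Ob_def)
  qed
  \<comment> \<open>The angular half width (1 - |z|) / 2 of the square is doubled by |Ln (1 + e)|
    \<le> 2 * |e|. The result is still below y, hence |Re| < 1.\<close>
  have wO: "w \<in> Ob" and wRe: "\<bar>Re (Lg w)\<bar> < 1"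
  proof -
    have w': "w \<noteq> 0" "cmod z < cmod w" "cmod (w / of_real (cmod w) - \<omega>) < (1 - cmod z) / 2"
      using w(1) by (auto simp: carleson_square_def \<omega>_def)
    define e where "e = w / of_real (cmod w) / \<omega> - 1"
    have "e = (w / of_real (cmod w) - \<omega>) / \<omega>" using \<omega> by (simp add: e_def diff_divide_distrib)
    then have ce: "cmod e < (1 - cmod z) / 2" using w'(3) \<omega>(1) by (simp add: norm_divide)
    also have "\<dots> \<le> 1/2" by simp
    finally have ce2: "cmod e < 1/2" .
    have weq: "w / \<omega> = of_real (cmod w) * (1 + e)" using w'(1) by (simp add: e_def)
    have "1 + e \<noteq> 0"
    proof
      assume "1 + e = 0"
      then have "e = -1" by (simp add: add_eq_0_iff)
      then show False using ce2 by simp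
    qed
    then have "Ln (w / \<omega>) = of_real (ln (cmod w)) + Ln (1 + e)"
      unfolding weq using w'(1) by (subst Ln_times_of_real) (auto simp: Ln_of_real)
    then have "\<bar>Im (Ln (w / \<omega>))\<bar> \<le> cmod (Ln (1 + e))" using abs_Im_le_cmod[of "Ln (1 + e)"] by simp
    also have "\<dots> \<le> 2 * cmod e" by (rule norm_Ln_le[OF ce2])
    also have "\<dots> < y" using ce y(3) by simp
    finally show wRe: "\<bar>Re (Lg w)\<bar> < 1" unfolding Re_Lg using y by (simp add: field_simps)
    have "Im (Lg w) < 1" unfolding Im_Lg[OF w'(1)] using w' z0 y by (simp add: field_simps) (simp add: y_def)
    moreover have "w \<in> U"
      using LgE(2)[of "Lg w"] wRe ELg[OF w'(1)] by simp
    ultimately show "w \<in> Ob" using wRe by (auto simp: Ob_def)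
  qed
  have w0O: "w0 \<notin> Ob"
  proof
    assume a: "w0 \<in> Ob"
    then have "w0 \<noteq> 0" using U0 by (auto simp: Ob_def)
    moreover have "ln (cmod w0) \<le> ln (cmod z)" using calculation w0(1) z0 by simp
    ultimately have "1 \<le> Im (Lg w0)" using y by (simp add: Im_Lg field_simps) (simp add: y_def)
    then show False using a by (simp add: Ob_def)
  qed
  have pc: "continuous_on {0..1} p" using p(1) by (simp add: path_def)
  have "closed ({0..1} \<inter> p -` (- Ob))" using oO by (intro continuous_closed_preimage pc) auto
  then have cpt: "compact ({0..1} \<inter> p -` (- Ob))"
    by (auto simp: compact_eq_bounded_closed intro: bounded_subset[OF bounded_closed_interval[of 0 1]])
  have "1 \<in> {0..1} \<inter> p -` (- Ob)" using p(4) w0O by (simp add: pathfinish_def)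
  then have "{0..1} \<inter> p -` (- Ob) \<noteq> {}" by blast
  from compact_attains_inf[OF cpt this] obtain T where T': "T \<in> {0..1} \<inter> p -` (- Ob)"
    "\<forall>t\<in>{0..1} \<inter> p -` (- Ob). T \<le> t" by blast
  have T: "T \<in> {0..1}" "p T \<notin> Ob" "\<And>t. t \<in> {0..1} \<Longrightarrow> p t \<notin> Ob \<Longrightarrow> T \<le> t"
    using T'(1) T'(2)[rule_format] by (simp_all add: vimage_def)
  have before: "p t \<in> Ob" if "0 \<le> t" "t < T" for t using T(3)[of t] T(1) that by force
  have Tpos: "0 < T" using T p(3) wO by (cases "T = 0") (auto simp: pathstart_def)
  define Rc where "Rc = {\<zeta>. \<bar>Re \<zeta>\<bar> \<le> 2 \<and> 0 \<le> Im \<zeta> \<and> Im \<zeta> \<le> 1/2}"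
  have cRc: "compact (E ` Rc)"
  proof (intro compact_continuous_image)
    show "continuous_on Rc E" using E_hol holomorphic_on_imp_continuous_on by blast
    have "Rc = {\<zeta>. Re \<zeta> \<le> 2} \<inter> {\<zeta>. -2 \<le> Re \<zeta>} \<inter> {\<zeta>. 0 \<le> Im \<zeta>} \<inter> {\<zeta>. Im \<zeta> \<le> 1/2}" by (auto simp: Rc_def)
    then have "closed Rc" by (simp only:) (intro closed_Int closed_halfspace_Re_ge closed_halfspace_Re_le closed_halfspace_Im_ge closed_halfspace_Im_le)
    moreover have "bounded Rc"
    proof (rule boundedI[of _ 3])
      fix x assume "x \<in> Rc"
      then show "cmod x \<le> 3" using cmod_le[of x] by (auto simp: Rc_def)
    qed
    ultimately show "compact Rc" by (simp add: compact_eq_bounded_closed)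
  qed
  \<comment> \<open>The exit point is not in the window, so it has no coordinate a priori. It is a
    limit of points in the image of a compact box, and the coordinate found there has |Re \<zeta>| =
    2.\<close>
  have "p T \<in> E ` Rc"
  proof (rule closed_sequentially[OF compact_imp_closed[OF cRc]])
    define s where "s n = T - T / (real n + 2)" for n
    have s: "0 \<le> s n" "s n < T" for n using Tpos by (auto simp: s_def field_simps)
    show "p (s n) \<in> E ` Rc" for n
    proof -
      have i: "p (s n) \<in> Ob" "p (s n) \<in> \<Omega>" using before[OF s] p\<Omega>[of "s n"] s[of n] T(1) by auto
      have "p (s n) = E (Lg (p (s n)))" using ELg U0 i(1) by (auto simp: Ob_def)
      moreover have "Lg (p (s n)) \<in> Rc" using low[OF i] by (simp add: Rc_def)
      ultimately show ?thesis by blast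
    qed
    have "s \<longlonglongrightarrow> T" unfolding s_def by real_asymp
    moreover have "s n \<in> {0..1}" for n using s[of n] T(1) by auto
    ultimately show "(\<lambda>n. p (s n)) \<longlonglongrightarrow> p T"
      using continuous_on_tendsto_compose[OF pc, of s T] T(1) by auto
  qed
  then obtain \<zeta> where \<zeta>: "p T = E \<zeta>" "\<zeta> \<in> Rc" by auto
  have LgT: "Lg (p T) = \<zeta>" "p T \<in> U" using LgE[of \<zeta>] \<zeta> by (auto simp: Rc_def)
  have \<zeta>2: "\<bar>Re \<zeta>\<bar> = 2" using T(2) LgT \<zeta>(2) by (auto simp: Ob_def Rc_def)
  have pT: "p T \<in> \<Omega>" using p\<Omega> T(1) by blast
  have \<zeta>im: "0 < Im \<zeta> \<and> Im \<zeta> < 1/2"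
  proof -
    have x0: "p T \<noteq> 0" using U0 LgT by blast
    have "0 < - ln (cmod (p T)) / y" by (rule divide_pos_pos) (use pT x0 y in \<open>auto simp: \<Omega>_def\<close>)
    then have "0 < Im \<zeta>" using Im_Lg[OF x0] LgT by simp
    moreover have "Im \<zeta> \<noteq> 1/2"
    proof
      assume "Im \<zeta> = 1/2"
      then have "\<kappa> < cmod (f \<zeta>)" using \<zeta>2 by (intro box) auto
      then show False using \<zeta>(1) pT C\<kappa> by (simp add: f_def \<Omega>_def)
    qed
    ultimately show ?thesis using \<zeta>(2) by (auto simp: Rc_def)
  qed
  define q where "q = Lg \<circ> subpath 0 T p"
  have img0: "path_image (subpath 0 T p) = p ` {0..T}" using Tpos by (simp add: path_image_subpath)
  have inU: "p t \<in> U" if "t \<in> {0..T}" for t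
    using that before[of t] LgT by (cases "t = T") (auto simp: Ob_def)
  have "path q" unfolding q_def
    using p(1) T(1) inU img0 by (intro path_continuous_image path_subpath continuous_on_subset[OF Lg_cont]) auto
  have qs: "pathstart q = Lg w" "pathfinish q = \<zeta>"
    using p(3)[unfolded pathstart_def] LgT by (auto simp: q_def pathstart_compose pathfinish_compose)
  have q_im: "0 < Im x \<and> Im x < 1/2" and q_small: "cmod (f x) \<le> C" if x: "x \<in> path_image q" for x
  proof -
    obtain t where t: "t \<in> {0..T}" "x = Lg (p t)" using x img0 by (auto simp: q_def path_image_compose)
    then have t\<Omega>: "p t \<in> \<Omega>" using p\<Omega>[of t] T(1) by auto
    show "0 < Im x \<and> Im x < 1/2" using t low[OF before t\<Omega>] \<zeta>im LgT by (cases "t = T") auto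
    have "p t \<noteq> 0" using inU t U0 by blast
    then show "cmod (f x) \<le> C" using ELg t t\<Omega> by (simp add: f_def \<Omega>_def)
  qed
  \<comment> \<open>The columns [1, 2] and [-2, -1] have their midpoints 3/2 and -3/2 at height 1/2
    in the blocked box. For the left exit the path is reversed, because crossings run from left to
    right.\<close>
  have contra: "cmod (f (Complex (a + 1/2) (1/2))) \<le> \<kappa> \<Longrightarrow> a \<in> {1, -2} \<Longrightarrow> False" for a
    using box[of "Complex (a + 1/2) (1/2)"] by auto
  show False
  proof (cases "Re \<zeta> = 2")
    case True
    have "cmod (f (Complex (1 + 1/2) (1/2))) \<le> \<kappa>"
      unfolding \<kappa>_def
      by (rule crossing_bound_shift[OF f_hol f_le \<open>path q\<close> q_im _ _ C q_small]) (use qs wRe True in auto)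
    then show False by (rule contra) simp
  next
    case False
    then have "Re \<zeta> = -2" using \<zeta>2 by auto
    have "cmod (f (Complex (-2 + 1/2) (1/2))) \<le> \<kappa>"
      unfolding \<kappa>_def
      by (rule crossing_bound_shift[OF f_hol f_le, of "reversepath q"])
        (use \<open>path q\<close> q_im q_small C qs wRe \<open>Re \<zeta> = -2\<close> in auto)
    then show False by (rule contra) simp
  qed
qed


section \<open>Carleson squares\<close>

lemma carleson_square_open: "\<exists>N. open N \<and> carleson_square z = N \<inter> cball 0 1"
proof -
  define N where "N = (- {0}) \<inter> (\<lambda>x. (cmod x, cmod (x / of_real (cmod x) - z / of_real (cmod z)))) -` ({cmod z<..} \<times> {..<(1 - cmod z) / 2})"
  have "open N" unfolding N_def
    by (intro continuous_open_preimage) (auto intro!: continuous_intros open_Times)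
  moreover have "carleson_square z = N \<inter> cball 0 1"
    by (auto simp: N_def carleson_square_def)
  ultimately show ?thesis by blast
qed

lemma carleson_square_sphere:
  assumes "cmod z < 1"
  shows "carleson_square z \<inter> sphere 0 1 = sphere 0 1 \<inter> ball (z / of_real (cmod z)) ((1 - cmod z) / 2)"
  using assms by (auto simp: carleson_square_def dist_norm norm_minus_commute)

text \<open>Moving towards the origin keeps the direction, lowers the inner radius and widens the
  angle, since both depend on |z| only.\<close>

lemma carleson_square_mono:
  assumes "0 < s" "s \<le> 1" shows "carleson_square z \<subseteq> carleson_square (of_real s * z)"
proof
  fix w assume w: "w \<in> carleson_square z"
  have "cmod (of_real s * z) \<le> cmod z" using assms by (simp add: norm_mult mult_left_le_one_le)
  moreover have "of_real s * z / of_real (cmod (of_real s * z)) = z / of_real (cmod z)"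
    using assms by (simp add: norm_mult)
  ultimately show "w \<in> carleson_square (of_real s * z)"
    using w unfolding carleson_square_def by auto
qed

context schur_function
begin

text \<open>Bridges the two conditions of \<open>one_component\<close>: the closure condition
  supplies points with |b| \<le> C, connectedness concerns |b| < C. An open image contains values of
  smaller modulus near any nonzero value.\<close>

lemma small_values_near:
  assumes p: "cmod p < 1" "cmod (b p) \<le> C" and C: "0 < C" and nc: "\<not> b constant_on ball 0 1" and U: "open U" "p \<in> U"
  shows "\<exists>w\<in>U. cmod w < 1 \<and> cmod (b w) < C"
proof -
  have "open (b ` (U \<inter> ball 0 1))"
    by (rule open_mapping_thm[OF hol open_ball convex_connected[OF convex_ball] _ _ nc]) (use U in auto)
  moreover have "b p \<in> b ` (U \<inter> ball 0 1)" using U p by auto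
  ultimately obtain e where e: "0 < e" "ball (b p) e \<subseteq> b ` (U \<inter> ball 0 1)" using openE by blast
  show ?thesis
  proof (cases "b p = 0")
    case True
    then show ?thesis using U p C by auto
  next
    case False
    define s where "s = min (1/2) (e / (2 * cmod (b p)))"
    have s: "0 < s" "s < 1" "s * cmod (b p) < e"
    proof -
      show "0 < s" "s < 1" using e False by (auto simp: s_def)
      have "s * cmod (b p) \<le> e / (2 * cmod (b p)) * cmod (b p)" by (intro mult_right_mono) (auto simp: s_def)
      also have "\<dots> < e" using e False by simp
      finally show "s * cmod (b p) < e" .
    qed
    define y where "y = of_real (1 - s) * b p"
    have "dist (b p) y = s * cmod (b p)"
    proof -
      have "b p - y = of_real s * b p" by (simp add: y_def algebra_simps)
      then show ?thesis using s by (simp add: dist_norm norm_mult)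
    qed
    then have "y \<in> b ` (U \<inter> ball 0 1)" using e(2) s(3) by auto
    then obtain w where w: "w \<in> U" "cmod w < 1" "b w = y" by auto
    have "cmod y = (1 - s) * cmod (b p)" unfolding y_def norm_mult norm_of_real using s by simp
    also have "\<dots> < 1 * cmod (b p)" using s False by (intro mult_strict_right_mono) auto
    finally show ?thesis using w p by auto
  qed
qed

lemma one_component_imp:
  assumes one: "one_component b" and sup: "\<And>\<epsilon>. 0 < \<epsilon> \<Longrightarrow> \<exists>z\<in>ball 0 1. 1 - \<epsilon> < cmod (b z)"
  shows "\<exists>C1::real. 0 < C1 \<and> C1 < 1 \<and>
       (\<forall>z \<in> ball 0 1 - {0}. cmod (b z) \<ge> C1 \<longrightarrow> sigma_b b (carleson_square z) = 0)"
proof -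
  obtain C where C: "0 < C" "C < 1" and spec: "spec b \<subseteq> closure {z \<in> ball 0 1. cmod (b z) \<le> C}"
    and conn: "connected {z \<in> ball 0 1. cmod (b z) < C}"
    using one unfolding one_component_def by blast
  have nc: "\<not> b constant_on ball 0 1" if p: "cmod p < 1" "cmod (b p) \<le> C" for p
  proof
    assume "b constant_on ball 0 1"
    then have eq: "b z = b p" if "z \<in> ball 0 1" for z
      using p that unfolding constant_on_def by (metis mem_ball_0)
    obtain z where "z \<in> ball 0 1" "1 - (1 - C) < cmod (b z)" using sup[of "1 - C"] C by auto
    then show False using eq[of z] p by simp
  qed
  \<comment> \<open>The closure condition enters here. Either the square contains a zero, or its arc
    has mass and so meets the spectrum; near such a point of the spectrum, inside the relatively
    open square, |b| takes values below C.\<close>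
  have meets: "\<exists>w\<in>carleson_square z. cmod w < 1 \<and> cmod (b w) < C"
    if z: "cmod z < 1" "z \<noteq> 0" and \<sigma>: "sigma_b b (carleson_square z) \<noteq> 0" for z
  proof (cases "zeros_in b \<inter> carleson_square z = {}")
    case False
    then show ?thesis using C by (auto simp: zeros_in_def)
  next
    case True
    define \<omega> where "\<omega> = z / of_real (cmod z)"
    obtain N where N: "open N" "carleson_square z = N \<inter> cball 0 1" using carleson_square_open by blast
    have Qs: "carleson_square z \<inter> sphere 0 1 = sphere 0 1 \<inter> ball \<omega> ((1 - cmod z) / 2)"
      unfolding \<omega>_def by (rule carleson_square_sphere[OF z(1)])
    have "emeasure \<nu> (sphere 0 1 \<inter> ball \<omega> ((1 - cmod z) / 2)) \<noteq> 0"
      using \<sigma> True unfolding sigma_b_eq_0_iff Qs by blast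
    then have "sphere 0 1 \<inter> ball \<omega> ((1 - cmod z) / 2) \<inter> spec b \<noteq> {}"
      using arc_avoiding_spec_null by blast
    then obtain \<xi> where \<xi>: "\<xi> \<in> spec b" "\<xi> \<in> sphere 0 1 \<inter> ball \<omega> ((1 - cmod z) / 2)" by blast
    have "\<xi> \<in> N" using \<xi>(2) N(2) unfolding Qs[symmetric] by auto
    moreover have "\<xi> \<in> closure {z \<in> ball 0 1. cmod (b z) \<le> C}" using spec \<xi> by blast
    ultimately have "N \<inter> {z \<in> ball 0 1. cmod (b z) \<le> C} \<noteq> {}"
      using N(1) by (metis IntI empty_iff open_Int_closure_eq_empty)
    then obtain p where p: "p \<in> N" "cmod p < 1" "cmod (b p) \<le> C" by auto
    from small_values_near[OF p(2,3) C(1) nc[OF p(2,3)] N(1) p(1)] show ?thesis using N(2) by auto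
  qed
  show ?thesis
  proof (cases "\<exists>w0. cmod w0 < 1 \<and> cmod (b w0) < C")
    \<comment> \<open>An empty sublevel set leaves no square charged, so any constant works.\<close>
    case False
    have "sigma_b b (carleson_square z) = 0" if "cmod z < 1" "z \<noteq> 0" for z
      using False meets[OF that] by blast
    then show ?thesis by (intro exI[of _ "1/2"]) auto
  next
    case True
    then obtain w0 where w0: "cmod w0 < 1" "cmod (b w0) < C" by blast
    \<comment> \<open>Points z outside this disc satisfy both |w0| \<le> |z| and |z| \<ge> exp (-1),
      the two conditions for the crossing argument.\<close>
    define \<rho> where "\<rho> = max (cmod w0) (exp (-1))"
    have \<rho>: "\<rho> < 1" "0 \<le> \<rho>" using w0 by (auto simp: \<rho>_def le_max_iff_disj)
    have bc: "continuous_on (cball 0 \<rho>) (\<lambda>z. cmod (b z))"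
      using holomorphic_on_imp_continuous_on[OF hol] \<rho> by (intro continuous_intros continuous_on_subset[OF holomorphic_on_imp_continuous_on[OF hol]]) auto
    have "\<exists>k\<in>cball 0 \<rho>. \<forall>z\<in>cball 0 \<rho>. cmod (b z) \<le> cmod (b k)"
      using \<rho> by (intro continuous_attains_sup[OF compact_cball _ bc]) auto
    then obtain k where k: "cmod k \<le> \<rho>" "\<And>z. cmod z \<le> \<rho> \<Longrightarrow> cmod (b z) \<le> cmod (b k)" by auto
    have k1: "cmod (b k) < 1"
    proof (rule ccontr)
      assume "\<not> cmod (b k) < 1"
      then have "cmod (b z) \<le> cmod (b k)" if "z \<in> ball 0 1" for z using le_1 that by force
      moreover have "k \<in> ball 0 1" using k \<rho> by auto
      ultimately have "b constant_on ball 0 1"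
        by (intro maximum_modulus_principle[OF hol open_ball convex_connected[OF convex_ball] open_ball subset_refl])
      then show False using nc[of w0] w0 by simp
    qed
    define \<kappa> where "\<kappa> = C powr (sinh (pi/2) / sinh pi)"
    have \<kappa>: "0 < \<kappa>" "\<kappa> < 1"
    proof -
      have "0 < sinh (pi/2) / sinh pi" by simp
      then show "0 < \<kappa>" "\<kappa> < 1" unfolding \<kappa>_def using C powr_less_mono2[of "sinh (pi/2) / sinh pi" C 1] by auto
    qed
    \<comment> \<open>The first entry exceeds |b| on the disc of radius \<rho> and so forces |z| >
      \<rho>. The second makes 16 * (1 - |b(z)|) at most (1 - \<kappa>) / 2, which is less than 1 -
      \<kappa>.\<close>
    define C1 where "C1 = max ((1 + cmod (b k)) / 2) (1 - (1 - \<kappa>) / 32)"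
    have C1: "0 < C1" "C1 < 1" using k1 \<kappa> by (auto simp: C1_def less_max_iff_disj)
    have "sigma_b b (carleson_square z) = 0" if z: "z \<in> ball 0 1 - {0}" and big: "C1 \<le> cmod (b z)" for z
    proof (rule ccontr)
      assume "sigma_b b (carleson_square z) \<noteq> 0"
      then obtain w where w: "w \<in> carleson_square z" "cmod w < 1" "cmod (b w) < C" using meets[of z] z by auto
      have "\<not> cmod z \<le> \<rho>"
      proof
        assume "cmod z \<le> \<rho>"
        then have "cmod (b z) \<le> cmod (b k)" by (rule k(2))
        moreover have "(1 + cmod (b k)) / 2 \<le> cmod (b z)" using big by (simp add: C1_def)
        ultimately show False using k1 by simp
      qed
      then have zr: "cmod w0 \<le> cmod z" "exp (-1) \<le> cmod z" by (auto simp: \<rho>_def)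
      have "1 - 16 * (1 - cmod (b z)) \<le> \<kappa>"
        unfolding \<kappa>_def using le_1 z
        by (intro connected_small_set_bound[OF hol _ C conn _ zr(2) w zr(1) w0(2)]) auto
      moreover have "1 - (1 - \<kappa>) / 32 \<le> cmod (b z)" using big by (simp add: C1_def)
      ultimately show False using \<kappa> by (simp add: field_simps)
    qed
    then show ?thesis using C1 by blast
  qed
qed

end

section \<open>From empty squares to one component\<close>

text \<open>The function $v = \log (C/|b|)$ on $V$, extended by $0$, is subharmonic. Hence it is below the Poisson integral $U_r$ of its
  values on the circle of radius $r$, and $U_r$ is below $-\log |b|$, which bounds the mean of $v$ on that circle uniformly. For $r$
  near $1$ only points near $\overline{V} \cap \partial D$ contribute.\<close>
lemma component_poisson_bound:
  fixes b :: "complex \<Rightarrow> complex"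
  assumes hol: "b holomorphic_on ball 0 1" and le1: "\<And>z. cmod z < 1 \<Longrightarrow> cmod (b z) \<le> 1"
    and zs: "cmod zs < 1" "b zs \<noteq> 0"
    and V: "open V" "V \<subseteq> ball 0 1" and C: "0 < C" "C < 1"
    and bV: "\<And>z. z \<in> V \<Longrightarrow> b z \<noteq> 0 \<and> cmod (b z) < C"
    and fr: "\<And>z. z \<in> frontier V \<Longrightarrow> cmod z < 1 \<Longrightarrow> cmod (b z) = C"
  shows "\<exists>M>0. \<forall>z\<in>V. \<forall>t>0. (\<forall>\<xi>\<in>closure V. cmod \<xi> = 1 \<longrightarrow> t \<le> dist z \<xi>) \<longrightarrow> ln (C / cmod (b z)) \<le> 4 * M / t"
proof -
  \<comment> \<open>The extension by 0 is continuous in the disc, because |b| = C on the part of the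
    frontier of \<open>V\<close> inside the disc.\<close>
  define v where "v z = (if z \<in> V then ln (C / cmod (b z)) else 0)" for z
  have v0: "0 \<le> v z" for z using bV[of z] by (auto simp: v_def)
  have v_exp: "exp (v z) * cmod (b z) \<le> 1" if "cmod z < 1" for z
    using bV[of z] C le1[OF that] by (auto simp: v_def)
  have bc: "isCont b z" if "cmod z < 1" for z
    using hol that holomorphic_on_imp_continuous_on continuous_on_eq_continuous_at[of "ball 0 1" b] by auto
  have v_cont: "isCont v z" if z: "cmod z < 1" for z
  proof -
    consider "z \<in> V" | "z \<notin> closure V" | "z \<in> frontier V" "z \<notin> V"
      using V(1) by (auto simp: frontier_def interior_open)
    then show ?thesis
    proof cases
      case 1
      have "isCont (\<lambda>z. ln (C / cmod (b z))) z"
        using bV[OF 1] C by (intro continuous_intros bc z) auto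
      moreover have "\<forall>\<^sub>F x in nhds z. ln (C / cmod (b x)) = v x"
        using V(1) 1 by (auto simp: eventually_nhds v_def)
      ultimately show ?thesis by (rule isCont_cong[THEN iffD1, rotated])
    next
      case 2
      have "\<forall>\<^sub>F x in nhds z. 0 = v x"
        unfolding eventually_nhds using 2 closure_subset[of V]
        by (intro exI[of _ "- closure V"]) (auto simp: v_def)
      then show ?thesis by (rule isCont_cong[THEN iffD1]) simp
    next
      case 3
      have bz: "cmod (b z) = C" using fr 3 z by blast
      have "((\<lambda>x. \<bar>ln (C / cmod (b x))\<bar>) \<longlongrightarrow> \<bar>ln (C / cmod (b z))\<bar>) (at z)"
        using bc[OF z] bz C by (intro tendsto_intros) (auto simp: isCont_def)
      then have "((\<lambda>x. \<bar>ln (C / cmod (b x))\<bar>) \<longlongrightarrow> 0) (at z)" using bz C by simp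
      then have "(v \<longlongrightarrow> 0) (at z)"
        by (rule Lim_null_comparison[rotated]) (auto simp: v_def intro!: always_eventually)
      then show ?thesis using 3 by (simp add: isCont_def v_def)
    qed
  qed
  define U where "U r w = integral\<^sup>L circ (\<lambda>t. poisson_kernel w (cis t) * v (of_real r * cis t))" for r w
  have rw: "cmod (of_real r * w) < 1" if "0 < r" "r < 1" "cmod w \<le> 1" for r w
    using that by (simp add: norm_mult) (smt (verit) mult_left_le)
  have vr_cont: "isCont (\<lambda>w. v (of_real r * w)) w" if "0 < r" "r < 1" "cmod w \<le> 1" for r w
    by (rule isCont_o2[where f="\<lambda>w. of_real r * w" and g=v]) (use v_cont[OF rw[OF that]] in auto)
  have \<phi>: "continuous_on (sphere 0 1) (\<lambda>w. v (of_real r * w))" if "0 < r" "r < 1" for r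
    by (intro continuous_at_imp_continuous_on ballI vr_cont that) auto
  have H: "\<exists>H. H holomorphic_on ball 0 1 \<and> (\<forall>w. cmod w < 1 \<longrightarrow> Re (H w) = U r w)" if "0 < r" "r < 1" for r
    by (rule dirichlet_holomorphic[OF \<phi>[OF that]]) (auto simp: U_def)
  have U_lim: "(U r \<longlongrightarrow> v (of_real r * \<xi>)) (at \<xi> within ball 0 1)" if "0 < r" "r < 1" "cmod \<xi> = 1" for r \<xi>
    using poisson_integral_tendsto[OF \<phi>[OF that(1,2)] that(3)] by (simp add: U_def[abs_def])
  have U0: "0 \<le> U r w" if "cmod w < 1" for r w
    unfolding U_def using v0 poisson_kernel_pos[OF that] by (intro integral_nonneg_AE AE_I2 mult_nonneg_nonneg) (auto simp: less_imp_le)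
  have br_hol: "(\<lambda>w. b (of_real r * w)) holomorphic_on ball 0 1" if "0 < r" "r < 1" for r
  proof -
    have "b \<circ> (\<lambda>w. of_real r * w) holomorphic_on ball 0 1"
      by (rule holomorphic_on_compose_gen[OF _ hol]) (use rw[OF that] in \<open>auto intro!: holomorphic_intros\<close>)
    then show ?thesis by (simp add: o_def)
  qed
  \<comment> \<open>The comparison of a subharmonic function with its Poisson integral, in
    exponential form: \<open>f\<close> has modulus exp (v - U). At boundary points inside the disc v
    = 0 \<le> U; on the circle U tends to v.\<close>
  have vU: "v (of_real r * w) \<le> U r w" if r: "0 < r" "r < 1" and w: "cmod w < 1" for r w
  proof (cases "of_real r * w \<in> V")
    case False
    then show ?thesis using U0[OF w] by (simp add: v_def)
  next
    case True
    obtain H where H: "H holomorphic_on ball 0 1" "\<And>w. cmod w < 1 \<Longrightarrow> Re (H w) = U r w" using H[OF r] by blast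
    define Vr where "Vr = ball 0 1 \<inter> (\<lambda>w. of_real r * w) -` V"
    have oVr: "open Vr" unfolding Vr_def using V by (intro open_Int open_vimage) (auto intro!: continuous_intros)
    define f where "f w = of_real C / b (of_real r * w) * exp (- H w)" for w
    have fn: "cmod (f w) = exp (v (of_real r * w) - U r w)" if "w \<in> Vr" for w
    proof -
      have "of_real r * w \<in> V" "cmod w < 1" using that by (auto simp: Vr_def)
      then have "exp (v (of_real r * w)) = C / cmod (b (of_real r * w))" "cmod (exp (- H w)) = exp (- U r w)"
        using bV C H(2) by (auto simp: v_def norm_exp_eq_Re)
      then show ?thesis unfolding f_def norm_mult norm_divide using C by (simp only: exp_diff exp_minus divide_inverse norm_of_real abs_of_pos)
    qed
    have "cmod (f w) \<le> 1"
    proof (rule max_mod_limsup[OF oVr, where f=f])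
      show "bounded Vr" unfolding Vr_def by (intro bounded_Int) auto
      show "f holomorphic_on Vr" unfolding f_def
        by (intro holomorphic_intros holomorphic_on_subset[OF br_hol[OF r]] holomorphic_on_subset[OF H(1)]) (use bV in \<open>auto simp: Vr_def\<close>)
      show "w \<in> Vr" using True w by (simp add: Vr_def)
      fix \<xi> and \<epsilon> :: real assume \<xi>: "\<xi> \<in> frontier Vr" and \<epsilon>: "0 < \<epsilon>"
      have sub: "Vr \<subseteq> ball 0 1" by (auto simp: Vr_def)
      have \<xi>1: "cmod \<xi> \<le> 1" "\<xi> \<notin> Vr"
        using \<xi> oVr closure_mono[OF sub] by (auto simp: frontier_def interior_open)
      have evV: "\<forall>\<^sub>F w in at \<xi> within Vr. w \<in> Vr" by (auto simp: eventually_at_filter)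
      have vlim: "((\<lambda>w. v (of_real r * w)) \<longlongrightarrow> v (of_real r * \<xi>)) (at \<xi> within Vr)"
        using vr_cont[OF r \<xi>1(1)] by (auto simp: isCont_def intro: tendsto_within_subset)
      show "\<forall>\<^sub>F w in at \<xi> within Vr. cmod (f w) \<le> 1 + \<epsilon>"
      proof (cases "cmod \<xi> < 1")
        case True
        then have "v (of_real r * \<xi>) = 0" using \<xi>1(2) by (simp add: v_def Vr_def)
        then have "((\<lambda>w. exp (v (of_real r * w))) \<longlongrightarrow> exp 0) (at \<xi> within Vr)" using vlim by (intro tendsto_intros) simp
        then have "\<forall>\<^sub>F w in at \<xi> within Vr. exp (v (of_real r * w)) < 1 + \<epsilon>" using \<epsilon> by (intro order_tendstoD(2)) auto
        then show ?thesis using evV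
        proof eventually_elim
          case (elim w)
          have "exp (v (of_real r * w) - U r w) \<le> exp (v (of_real r * w))" using U0[of w r] sub elim(2) by auto
          then show ?case using elim(1) fn[OF elim(2)] by linarith
        qed
      next
        case False
        then have "cmod \<xi> = 1" using \<xi>1 by simp
        then have "(U r \<longlongrightarrow> v (of_real r * \<xi>)) (at \<xi> within Vr)" using U_lim[OF r] sub tendsto_within_subset by blast
        then have "((\<lambda>w. exp (v (of_real r * w) - U r w)) \<longlongrightarrow> exp (v (of_real r * \<xi>) - v (of_real r * \<xi>))) (at \<xi> within Vr)"
          by (intro tendsto_intros vlim)
        then have "\<forall>\<^sub>F w in at \<xi> within Vr. exp (v (of_real r * w) - U r w) < 1 + \<epsilon>" using \<epsilon> by (intro order_tendstoD(2)) auto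
        then show ?thesis using evV by eventually_elim (use fn in simp)
      qed
    qed
    then show ?thesis using fn[of w] True w by (simp add: Vr_def)
  qed
  \<comment> \<open>The boundary values exp v * |b| are C in \<open>V\<close> and |b| elsewhere, so
    at most 1. Thus U is bounded by - ln |b| even though v lives only on \<open>V\<close>.\<close>
  have Ub: "exp (U r w) * cmod (b (of_real r * w)) \<le> 1" if r: "0 < r" "r < 1" and w: "cmod w < 1" for r w
  proof -
    obtain H where H: "H holomorphic_on ball 0 1" "\<And>w. cmod w < 1 \<Longrightarrow> Re (H w) = U r w" using H[OF r] by blast
    define f where "f w = exp (H w) * b (of_real r * w)" for w
    have fn: "cmod (f w) = exp (U r w) * cmod (b (of_real r * w))" if "cmod w < 1" for w
      using H(2)[OF that] by (simp add: f_def norm_mult)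
    have "cmod (f w) \<le> 1"
    proof (rule max_mod_limsup[of "ball 0 1" f])
      show "f holomorphic_on ball 0 1" unfolding f_def by (intro holomorphic_intros br_hol[OF r] H(1))
      show "w \<in> ball 0 1" using w by simp
      fix \<xi> :: complex and \<epsilon> :: real assume "\<xi> \<in> frontier (ball 0 1)" and \<epsilon>: "0 < \<epsilon>"
      then have \<xi>: "cmod \<xi> = 1" by simp
      have "isCont (\<lambda>w. b (of_real r * w)) \<xi>"
        by (rule isCont_o2[where f="\<lambda>w. of_real r * w" and g=b]) (use bc[OF rw[OF r]] \<xi> in auto)
      then have "((\<lambda>w. b (of_real r * w)) \<longlongrightarrow> b (of_real r * \<xi>)) (at \<xi> within ball 0 1)"
        unfolding isCont_def by (rule tendsto_within_subset) simp
      then have lim: "((\<lambda>w. exp (U r w) * cmod (b (of_real r * w))) \<longlongrightarrow> exp (v (of_real r * \<xi>)) * cmod (b (of_real r * \<xi>))) (at \<xi> within ball 0 1)"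
        by (intro tendsto_intros U_lim[OF r \<xi>])
      have "exp (v (of_real r * \<xi>)) * cmod (b (of_real r * \<xi>)) < 1 + \<epsilon>"
        using v_exp[OF rw[OF r]] \<xi> \<epsilon> by (smt (verit))
      from order_tendstoD(2)[OF lim this]
      have "\<forall>\<^sub>F w in at \<xi> within ball 0 1. exp (U r w) * cmod (b (of_real r * w)) < 1 + \<epsilon>" .
      moreover have "\<forall>\<^sub>F w in at \<xi> within ball 0 1. cmod w < 1" by (auto simp: eventually_at_filter)
      ultimately show "\<forall>\<^sub>F w in at \<xi> within ball 0 1. cmod (f w) \<le> 1 + \<epsilon>"
        by eventually_elim (use fn in simp)
    qed auto
    then show ?thesis using fn[OF w] by simp
  qed
  \<comment> \<open>For r > \<rho> the rescaled point zs / r stays in |w| \<le> q < 1. There the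
    kernel is at least (1 - q) / (1 + q), which bounds the mean over the circle by a constant
    independent of r. The summand 1 in \<open>M\<close> makes it positive.\<close>
  define \<rho> where "\<rho> = (1 + cmod zs) / 2"
  have \<rho>: "0 < \<rho>" "cmod zs < \<rho>" "\<rho> < 1" using zs by (auto simp: \<rho>_def intro: add_pos_nonneg)
  define q where "q = cmod zs / \<rho>"
  have q: "0 \<le> q" "q < 1" using \<rho> by (auto simp: q_def)
  define M where "M = (1 + q) / (1 - q) * (- ln (cmod (b zs))) + 1"
  have M: "0 < M"
  proof -
    have "ln (cmod (b zs)) \<le> 0" using le1[OF zs(1)] zs(2) by simp
    then have "0 \<le> (1 + q) / (1 - q) * (- ln (cmod (b zs)))" using q by (intro mult_nonneg_nonneg divide_nonneg_nonneg) auto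
    then show ?thesis by (simp add: M_def)
  qed
  have \<phi>c: "continuous_on UNIV (\<lambda>t. v (of_real r * cis t))" if "0 < r" "r < 1" for r
    using continuous_on_sphere_cis[OF \<phi>[OF that]] .
  have U00: "U r 0 = integral\<^sup>L circ (\<lambda>t. v (of_real r * cis t))" for r by (simp add: U_def poisson_kernel_def)
  have mean: "U r 0 \<le> M" if r: "\<rho> < r" "r < 1" for r
  proof -
    have r0: "0 < r" using r \<rho> by simp
    define w where "w = zs / of_real r"
    have cw: "cmod w = cmod zs / r" using r0 by (simp add: w_def norm_divide)
    have wq: "cmod w \<le> q" unfolding cw q_def using r \<rho> by (intro divide_left_mono) auto
    then have w1: "cmod w < 1" using q by simp
    have "(1 - q) / (1 + q) * U r 0 = integral\<^sup>L circ (\<lambda>t. (1 - q) / (1 + q) * v (of_real r * cis t))"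
      unfolding U00 by simp
    also have "\<dots> \<le> U r w" unfolding U_def
    proof (rule integral_mono)
      fix t
      have "(1 - q) / (1 + q) \<le> (1 - cmod w) / (1 + cmod w)"
        using wq q by (intro frac_le) (auto intro: add_pos_nonneg)
      also have "\<dots> \<le> poisson_kernel w (cis t)" using w1 by (intro poisson_kernel_ge) auto
      finally show "(1 - q) / (1 + q) * v (of_real r * cis t) \<le> poisson_kernel w (cis t) * v (of_real r * cis t)"
        using v0 by (intro mult_right_mono)
    qed (intro integral_circ continuous_intros \<phi>c r0 r poisson_kernel_continuous w1)+
    also have "\<dots> \<le> - ln (cmod (b zs))"
    proof -
      have "of_real r * w = zs" using r0 by (simp add: w_def)
      then have "exp (U r w) * cmod (b zs) \<le> 1" using Ub[OF r0 r(2) w1] by simp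
      then have "ln (exp (U r w) * cmod (b zs)) \<le> 0" using zs by simp
      then show ?thesis using zs by (simp add: ln_mult)
    qed
    finally have "(1 - q) / (1 + q) * U r 0 \<le> - ln (cmod (b zs))" .
    from mult_left_mono[OF this, of "(1 + q) / (1 - q)"] q show ?thesis by (simp add: M_def)
  qed
  show ?thesis
  proof (intro exI[of _ M] conjI M ballI allI impI)
    fix z and t :: real assume z: "z \<in> V" and t: "0 < t" and far: "\<forall>\<xi>\<in>closure V. cmod \<xi> = 1 \<longrightarrow> t \<le> dist z \<xi>"
    have z1: "cmod z < 1" using z V by auto
    \<comment> \<open>This part of the closure is compact in the open disc. If r exceeds all moduli
      in it, every point of \<open>V\<close> on the circle of radius r is farther than t/2 from z,
      and only those points carry v.\<close>
    define K where "K = closure V \<inter> cball z (t/2)"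
    have "closure V \<subseteq> cball 0 1" by (rule closure_minimal) (use V(2) ball_subset_cball[of 0 1] in auto)
    then have K1: "cmod x < 1" if "x \<in> K" for x
    proof -
      have x: "x \<in> closure V" "dist z x \<le> t / 2" "cmod x \<le> 1" using that \<open>closure V \<subseteq> cball 0 1\<close> by (auto simp: K_def)
      then have "cmod x \<noteq> 1" using far t by force
      then show ?thesis using x by simp
    qed
    have cK: "compact K" unfolding K_def by (intro closed_Int_compact) auto
    have zK: "z \<in> K" using z t closure_subset by (auto simp: K_def)
    obtain k where k: "k \<in> K" "\<And>x. x \<in> K \<Longrightarrow> cmod x \<le> cmod k"
      using continuous_attains_sup[OF cK _ continuous_on_norm_id] zK by blast
    define r where "r = (1 + max \<rho> (cmod k)) / 2"
    have r: "\<rho> < r" "r < 1" "cmod k < r" "0 < r" using \<rho> K1[OF k(1)] by (auto simp: r_def max_def)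
    have zr: "cmod z < r" using k(2)[OF zK] r by simp
    define w where "w = z / of_real r"
    have w1: "cmod w < 1" using zr r by (simp add: w_def norm_divide)
    have rww: "of_real r * w = z" using r by (simp add: w_def)
    have "ln (C / cmod (b z)) = v (of_real r * w)" using z by (simp add: v_def rww)
    also have "\<dots> \<le> U r w" by (rule vU[OF r(4,2) w1])
    also have "\<dots> \<le> integral\<^sup>L circ (\<lambda>s. 4 / t * v (of_real r * cis s))"
      unfolding U_def
    proof (rule integral_mono)
      fix s
      show "poisson_kernel w (cis s) * v (of_real r * cis s) \<le> 4 / t * v (of_real r * cis s)"
      proof (cases "of_real r * cis s \<in> V")
        case True
        have "cmod (of_real r * cis s) = r" using r by (simp add: norm_mult)
        then have "of_real r * cis s \<notin> K" using k(2) r(3) by force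
        then have d: "t / 2 < dist z (of_real r * cis s)" using True closure_subset by (auto simp: K_def)
        have "dist z (of_real r * cis s) = r * cmod (cis s - w)"
        proof -
          have "of_real r * cis s - z = of_real r * (cis s - w)" using r by (simp add: w_def algebra_simps)
          then show ?thesis using r by (subst dist_commute) (simp add: dist_norm norm_mult)
        qed
        also have "\<dots> \<le> 1 * cmod (cis s - w)" using r by (intro mult_right_mono) auto
        finally have d2: "t / 2 < cmod (cis s - w)" using d by simp
        have "poisson_kernel w (cis s) \<le> 2 / cmod (cis s - w)" using w1 by (intro poisson_kernel_le) auto
        also have "\<dots> \<le> 2 / (t / 2)" using d2 t by (intro divide_left_mono mult_pos_pos) auto
        finally show ?thesis using v0 by (intro mult_right_mono) auto
      qed (simp add: v_def)
    qed (intro integral_circ continuous_intros \<phi>c r poisson_kernel_continuous w1)+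
    also have "\<dots> = 4 / t * U r 0" unfolding U00 by simp
    also have "\<dots> \<le> 4 / t * M" using mean[OF r(1,2)] t by (intro mult_left_mono) auto
    finally show "ln (C / cmod (b z)) \<le> 4 * M / t" by simp
  qed
qed

text \<open>In the wedge |arg w| \<le> pi/4, so the power -3/2 has argument at most 3 * pi / 8 <
  pi/2, and its real part is comparable to its modulus.\<close>

lemma wedge_power_bound:
  assumes "0 < Re w" "\<bar>Im w\<bar> \<le> Re w"
  shows "cos (3 * pi / 8) * (cmod w powr (-3/2)) \<le> Re (exp (- (3/2) * Ln w))"
proof -
  have w0: "w \<noteq> 0" using assms by auto
  have im: "Im (Ln w) = arctan (Im w / Re w)" using assms by (subst Im_Ln_eq) auto
  have "arctan (Im w / Re w) \<le> arctan 1" "arctan (-1) \<le> arctan (Im w / Re w)"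
    by (rule arctan_monotone'; use assms in \<open>simp add: field_simps\<close>)+
  then have a: "\<bar>Im (Ln w)\<bar> \<le> pi / 4" unfolding im by (auto simp: arctan_one arctan_minus)
  have "Re (exp (- (3/2) * Ln w)) = exp (- (3/2) * ln (cmod w)) * cos (- (3/2) * Im (Ln w))"
    using w0 by (simp add: Re_exp)
  also have "exp (- (3/2) * ln (cmod w)) = cmod w powr (-3/2)" using w0 by (simp add: powr_def)
  also have "cos (- (3/2) * Im (Ln w)) = cos (3/2 * \<bar>Im (Ln w)\<bar>)" by (simp add: abs_if)
  finally have eq: "Re (exp (- (3/2) * Ln w)) = cmod w powr (-3/2) * cos (3/2 * \<bar>Im (Ln w)\<bar>)" .
  have "cos (3 * pi / 8) \<le> cos (3/2 * \<bar>Im (Ln w)\<bar>)" using a by (intro cos_monotone_0_pi_le) auto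
  then show ?thesis unfolding eq by (simp add: mult.commute mult_left_mono)
qed


text \<open>Here $V$ is lifted by $z = e^{i\zeta}$ to a half strip with right angles at $x_1$ and $x_2$. The exponent $3/2$ of the barrier lies
  between the growth order $1$ and the critical order $2$ of these corners.\<close>
lemma component_lift_empty:
  fixes b :: "complex \<Rightarrow> complex" and x1 x2 :: real
  assumes hol: "b holomorphic_on ball 0 1" and le1: "\<And>z. cmod z < 1 \<Longrightarrow> cmod (b z) \<le> 1"
    and zs: "cmod zs < 1" "b zs \<noteq> 0" and C: "0 < C" "C < 1"
    and W: "open W" "bounded W" and W_strip: "\<And>\<zeta>. \<zeta> \<in> W \<Longrightarrow> x1 < Re \<zeta> \<and> Re \<zeta> < x2 \<and> 0 < Im \<zeta>"
    and bW: "\<And>\<zeta>. \<zeta> \<in> W \<Longrightarrow> b (exp (\<i> * \<zeta>)) \<noteq> 0 \<and> cmod (b (exp (\<i> * \<zeta>))) < C"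
    and fr_in: "\<And>\<zeta>. \<zeta> \<in> frontier W \<Longrightarrow> 0 < Im \<zeta> \<Longrightarrow> cmod (b (exp (\<i> * \<zeta>))) = C"
    and fr_bd: "\<And>\<zeta>. \<zeta> \<in> frontier W \<Longrightarrow> Im \<zeta> = 0 \<Longrightarrow> \<zeta> = of_real x1 \<or> \<zeta> = of_real x2"
  shows "W = {}"
proof -
  define e where "e \<zeta> = exp (\<i> * \<zeta>)" for \<zeta> :: complex
  have e_norm: "cmod (e \<zeta>) = exp (- Im \<zeta>)" for \<zeta> by (simp add: e_def)
  have e_hol: "e holomorphic_on A" for A unfolding e_def by (intro holomorphic_intros)
  have e_cont: "continuous_on A e" for A by (rule holomorphic_on_imp_continuous_on[OF e_hol])
  define V where "V = e ` W"
  have oV: "open V" unfolding V_def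
  proof (rule open_mapping_thm[OF e_hol open_UNIV connected_UNIV W(1)])
    show "\<not> e constant_on UNIV"
    proof
      assume "e constant_on UNIV"
      then have "e 0 = e \<i>" unfolding constant_on_def by (metis UNIV_I)
      then show False using e_norm[of 0] e_norm[of \<i>] by simp
    qed
  qed simp
  have clW_im: "0 \<le> Im \<zeta>" if "\<zeta> \<in> closure W" for \<zeta>
  proof -
    have "closure W \<subseteq> {\<zeta>. 0 \<le> Im \<zeta>}" using W_strip by (intro closure_minimal closed_halfspace_Im_ge) (auto simp: less_imp_le)
    then show ?thesis using that by blast
  qed
  have "compact (closure W)" using W(2) by (simp add: compact_closure)
  then have "closed (e ` closure W)" using e_cont by (intro compact_imp_closed compact_continuous_image)
  \<comment> \<open>Boundedness of \<open>W\<close> makes the image of its closure compact. So every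
    boundary point of \<open>V\<close> lifts to a boundary point of \<open>W\<close>.\<close>
  then have clV: "closure V \<subseteq> e ` closure W" unfolding V_def using closure_subset by (intro closure_minimal) auto
  have fr_W: "\<zeta> \<in> frontier W" if "\<zeta> \<in> closure W" "e \<zeta> \<notin> V" for \<zeta>
    using that W(1) by (auto simp: frontier_def interior_open V_def)
  have V_ball: "V \<subseteq> ball 0 1" unfolding V_def using W_strip e_norm by auto
  obtain M where M: "0 < M" and est: "\<And>z t. z \<in> V \<Longrightarrow> 0 < t \<Longrightarrow> (\<forall>\<xi>\<in>closure V. cmod \<xi> = 1 \<longrightarrow> t \<le> dist z \<xi>) \<Longrightarrow> ln (C / cmod (b z)) \<le> 4 * M / t"
  proof -
    have "cmod (b z) = C" if z: "z \<in> frontier V" "cmod z < 1" for z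
    proof -
      have "z \<in> closure V" "z \<notin> V" using z oV by (auto simp: frontier_def interior_open)
      then obtain \<zeta> where \<zeta>: "\<zeta> \<in> closure W" "z = e \<zeta>" using clV by blast
      then have "\<zeta> \<in> frontier W" using fr_W \<open>z \<notin> V\<close> by simp
      moreover have "0 < Im \<zeta>" using z(2) \<zeta>(2) by (simp add: e_norm)
      ultimately show ?thesis using fr_in \<zeta>(2) by (simp add: e_def)
    qed
    moreover have "\<And>z. z \<in> V \<Longrightarrow> b z \<noteq> 0 \<and> cmod (b z) < C" using bW by (auto simp: V_def e_def)
    ultimately show ?thesis using component_poisson_bound[OF hol le1 zs oV V_ball C] that by blast
  qed
  define p1 where "p1 = e (of_real x1)" define p2 where "p2 = e (of_real x2)"
  have p1_norm: "cmod p1 = 1" "cmod p2 = 1" by (auto simp: p1_def p2_def e_norm)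
  have ends: "\<xi> = p1 \<or> \<xi> = p2" if \<xi>: "\<xi> \<in> closure V" "cmod \<xi> = 1" for \<xi>
  proof -
    obtain \<zeta> where \<zeta>: "\<zeta> \<in> closure W" "\<xi> = e \<zeta>" using clV \<xi> by blast
    have "\<xi> \<notin> V" using V_ball \<xi>(2) by auto
    then have "\<zeta> \<in> frontier W" using fr_W \<zeta> by simp
    moreover have "Im \<zeta> = 0" using \<xi>(2) \<zeta>(2) by (simp add: e_norm)
    ultimately show ?thesis using fr_bd \<zeta>(2) by (auto simp: p1_def p2_def)
  qed
  have est': "ln (C / cmod (b (e \<zeta>))) \<le> 4 * M / t"
    if "\<zeta> \<in> W" "0 < t" "t \<le> dist (e \<zeta>) p1" "t \<le> dist (e \<zeta>) p2" for \<zeta> t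
    by (rule est) (use that ends in \<open>auto simp: V_def\<close>)
  \<comment> \<open>Multiplication by 1 - i and -1 - i rotates the quarter planes at x1 and x2 onto
    the wedge |arg w| < pi/4. The power -3/2 eventually dominates any multiple of the power -1 that
    the Poisson estimate allows.\<close>
  define \<beta> where "\<beta> \<zeta> = exp (- (3/2) * Ln ((1 - \<i>) * (\<zeta> - of_real x1))) + exp (- (3/2) * Ln ((- 1 - \<i>) * (\<zeta> - of_real x2)))" for \<zeta>
  define \<kappa> where "\<kappa> = cos (3 * pi / 8)"
  have \<kappa>: "0 < \<kappa>" unfolding \<kappa>_def by (rule cos_gt_zero_pi) (use pi_gt_zero in linarith)+
  have wedge: "0 < Re ((1 - \<i>) * (\<zeta> - of_real x1))" "\<bar>Im ((1 - \<i>) * (\<zeta> - of_real x1))\<bar> \<le> Re ((1 - \<i>) * (\<zeta> - of_real x1))"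
     "0 < Re ((- 1 - \<i>) * (\<zeta> - of_real x2))" "\<bar>Im ((- 1 - \<i>) * (\<zeta> - of_real x2))\<bar> \<le> Re ((- 1 - \<i>) * (\<zeta> - of_real x2))"
    if "\<zeta> \<in> W" for \<zeta> using W_strip[OF that] by (auto simp: algebra_simps)
  have n2: "cmod (1 - \<i>) = sqrt 2" "cmod (- 1 - \<i>) = sqrt 2" by (auto simp: cmod_def)
  have \<beta>1: "\<kappa> * (sqrt 2 * cmod (\<zeta> - of_real x1)) powr (-3/2) \<le> Re (\<beta> \<zeta>)"
    and \<beta>2: "\<kappa> * (sqrt 2 * cmod (\<zeta> - of_real x2)) powr (-3/2) \<le> Re (\<beta> \<zeta>)"
    and \<beta>0: "0 \<le> Re (\<beta> \<zeta>)" if "\<zeta> \<in> W" for \<zeta>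
  proof -
    note w1 = wedge_power_bound[OF wedge(1,2)[OF that], folded \<kappa>_def, unfolded norm_mult n2]
    note w2 = wedge_power_bound[OF wedge(3,4)[OF that], folded \<kappa>_def, unfolded norm_mult n2]
    have nn: "0 \<le> \<kappa> * (sqrt 2 * cmod (\<zeta> - of_real x1)) powr (-3/2)" "0 \<le> \<kappa> * (sqrt 2 * cmod (\<zeta> - of_real x2)) powr (-3/2)"
      using \<kappa> by auto
    have "Re (\<beta> \<zeta>) = Re (exp (- (3/2) * Ln ((1 - \<i>) * (\<zeta> - of_real x1)))) + Re (exp (- (3/2) * Ln ((- 1 - \<i>) * (\<zeta> - of_real x2))))"
      unfolding \<beta>_def by (rule plus_complex.sel)
    then show "\<kappa> * (sqrt 2 * cmod (\<zeta> - of_real x1)) powr (-3/2) \<le> Re (\<beta> \<zeta>)"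
      "\<kappa> * (sqrt 2 * cmod (\<zeta> - of_real x2)) powr (-3/2) \<le> Re (\<beta> \<zeta>)" "0 \<le> Re (\<beta> \<zeta>)"
      using w1 w2 nn by linarith+
  qed
  have \<beta>_hol: "\<beta> holomorphic_on W"
    unfolding \<beta>_def
    by (intro holomorphic_intros) (use wedge in \<open>force simp: complex_nonpos_Reals_iff\<close>)+
  have corner: "\<forall>\<^sub>F \<zeta> in at (of_real X) within W. ln (C / cmod (b (e \<zeta>))) \<le> \<epsilon> * Re (\<beta> \<zeta>)"
    if X: "X = x1 \<or> X = x2" and \<epsilon>: "0 < \<epsilon>" for X \<epsilon>
  proof -
    define P where "P = e (of_real X)"
    have P1: "cmod P = 1" by (simp add: P_def e_norm)
    \<comment> \<open>The derivative has modulus 1 at a real point, so distances to the corner and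
      to its image are comparable with the factor 1/2.\<close>
    have "(e has_field_derivative (\<i> * P)) (at (of_real X))"
      unfolding e_def P_def by (auto intro!: derivative_eq_intros)
    then have "((\<lambda>\<zeta>. (e \<zeta> - P) / (\<zeta> - of_real X)) \<longlongrightarrow> \<i> * P) (at (of_real X))"
      unfolding has_field_derivative_iff P_def .
    then have "((\<lambda>\<zeta>. cmod ((e \<zeta> - P) / (\<zeta> - of_real X))) \<longlongrightarrow> 1) (at (of_real X))"
      using tendsto_norm P1 by (fastforce simp: norm_mult)
    then have "\<forall>\<^sub>F \<zeta> in at (of_real X). 1/2 < cmod ((e \<zeta> - P) / (\<zeta> - of_real X))"
      by (rule order_tendstoD) simp
    then have "\<forall>\<^sub>F \<zeta> in at (of_real X) within W. 1/2 < cmod ((e \<zeta> - P) / (\<zeta> - of_real X))"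
      by (rule filter_leD[OF at_le, rotated]) simp
    then have evP: "\<forall>\<^sub>F \<zeta> in at (of_real X) within W. cmod (\<zeta> - of_real X) / 2 \<le> dist (e \<zeta>) P"
    proof (rule eventually_mono)
      fix \<zeta> assume "1/2 < cmod ((e \<zeta> - P) / (\<zeta> - of_real X))"
      then show "cmod (\<zeta> - of_real X) / 2 \<le> dist (e \<zeta>) P"
        by (cases "\<zeta> = of_real X") (auto simp: dist_norm norm_divide field_simps)
    qed
    \<comment> \<open>The estimate asks for the distance to both end points on the circle. They may
      coincide, namely when the strip has width 2 * pi; a different one is at positive
      distance.\<close>
    have evQ: "\<forall>\<^sub>F \<zeta> in at (of_real X) within W. cmod (\<zeta> - of_real X) / 2 \<le> dist (e \<zeta>) Q" for Q
    proof (cases "Q = P")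
      case False
      have e_at: "(e \<longlongrightarrow> P) (at (of_real X) within W)"
        using e_cont[of UNIV] unfolding P_def by (auto simp: continuous_on_def intro: tendsto_within_subset)
      have "((\<lambda>\<zeta>. dist (e \<zeta>) Q - cmod (\<zeta> - of_real X) / 2) \<longlongrightarrow> dist P Q - cmod (of_real X - of_real X) / 2) (at (of_real X) within W)"
        by (intro tendsto_intros e_at) auto
      then have "\<forall>\<^sub>F \<zeta> in at (of_real X) within W. 0 < dist (e \<zeta>) Q - cmod (\<zeta> - of_real X) / 2"
        using False by (intro order_tendstoD(1)) auto
      then show ?thesis by eventually_elim simp
    qed (use evP in simp)
    have "\<forall>\<^sub>F s in at_right 0. 8 * M / s \<le> \<epsilon> * (\<kappa> * (sqrt 2 * s) powr (-3/2))"
      using M \<kappa> \<epsilon> by real_asymp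
    moreover have "filterlim (\<lambda>\<zeta>. cmod (\<zeta> - of_real X)) (at_right 0) (at (of_real X) within W)"
      unfolding filterlim_at
    proof
      have "((\<lambda>\<zeta>. cmod (\<zeta> - of_real X)) \<longlongrightarrow> cmod (of_real X - of_real X)) (at (of_real X) within W)"
        by (intro tendsto_intros)
      then show "((\<lambda>\<zeta>. cmod (\<zeta> - of_real X)) \<longlongrightarrow> 0) (at (of_real X) within W)" by simp
      show "\<forall>\<^sub>F \<zeta> in at (of_real X) within W. cmod (\<zeta> - of_real X) \<in> {0<..} \<and> cmod (\<zeta> - of_real X) \<noteq> 0"
        by (auto simp: eventually_at_filter)
    qed
    ultimately have evs: "\<forall>\<^sub>F \<zeta> in at (of_real X) within W. 8 * M / cmod (\<zeta> - of_real X) \<le> \<epsilon> * (\<kappa> * (sqrt 2 * cmod (\<zeta> - of_real X)) powr (-3/2))"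
      by (rule eventually_compose_filterlim)
    have evW: "\<forall>\<^sub>F \<zeta> in at (of_real X) within W. \<zeta> \<in> W" by (auto simp: eventually_at_filter)
    show ?thesis using evQ[of p1] evQ[of p2] evs evW
    proof eventually_elim
      case (elim \<zeta>)
      have "\<zeta> \<noteq> of_real X" using W_strip[OF elim(4)] by auto
      then have "ln (C / cmod (b (e \<zeta>))) \<le> 4 * M / (cmod (\<zeta> - of_real X) / 2)"
        by (intro est' elim) auto
      also have "\<dots> = 8 * M / cmod (\<zeta> - of_real X)" by simp
      also have "\<dots> \<le> \<epsilon> * (\<kappa> * (sqrt 2 * cmod (\<zeta> - of_real X)) powr (-3/2))" by (rule elim)
      also have "\<dots> \<le> \<epsilon> * Re (\<beta> \<zeta>)" using \<epsilon> X \<beta>1[OF elim(4)] \<beta>2[OF elim(4)] by (intro mult_left_mono) auto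
      finally show ?case .
    qed
  qed
  have be_hol: "(\<lambda>\<zeta>. b (e \<zeta>)) holomorphic_on {\<zeta>. 0 < Im \<zeta>}"
  proof -
    have "b \<circ> e holomorphic_on {\<zeta>. 0 < Im \<zeta>}"
      by (rule holomorphic_on_compose_gen[OF e_hol hol]) (auto simp: e_norm)
    then show ?thesis by (simp add: o_def)
  qed
  \<comment> \<open>The barrier with a small factor absorbs the growth at the corners, and elsewhere
    on the frontier |b| = C. Letting \<epsilon> tend to 0 at a fixed point then removes the
    barrier.\<close>
  have key: "ln (C / cmod (b (e \<zeta>))) \<le> \<epsilon> * Re (\<beta> \<zeta>)" if \<epsilon>: "0 < \<epsilon>" and \<zeta>: "\<zeta> \<in> W" for \<epsilon> \<zeta>
  proof -
    define F where "F \<zeta> = of_real C / b (e \<zeta>) * exp (- of_real \<epsilon> * \<beta> \<zeta>)" for \<zeta>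
    have Fn: "cmod (F \<zeta>) = exp (ln (C / cmod (b (e \<zeta>))) - \<epsilon> * Re (\<beta> \<zeta>))" if "\<zeta> \<in> W" for \<zeta>
    proof -
      have "exp (ln (C / cmod (b (e \<zeta>)))) = C / cmod (b (e \<zeta>))" using C bW[OF that] by (simp add: e_def)
      moreover have "cmod (exp (- of_real \<epsilon> * \<beta> \<zeta>)) = exp (- (\<epsilon> * Re (\<beta> \<zeta>)))" by (simp add: norm_exp_eq_Re)
      ultimately show ?thesis unfolding F_def norm_mult norm_divide using C
        by (simp only: exp_diff exp_minus divide_inverse norm_of_real abs_of_pos)
    qed
    have "cmod (F \<zeta>) \<le> 1"
    proof (rule max_mod_limsup[OF W, where f=F])
      show "F holomorphic_on W" unfolding F_def
        by (intro holomorphic_intros \<beta>_hol holomorphic_on_subset[OF be_hol]) (use W_strip bW in \<open>auto simp: e_def\<close>)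
      fix \<xi> and \<delta> :: real assume \<xi>: "\<xi> \<in> frontier W" and \<delta>: "0 < \<delta>"
      have evW: "\<forall>\<^sub>F \<zeta> in at \<xi> within W. \<zeta> \<in> W" by (auto simp: eventually_at_filter)
      have "0 \<le> Im \<xi>" using \<xi> clW_im by (auto simp: frontier_def)
      then consider "0 < Im \<xi>" | "Im \<xi> = 0" by linarith
      then show "\<forall>\<^sub>F \<zeta> in at \<xi> within W. cmod (F \<zeta>) \<le> 1 + \<delta>"
      proof cases
        case 1
        have b\<xi>: "cmod (b (e \<xi>)) = C" using fr_in[OF \<xi> 1] by (simp add: e_def)
        have "isCont (\<lambda>\<zeta>. b (e \<zeta>)) \<xi>"
          using holomorphic_on_imp_continuous_on[OF be_hol] 1
          by (simp add: continuous_on_eq_continuous_at[OF open_halfspace_Im_gt])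
        then have "((\<lambda>\<zeta>. b (e \<zeta>)) \<longlongrightarrow> b (e \<xi>)) (at \<xi> within W)"
          unfolding isCont_def by (rule tendsto_within_subset) simp
        then have "((\<lambda>\<zeta>. C / cmod (b (e \<zeta>))) \<longlongrightarrow> C / cmod (b (e \<xi>))) (at \<xi> within W)"
          using b\<xi> C by (intro tendsto_intros) auto
        then have "\<forall>\<^sub>F \<zeta> in at \<xi> within W. C / cmod (b (e \<zeta>)) < 1 + \<delta>"
          using b\<xi> C \<delta> by (intro order_tendstoD(2)) auto
        then show ?thesis using evW
        proof eventually_elim
          case (elim \<zeta>)
          have "cmod (F \<zeta>) \<le> exp (ln (C / cmod (b (e \<zeta>))))"
            unfolding Fn[OF elim(2)] using \<beta>0[OF elim(2)] \<epsilon> by simp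
          also have "\<dots> = C / cmod (b (e \<zeta>))" using C bW[OF elim(2)] by (simp add: e_def)
          finally show ?case using elim(1) by linarith
        qed
      next
        case 2
        then obtain X where X: "X = x1 \<or> X = x2" "\<xi> = of_real X" using fr_bd[OF \<xi>] by blast
        show ?thesis using corner[OF X(1) \<epsilon>] evW unfolding X(2)[symmetric]
        proof eventually_elim
          case (elim \<zeta>)
          have "cmod (F \<zeta>) \<le> exp 0" unfolding Fn[OF elim(2)] using elim(1) by (subst exp_le_cancel_iff) simp
          then show ?case using \<delta> by simp
        qed
      qed
    qed (use \<zeta> in auto)
    then show ?thesis unfolding Fn[OF \<zeta>] by simp
  qed
  show ?thesis
  proof (rule ccontr)
    assume "W \<noteq> {}"
    then obtain \<zeta> where \<zeta>: "\<zeta> \<in> W" by blast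
    have "((\<lambda>\<epsilon>. \<epsilon> * Re (\<beta> \<zeta>)) \<longlongrightarrow> 0 * Re (\<beta> \<zeta>)) (at_right 0)" by (intro tendsto_intros)
    moreover have "\<forall>\<^sub>F \<epsilon> in at_right 0. ln (C / cmod (b (e \<zeta>))) \<le> \<epsilon> * Re (\<beta> \<zeta>)"
      using eventually_at_right_less[of "0::real"] by eventually_elim (rule key[OF _ \<zeta>])
    ultimately have "ln (C / cmod (b (e \<zeta>))) \<le> 0" using tendsto_lowerbound[of "\<lambda>\<epsilon>. \<epsilon> * Re (\<beta> \<zeta>)" _ "at_right 0"] by auto
    moreover have "1 < C / cmod (b (e \<zeta>))" using bW[OF \<zeta>] by (simp add: e_def)
    ultimately show False by (simp add: ln_gt_zero leD)
  qed
qed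

context schur_function
begin

lemma sigma_b_mono_0: "A \<subseteq> B \<Longrightarrow> B \<inter> sphere 0 1 \<in> sets borel \<Longrightarrow> sigma_b b B = 0 \<Longrightarrow> sigma_b b A = 0"
  unfolding sigma_b_eq_0_iff
  by (metis (no_types, lifting) Int_mono bot.extremum_uniqueI emeasure_mono le_zero_eq order_refl sets_\<nu>)

text \<open>A square is relatively open in the closed disc, so a null square contains a null
  neighbourhood of the midpoint of its arc.\<close>

lemma tendsto_1_null_square:
  assumes z: "cmod z < 1" "z \<noteq> 0" and \<sigma>: "sigma_b b (carleson_square z) = 0"
  shows "((\<lambda>z. cmod (b z)) \<longlongrightarrow> 1) (at (z / of_real (cmod z)) within ball 0 1)"
proof -
  define \<omega> where "\<omega> = z / of_real (cmod z)"
  have \<omega>: "cmod \<omega> = 1" using z by (simp add: \<omega>_def norm_divide)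
  note Qs = carleson_square_sphere[OF z(1), folded \<omega>_def]
  obtain N where N: "open N" "carleson_square z = N \<inter> cball 0 1" using carleson_square_open by blast
  have "\<omega> \<in> carleson_square z \<inter> sphere 0 1" unfolding Qs using \<omega> z by simp
  then have "\<omega> \<in> N" using N(2) by blast
  then obtain d where d: "0 < d" "ball \<omega> d \<subseteq> N" using N(1) openE by blast
  have null: "zeros_in b \<inter> carleson_square z = {}" "emeasure \<nu> (sphere 0 1 \<inter> ball \<omega> ((1 - cmod z) / 2)) = 0"
    using \<sigma> unfolding sigma_b_eq_0_iff Qs by auto
  have "zeros_in b \<inter> ball \<omega> d = {}" using null(1) d(2) N(2) by (auto simp: zeros_in_def)
  moreover have "emeasure \<nu> (ball \<omega> d) = 0"
  proof -
    have sub: "ball \<omega> d \<subseteq> (sphere 0 1 \<inter> ball \<omega> ((1 - cmod z) / 2)) \<union> - sphere 0 1"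
      unfolding Qs[symmetric] using d(2) N(2) by auto
    have "emeasure \<nu> (- sphere 0 1) = 0" using circle_measure_\<nu> by (simp add: circle_measure_def)
    then have "emeasure \<nu> ((sphere 0 1 \<inter> ball \<omega> ((1 - cmod z) / 2)) \<union> - sphere 0 1) = 0"
      using null(2) by (subst emeasure_Un_null_set) (auto simp: null_sets_def)
    then show ?thesis using emeasure_mono[OF sub, of \<nu>] by (simp add: borel_comp)
  qed
  ultimately show ?thesis unfolding \<omega>_def[symmetric] by (intro tendsto_1_near_null_arc[OF \<omega> d(1)])
qed

lemma sublevel_component_contains_0:
  assumes C1: "0 < C1" "C1 < C" "C < 1"
    and H: "\<And>z. cmod z < 1 \<Longrightarrow> z \<noteq> 0 \<Longrightarrow> C1 \<le> cmod (b z) \<Longrightarrow> sigma_b b (carleson_square z) = 0"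
    and x: "cmod x < 1" "cmod (b x) < C"
  shows "0 \<in> connected_component_set {z \<in> ball 0 1. cmod (b z) < C} x"
proof (rule ccontr)
  define \<Omega> where "\<Omega> = {z \<in> ball 0 1. cmod (b z) < C}"
  define V where "V = connected_component_set \<Omega> x"
  assume "\<not> ?thesis"
  then have V0: "0 \<notin> V" by (simp add: V_def \<Omega>_def)
  have bc: "continuous_on (ball 0 1) b" by (rule holomorphic_on_imp_continuous_on[OF hol])
  have b_cont: "isCont b z" if "cmod z < 1" for z
    using bc that by (simp add: continuous_on_eq_continuous_at)
  have "open (ball 0 1 \<inter> (\<lambda>z. cmod (b z)) -` {..<C})" using bc by (intro continuous_open_preimage continuous_intros) auto
  moreover have "ball 0 1 \<inter> (\<lambda>z. cmod (b z)) -` {..<C} = \<Omega>" by (auto simp: \<Omega>_def)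
  ultimately have o\<Omega>: "open \<Omega>" by simp
  have x\<Omega>: "x \<in> \<Omega>" using x by (simp add: \<Omega>_def)
  have V: "open V" "connected V" "V \<subseteq> \<Omega>" "x \<in> V"
    unfolding V_def using o\<Omega> x\<Omega> open_connected_component[of \<Omega> x] connected_component_subset[of \<Omega> x]
    by (simp_all add: connected_component_refl_eq)
  have V_in: "cmod z < 1" "cmod (b z) < C" if "z \<in> V" for z using V(3) that by (auto simp: \<Omega>_def)
  have absorb: "A \<subseteq> V" if "connected A" "A \<subseteq> \<Omega>" "A \<inter> V \<noteq> {}" for A
  proof -
    have "connected (A \<union> V)" using that V by (intro connected_Un) auto
    then have "A \<union> V \<subseteq> V" using that V unfolding V_def by (intro connected_component_maximal) (auto simp: V_def)
    then show ?thesis by blast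
  qed
  \<comment> \<open>By monotonicity every point on the radius below a charged one is charged too,
    and the hypothesis then forces |b| < C1 there.\<close>
  have small: "cmod (b (of_real s * z)) < C1" if z: "cmod z < 1" "z \<noteq> 0" "sigma_b b (carleson_square z) \<noteq> 0" and s: "0 < s" "s \<le> 1" for s z
  proof (rule ccontr)
    let ?z = "of_real s * z"
    assume "\<not> cmod (b ?z) < C1"
    moreover have "cmod ?z \<le> cmod z" using s by (simp add: norm_mult mult_left_le_one_le)
    ultimately have "sigma_b b (carleson_square ?z) = 0" using z s by (intro H) auto
    moreover have "carleson_square ?z \<inter> sphere 0 1 \<in> sets borel"
      using carleson_square_sphere[of ?z] \<open>cmod ?z \<le> cmod z\<close> z(1) by auto
    ultimately have "sigma_b b (carleson_square z) = 0"
      using sigma_b_mono_0[OF carleson_square_mono[OF s]] by blast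
    then show False using z by simp
  qed
  have small0: "cmod (b 0) \<le> C1" if z: "cmod z < 1" "z \<noteq> 0" "sigma_b b (carleson_square z) \<noteq> 0" for z
  proof (rule tendsto_upperbound)
    have "((\<lambda>s. of_real s * z) \<longlongrightarrow> of_real 0 * z) (at_right 0)" by (intro tendsto_intros)
    then have "((\<lambda>s. of_real s * z) \<longlongrightarrow> 0) (at_right 0)" by simp
    from isCont_tendsto_compose[OF b_cont this] show "((\<lambda>s. cmod (b (of_real s * z))) \<longlongrightarrow> cmod (b 0)) (at_right 0)"
      by (intro tendsto_norm) simp
    show "\<forall>\<^sub>F s in at_right 0. cmod (b (of_real s * z)) \<le> C1"
      using eventually_at_right_real[of 0 1, OF zero_less_one] by eventually_elim (use small[OF z] in \<open>force intro: less_imp_le\<close>)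
  qed simp
  \<comment> \<open>Otherwise the whole segment from 0 to z lies in the sublevel set, with |b(0)|
    \<le> C1 < C at its end, and connects \<open>V\<close> to the origin.\<close>
  have V_null: "sigma_b b (carleson_square z) = 0" if z: "z \<in> V" for z
  proof (rule ccontr)
    assume \<sigma>: "sigma_b b (carleson_square z) \<noteq> 0"
    have z1: "cmod z < 1" "z \<noteq> 0" using V_in z V0 by auto
    have "closed_segment 0 z \<subseteq> \<Omega>"
    proof
      fix y assume "y \<in> closed_segment 0 z"
      then obtain s where s: "0 \<le> s" "s \<le> 1" "y = of_real s * z" by (auto simp: in_segment scaleR_conv_of_real)
      have "cmod y < 1" using s z1 by (simp add: norm_mult) (smt (verit) mult_left_le_one_le norm_ge_zero)
      moreover have "cmod (b y) < C"
        using small0[OF z1 \<sigma>] small[OF z1 \<sigma>, of s] s C1 by (cases "s = 0") auto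
      ultimately show "y \<in> \<Omega>" by (simp add: \<Omega>_def)
    qed
    then have "closed_segment 0 z \<subseteq> V" using z by (intro absorb) auto
    then show False using V0 by auto
  qed
  \<comment> \<open>A zero z lies in the square of s * z for s < 1. For s near 1 that point is still
    in \<open>V\<close>, where squares are null.\<close>
  have V_nz: "b z \<noteq> 0" if z: "z \<in> V" for z
  proof
    assume bz: "b z = 0"
    have z1: "cmod z < 1" "z \<noteq> 0" using V_in z V0 by auto
    have "((\<lambda>s. of_real s * z) \<longlongrightarrow> of_real 1 * z) (at_left 1)" by (intro tendsto_intros)
    then have "((\<lambda>s. of_real s * z) \<longlongrightarrow> z) (at_left 1)" by simp
    then have "\<forall>\<^sub>F s in at_left 1. of_real s * z \<in> V" using V(1) z by (rule topological_tendstoD)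
    moreover have "\<forall>\<^sub>F s in at_left (1::real). s \<in> {0<..<1}" by (rule eventually_at_left_real) simp
    ultimately have "\<forall>\<^sub>F s in at_left 1. of_real s * z \<in> V \<and> s \<in> {0<..<1}" by eventually_elim simp
    then obtain s :: real where s: "of_real s * z \<in> V" "0 < s" "s < 1"
      using eventually_happens[of _ "at_left (1::real)"] trivial_limit_at_left_real by auto
    have "z \<in> carleson_square (of_real s * z)"
      using s z1 by (simp add: carleson_square_def norm_mult)
        (smt (verit) mult_left_le_one_le norm_ge_zero)
    then show False using V_null[OF s(1)] bz z1 unfolding sigma_b_eq_0_iff by (auto simp: zeros_in_def)
  qed
  have V_fr: "cmod (b z) = C" if z: "z \<in> closure V" "z \<notin> V" "cmod z < 1" for z
  proof (rule antisym)
    show "C \<le> cmod (b z)"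
    proof (rule ccontr)
      assume "\<not> C \<le> cmod (b z)"
      then have "z \<in> \<Omega>" using z by (simp add: \<Omega>_def)
      then obtain e where e: "0 < e" "ball z e \<subseteq> \<Omega>" using o\<Omega> openE by blast
      then have "ball z e \<inter> V \<noteq> {}" using z(1) by (metis centre_in_ball closure_iff_nhds_not_empty inf_commute open_ball subset_refl)
      then have "ball z e \<subseteq> V" using e by (intro absorb) auto
      then show False using z(2) e(1) centre_in_ball[of z e] by blast
    qed
    have "z islimpt V" using z by (simp add: closure_def)
    then have "at z within V \<noteq> bot" by (simp add: trivial_limit_within)
    moreover have "((\<lambda>w. cmod (b w)) \<longlongrightarrow> cmod (b z)) (at z within V)"
      using b_cont[OF z(3)] unfolding isCont_def by (intro tendsto_norm) (rule tendsto_within_subset, auto)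
    moreover have "\<forall>\<^sub>F w in at z within V. cmod (b w) \<le> C"
      using V_in by (auto simp: eventually_at_filter less_imp_le)
    ultimately show "cmod (b z) \<le> C" by (intro tendsto_upperbound)
  qed
  \<comment> \<open>A null square on the radius would give |b| \<rightarrow> 1 at \<xi>, while |b| <
    C on points of \<open>V\<close> tending to \<xi>.\<close>
  have radius: "sigma_b b (carleson_square (of_real s * \<xi>)) \<noteq> 0" if \<xi>: "\<xi> \<in> closure V" "cmod \<xi> = 1" and s: "0 < s" "s < 1" for \<xi> s
  proof
    let ?z = "of_real s * \<xi>"
    assume \<sigma>: "sigma_b b (carleson_square ?z) = 0"
    have "?z / of_real (cmod ?z) = \<xi>" using \<xi> s by (simp add: norm_mult)
    then have lim: "((\<lambda>z. cmod (b z)) \<longlongrightarrow> 1) (at \<xi> within ball 0 1)"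
      using tendsto_1_null_square[OF _ _ \<sigma>] \<xi> s norm_zero[where 'a=complex] by (force simp: norm_mult)
    have "V \<subseteq> ball 0 1" using V_in by auto
    then have "((\<lambda>z. cmod (b z)) \<longlongrightarrow> 1) (at \<xi> within V)" by (rule tendsto_within_subset[OF lim])
    moreover have "\<xi> \<notin> V" using V_in \<xi> by force
    then have "\<xi> islimpt V" using \<xi> by (simp add: closure_def)
    then have "at \<xi> within V \<noteq> bot" by (simp add: trivial_limit_within)
    moreover have "\<forall>\<^sub>F w in at \<xi> within V. cmod (b w) \<le> C"
      using V_in by (auto simp: eventually_at_filter less_imp_le)
    ultimately have "1 \<le> C" by (intro tendsto_upperbound)
    then show False using C1 by simp
  qed
  have clV: "closure V \<subseteq> cball 0 1" by (rule closure_minimal) (use V_in(1) in \<open>force+\<close>)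
  show False
  proof (cases "\<exists>\<xi>\<in>closure V. cmod \<xi> = 1")
    \<comment> \<open>Without boundary points on the circle |b| = C on the whole frontier, and the
      maximum principle for C / b contradicts |b(x)| < C.\<close>
    case False
    have "cmod (of_real C / b x) \<le> 1"
    proof (rule max_mod_limsup[OF V(1), where f="\<lambda>z. of_real C / b z"])
      show "bounded V" using clV by (meson bounded_cball bounded_closure bounded_subset closure_subset)
      show "(\<lambda>z. of_real C / b z) holomorphic_on V"
        using V_nz V_in by (intro holomorphic_intros holomorphic_on_subset[OF hol]) auto
      fix \<xi> and \<epsilon> :: real assume \<xi>: "\<xi> \<in> frontier V" and \<epsilon>: "0 < \<epsilon>"
      then have \<xi>c: "\<xi> \<in> closure V" "\<xi> \<notin> V" using V(1) by (auto simp: frontier_def interior_open)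
      then have \<xi>1: "cmod \<xi> < 1" using False clV by force
      have b\<xi>: "cmod (b \<xi>) = C" by (rule V_fr[OF \<xi>c \<xi>1])
      have "(b \<longlongrightarrow> b \<xi>) (at \<xi> within V)" using b_cont[OF \<xi>1] unfolding isCont_def by (rule tendsto_within_subset) simp
      then have "((\<lambda>z. cmod (of_real C / b z)) \<longlongrightarrow> cmod (of_real C / b \<xi>)) (at \<xi> within V)"
        using b\<xi> C1 by (intro tendsto_intros) auto
      moreover have "cmod (of_real C / b \<xi>) < 1 + \<epsilon>" using b\<xi> C1 \<epsilon> by (simp add: norm_divide)
      ultimately have "\<forall>\<^sub>F z in at \<xi> within V. cmod (of_real C / b z) < 1 + \<epsilon>" by (rule order_tendstoD(2))
      then show "\<forall>\<^sub>F z in at \<xi> within V. cmod (of_real C / b z) \<le> 1 + \<epsilon>" by eventually_elim simp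
    qed (rule V(4))
    then show False using V_nz[OF V(4)] V_in[OF V(4)] C1 by (simp add: norm_divide field_simps)
  next
    case True
    then obtain \<xi>0 where \<xi>0: "\<xi>0 \<in> closure V" "cmod \<xi>0 = 1" by blast
    define e where "e \<zeta> = exp (\<i> * \<zeta>)" for \<zeta> :: complex
    have e_norm: "cmod (e \<zeta>) = exp (- Im \<zeta>)" for \<zeta> by (simp add: e_def)
    have e_cont: "continuous_on A e" for A unfolding e_def by (intro continuous_intros)
    have e_split: "e \<zeta> = of_real (exp (- Im \<zeta>)) * e (of_real (Re \<zeta>))" for \<zeta>
    proof -
      have "\<i> * \<zeta> = of_real (- Im \<zeta>) + \<i> * of_real (Re \<zeta>)" by (simp add: complex_eq_iff)
      then show ?thesis unfolding e_def by (simp only: exp_add exp_of_real)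
    qed
    \<comment> \<open>The squares on such a radius are charged, those of points of \<open>V\<close>
      are null, so the radius cannot meet \<open>V\<close>.\<close>
    have miss: "e \<zeta> \<notin> V" if "0 < Im \<zeta>" "e (of_real (Re \<zeta>)) \<in> closure V" for \<zeta>
    proof
      assume "e \<zeta> \<in> V"
      then have "sigma_b b (carleson_square (of_real (exp (- Im \<zeta>)) * e (of_real (Re \<zeta>)))) = 0"
        using V_null e_split by metis
      moreover have "cmod (e (of_real (Re \<zeta>))) = 1" by (simp add: e_norm)
      ultimately show False using radius[OF that(2), of "exp (- Im \<zeta>)"] that(1) by simp
    qed
    \<comment> \<open>Any point on the charged radius gives |b(0)| \<le> C1. As |b| = C on the
      frontier inside the disc, \<open>V\<close> stays away from the origin, and its lift has
      bounded height.\<close>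
    have "cmod (of_real (1/2) * \<xi>0) < 1" "of_real (1/2) * \<xi>0 \<noteq> 0" using \<xi>0 by (auto simp: norm_mult)
    from small0[OF this radius[OF \<xi>0, of "1/2"]] have "cmod (b 0) \<le> C1" by simp
    then have "0 \<notin> closure V" using V_fr[of 0] V0 C1 by auto
    then obtain \<rho> where \<rho>: "0 < \<rho>" "ball 0 \<rho> \<subseteq> - closure V" using openE[of "- closure V" 0] by auto
    have V_ge: "\<rho> \<le> cmod z" if "z \<in> V" for z using \<rho>(2) that closure_subset[of V] by force
    \<comment> \<open>The angles whose whole open radius misses \<open>V\<close>. The set is closed
      as an intersection of preimages of the closed complement of \<open>V\<close>, so nearest
      angles on either side of a given one exist.\<close>
    define T where "T = (\<Inter>y\<in>{0<..}. (\<lambda>x. e (Complex x y)) -` (- V))"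
    have cT: "closed T" unfolding T_def
    proof (intro closed_INT ballI closed_vimage)
      show "closed (- V)" using V(1) by (simp add: closed_def)
      show "continuous_on UNIV (\<lambda>x. e (Complex x y))" for y
        unfolding e_def Complex_eq by (intro continuous_intros)
    qed
    have T_iff: "r \<in> T \<longleftrightarrow> (\<forall>\<zeta>. 0 < Im \<zeta> \<longrightarrow> Re \<zeta> = r \<longrightarrow> e \<zeta> \<notin> V)" for r
    proof (intro iffI allI impI)
      fix \<zeta> assume r: "r \<in> T" "0 < Im \<zeta>" "Re \<zeta> = r"
      then have "e (Complex r (Im \<zeta>)) \<notin> V" by (simp add: T_def)
      moreover have "Complex r (Im \<zeta>) = \<zeta>" using r by (simp add: complex_eq_iff)
      ultimately show "e \<zeta> \<notin> V" by simp
    qed (simp add: T_def)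
    have T_cl: "r \<in> T" if "e (of_real r) \<in> closure V" for r
      unfolding T_iff using miss that by auto
    define x0 where "x0 = Arg2pi \<xi>0"
    have x0: "\<xi>0 = e (of_real x0)" using complex_norm_eq_1_exp[of \<xi>0] \<xi>0(2) by (simp add: e_def x0_def)
    have e_per: "e (of_real (x0 + 2 * pi * of_int k)) = \<xi>0" for k :: int
    proof -
      have "\<i> * of_real (x0 + 2 * pi * of_int k) = \<i> * of_real x0 + of_int k * (of_real (2 * pi) * \<i>)" by (simp add: algebra_simps)
      then show ?thesis unfolding e_def x0 by (simp only: exp_add) (simp add: exp_eq_1)
    qed
    \<comment> \<open>The lifts of the single point \<xi>0 recur with period 2 * pi, so
      \<open>T\<close> has elements on both sides of the angle of x.\<close>
    have T_per: "x0 + 2 * pi * of_int k \<in> T" for k :: int using T_cl[of "x0 + 2 * pi * of_int k"] e_per \<xi>0(1) by simp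
    have x00: "x \<noteq> 0" using V(4) V0 by auto
    define \<zeta>w where "\<zeta>w = - \<i> * Ln x"
    have ew: "e \<zeta>w = x" "0 < Im \<zeta>w" using x00 x(1) by (auto simp: e_def \<zeta>w_def)
    define xw where "xw = Re \<zeta>w"
    have xwT: "xw \<notin> T" unfolding T_iff xw_def using ew V(4) by auto
    obtain k1 :: int where k1: "x0 + 2 * pi * of_int k1 \<le> xw"
    proof
      show "x0 + 2 * pi * of_int \<lfloor>(xw - x0) / (2 * pi)\<rfloor> \<le> xw"
      proof -
        have "of_int \<lfloor>(xw - x0) / (2 * pi)\<rfloor> * (2 * pi) \<le> xw - x0"
          by (subst pos_le_divide_eq[symmetric]) auto
        then show ?thesis by (simp only: mult.commute[of "2 * pi"]; linarith)
      qed
    qed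
    obtain k2 :: int where k2: "xw \<le> x0 + 2 * pi * of_int k2"
    proof
      show "xw \<le> x0 + 2 * pi * of_int \<lceil>(xw - x0) / (2 * pi)\<rceil>"
      proof -
        have "xw - x0 \<le> of_int \<lceil>(xw - x0) / (2 * pi)\<rceil> * (2 * pi)"
          by (subst pos_divide_le_eq[symmetric]) auto
        then show ?thesis by (simp only: mult.commute[of "2 * pi"]; linarith)
      qed
    qed
    define x1 where "x1 = Sup (T \<inter> {..xw})" define x2 where "x2 = Inf (T \<inter> {xw..})"
    have ne1: "T \<inter> {..xw} \<noteq> {}" and ne2: "T \<inter> {xw..} \<noteq> {}" using T_per k1 k2 by auto
    have x1T: "x1 \<in> T \<inter> {..xw}" unfolding x1_def using cT ne1 by (intro closed_contains_Sup) auto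
    have x2T: "x2 \<in> T \<inter> {xw..}" unfolding x2_def using cT ne2 by (intro closed_contains_Inf) auto
    have gap: "r = x1 \<or> r = x2" if r: "r \<in> T" "x1 \<le> r" "r \<le> x2" for r
    proof (cases "r \<le> xw")
      case True
      then have "r \<le> x1" unfolding x1_def using r by (intro cSup_upper) auto
      then show ?thesis using r by simp
    next
      case False
      then have "x2 \<le> r" unfolding x2_def using r by (intro cInf_lower) auto
      then show ?thesis using r by simp
    qed
    have xw12: "x1 < xw" "xw < x2" using x1T x2T xwT by (auto simp: less_le)
    define S where "S = {\<zeta>. x1 < Re \<zeta>} \<inter> {\<zeta>. Re \<zeta> < x2} \<inter> {\<zeta>. 0 < Im \<zeta>}"
    \<comment> \<open>Only the part of the preimage over one gap of \<open>T\<close> is taken. This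
      confines the lift to a strip without choosing a branch of the logarithm on
      \<open>V\<close>.\<close>
    define W where "W = S \<inter> e -` V"
    have oS: "open S" unfolding S_def by (intro open_Int open_halfspace_Re_gt open_halfspace_Re_lt open_halfspace_Im_gt)
    have oW: "open W" unfolding W_def by (intro continuous_open_preimage e_cont oS V(1))
    have clW: "x1 \<le> Re \<zeta> \<and> Re \<zeta> \<le> x2 \<and> 0 \<le> Im \<zeta>" "e \<zeta> \<in> closure V" if \<zeta>: "\<zeta> \<in> closure W" for \<zeta>
    proof -
      have "closure W \<subseteq> {\<zeta>. x1 \<le> Re \<zeta>} \<inter> {\<zeta>. Re \<zeta> \<le> x2} \<inter> {\<zeta>. 0 \<le> Im \<zeta>}"
        by (intro closure_minimal closed_Int closed_halfspace_Re_ge closed_halfspace_Re_le closed_halfspace_Im_ge) (auto simp: W_def S_def)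
      then show "x1 \<le> Re \<zeta> \<and> Re \<zeta> \<le> x2 \<and> 0 \<le> Im \<zeta>" using \<zeta> by blast
      have "closure W \<subseteq> e -` closure V"
        by (intro closure_minimal closed_vimage e_cont) (use closure_subset[of V] in \<open>auto simp: W_def\<close>)
      then show "e \<zeta> \<in> closure V" using \<zeta> by blast
    qed
    have bW: "bounded W"
    proof (rule boundedI)
      fix \<zeta> assume \<zeta>: "\<zeta> \<in> W"
      then have "\<rho> \<le> exp (- Im \<zeta>)" using V_ge[of "e \<zeta>"] e_norm by (simp add: W_def)
      then have "ln \<rho> \<le> - Im \<zeta>" using \<rho>(1) by (metis exp_gt_zero ln_exp ln_le_cancel_iff)
      moreover have "0 < Im \<zeta>" "x1 < Re \<zeta>" "Re \<zeta> < x2" using \<zeta> by (auto simp: W_def S_def)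
      ultimately have "\<bar>Re \<zeta>\<bar> + \<bar>Im \<zeta>\<bar> \<le> (\<bar>x1\<bar> + \<bar>x2\<bar>) + \<bar>ln \<rho>\<bar>" by linarith
      then show "cmod \<zeta> \<le> (\<bar>x1\<bar> + \<bar>x2\<bar>) + \<bar>ln \<rho>\<bar>" using cmod_le[of \<zeta>] by linarith
    qed
    obtain zs where zs: "cmod zs < 1" "b zs \<noteq> 0" using nz by (metis mem_ball_0)
    have "W = {}"
    proof (rule component_lift_empty[OF hol _ zs _ C1(3) oW bW])
      show "cmod (b z) \<le> 1" if "cmod z < 1" for z using le_1 that by simp
      show "0 < C" using C1 by simp
      show "x1 < Re \<zeta> \<and> Re \<zeta> < x2 \<and> 0 < Im \<zeta>" if "\<zeta> \<in> W" for \<zeta> using that by (auto simp: W_def S_def)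
      show "b (exp (\<i> * \<zeta>)) \<noteq> 0 \<and> cmod (b (exp (\<i> * \<zeta>))) < C" if "\<zeta> \<in> W" for \<zeta>
        using that V_nz[of "e \<zeta>"] V_in[of "e \<zeta>"] by (simp add: W_def e_def)
      fix \<zeta> assume "\<zeta> \<in> frontier W"
      then have \<zeta>: "\<zeta> \<in> closure W" "\<zeta> \<notin> W" using oW by (auto simp: frontier_def interior_open)
      show "cmod (b (exp (\<i> * \<zeta>))) = C" if im: "0 < Im \<zeta>"
      proof -
        \<comment> \<open>On the vertical sides the angle belongs to \<open>T\<close>, so the image
          misses \<open>V\<close>; the sides thus contribute no frontier points with |b| <
          C.\<close>
        have "e \<zeta> \<notin> V"
        proof
          assume eV: "e \<zeta> \<in> V"
          then have "Re \<zeta> \<notin> T" unfolding T_iff using im by blast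
          then have "Re \<zeta> \<noteq> x1" "Re \<zeta> \<noteq> x2" using x1T x2T by auto
          then have "\<zeta> \<in> W" using clW(1)[OF \<zeta>(1)] im eV by (auto simp: W_def S_def less_le)
          then show False using \<zeta> by simp
        qed
        then show ?thesis using V_fr[OF clW(2)[OF \<zeta>(1)]] im e_norm by (simp add: e_def)
      qed
      show "\<zeta> = of_real x1 \<or> \<zeta> = of_real x2" if im: "Im \<zeta> = 0"
      proof -
        have eq: "\<zeta> = of_real (Re \<zeta>)" using im by (simp add: complex_eq_iff)
        then have "Re \<zeta> \<in> T" using T_cl clW(2)[OF \<zeta>(1)] by metis
        then show ?thesis using gap[of "Re \<zeta>"] clW(1)[OF \<zeta>(1)] eq by metis
      qed
    qed
    moreover have "\<zeta>w \<in> W" using xw12 ew V(4) by (auto simp: W_def S_def xw_def)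
    ultimately show False by blast
  qed
qed

lemma one_component_if:
  assumes C1: "0 < C1" "C1 < 1"
    and H: "\<And>z. cmod z < 1 \<Longrightarrow> z \<noteq> 0 \<Longrightarrow> C1 \<le> cmod (b z) \<Longrightarrow> sigma_b b (carleson_square z) = 0"
  shows "one_component b"
proof -
  \<comment> \<open>Strictly above C1, so that the bound |b(0)| \<le> C1, obtained as a limit along
    a radius, puts the origin in the sublevel set.\<close>
  define C where "C = (1 + C1) / 2"
  have C: "0 < C" "C1 < C" "C < 1" using C1 by (auto simp: C_def)
  \<comment> \<open>If \<xi> were away from this closure, then |b| > C > C1 at points of the radius
    near \<xi>. Their squares are null, so |b| \<rightarrow> 1 at \<xi>, which is then not in the
    spectrum.\<close>
  have "spec b \<subseteq> closure {z \<in> ball 0 1. cmod (b z) \<le> C}"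
  proof (rule ccontr)
    assume "\<not> ?thesis"
    then obtain \<xi> where \<xi>: "\<xi> \<in> spec b" "\<xi> \<in> - closure {z \<in> ball 0 1. cmod (b z) \<le> C}" by blast
    have \<xi>1: "cmod \<xi> = 1" using \<xi> by (simp add: spec_def)
    have "((\<lambda>s. of_real s * \<xi>) \<longlongrightarrow> of_real 1 * \<xi>) (at_left 1)" by (intro tendsto_intros)
    then have "((\<lambda>s. of_real s * \<xi>) \<longlongrightarrow> \<xi>) (at_left 1)" by simp
    then have "\<forall>\<^sub>F s in at_left 1. of_real s * \<xi> \<in> - closure {z \<in> ball 0 1. cmod (b z) \<le> C}"
      by (rule topological_tendstoD) (use \<xi> in auto)
    moreover have "\<forall>\<^sub>F s in at_left (1::real). s \<in> {0<..<1}" by (rule eventually_at_left_real) simp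
    ultimately have "\<forall>\<^sub>F s in at_left 1. of_real s * \<xi> \<in> - closure {z \<in> ball 0 1. cmod (b z) \<le> C} \<and> s \<in> {0<..<1}" by eventually_elim simp
    from eventually_happens[OF this] obtain s :: real
      where s: "of_real s * \<xi> \<in> - closure {z \<in> ball 0 1. cmod (b z) \<le> C}" "0 < s" "s < 1"
      by (auto simp: trivial_limit_at_left_real simp del: Compl_iff)
    have z1: "cmod (of_real s * \<xi>) < 1" "of_real s * \<xi> \<noteq> 0" using s \<xi>1 by (auto simp: norm_mult)
    have "of_real s * \<xi> \<notin> {z \<in> ball 0 1. cmod (b z) \<le> C}"
    proof
      assume "of_real s * \<xi> \<in> {z \<in> ball 0 1. cmod (b z) \<le> C}"
      from subsetD[OF closure_subset this] show False using s(1) by simp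
    qed
    then have "C1 \<le> cmod (b (of_real s * \<xi>))" using z1 C by auto
    from tendsto_1_null_square[OF z1 H[OF z1 this]]
    have "((\<lambda>z. cmod (b z)) \<longlongrightarrow> 1) (at \<xi> within ball 0 1)" using s \<xi>1 by (simp add: norm_mult)
    from tendsto_1_not_spec[OF this \<xi>1] show False using \<xi> by simp
  qed
  moreover have "connected {z \<in> ball 0 1. cmod (b z) < C}"
    unfolding connected_iff_connected_component
  proof (intro ballI)
    fix x y assume "x \<in> {z \<in> ball 0 1. cmod (b z) < C}" "y \<in> {z \<in> ball 0 1. cmod (b z) < C}"
    then have "connected_component {z \<in> ball 0 1. cmod (b z) < C} x 0" "connected_component {z \<in> ball 0 1. cmod (b z) < C} y 0"
      using sublevel_component_contains_0[OF C1(1) C(2,3) H] by auto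
    then show "connected_component {z \<in> ball 0 1. cmod (b z) < C} x y"
      by (meson connected_component_sym connected_component_trans)
  qed
  ultimately show ?thesis unfolding one_component_def using C by blast
qed

end

theorem theorem1p1:
  fixes b :: "complex \<Rightarrow> complex"
  assumes "Hinf b" and "sup_norm b = 1"
  shows "one_component b \<longleftrightarrow>
    (\<exists>C1::real. 0 < C1 \<and> C1 < 1 \<and>
       (\<forall>z \<in> ball 0 1 - {0}. cmod (b z) \<ge> C1 \<longrightarrow> sigma_b b (carleson_square z) = 0))"
proof -
  have hol: "b holomorphic_on ball 0 1" and "bounded (b ` ball 0 1)" using assms(1) by (auto simp: Hinf_def)
  then have "bounded ((\<lambda>z. cmod (b z)) ` ball 0 1)"
    unfolding bounded_iff by auto
  then have bdd: "bdd_above ((\<lambda>z. cmod (b z)) ` ball 0 1)" by (rule bounded_imp_bdd_above)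
  have sup: "(SUP z\<in>ball 0 1. cmod (b z)) = 1" using assms(2) by (simp add: sup_norm_def)
  have near: "\<exists>z\<in>ball 0 1. 1 - \<epsilon> < cmod (b z)" if "0 < \<epsilon>" for \<epsilon>
    using less_cSUP_iff[OF _ bdd, of "1 - \<epsilon>"] sup that by auto
  interpret schur_function b
  proof
    show "b holomorphic_on ball 0 1" by (rule hol)
    show "\<forall>z\<in>ball 0 1. cmod (b z) \<le> 1" using cSUP_upper[OF _ bdd] sup by auto
    show "\<exists>w\<in>ball 0 1. b w \<noteq> 0" using near[of 1] by auto
  qed
  show ?thesis
  proof
    assume "one_component b"
    then show "\<exists>C1::real. 0 < C1 \<and> C1 < 1 \<and>
       (\<forall>z \<in> ball 0 1 - {0}. cmod (b z) \<ge> C1 \<longrightarrow> sigma_b b (carleson_square z) = 0)"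
      using near by (rule one_component_imp)
  next
    assume "\<exists>C1::real. 0 < C1 \<and> C1 < 1 \<and>
       (\<forall>z \<in> ball 0 1 - {0}. cmod (b z) \<ge> C1 \<longrightarrow> sigma_b b (carleson_square z) = 0)"
    then show "one_component b" using one_component_if by auto
  qed
qed

end
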